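(* Suppose $\{\gamma_1,\gamma_2\}\subset\mathbb Z$ and $\gamma\notin\mathbb Z$, and let $\phi_1$ be the Laplace transform of the lateral invariant measure $\boldsymbol\nu_1$. In each case below there is a constant $c$ such that the stated formula holds for $\mathfrak{Re}(y)\le0$ (removable singularities filled in). (1) If either ($\gamma_1\in-2\mathbb N$ and $\gamma_2\in2\mathbb N$) or ($\gamma_1\in2\mathbb N-1$ and $\gamma_2\in-2\mathbb N+1$), then there exist polynomials $P$ and $Q$ such that $$\phi_1(y)=c\,\frac{P(y)\tan\left(\frac{\pi}{2}\sqrt{2y+\mu_1^2}\right)}{Q(y)\sqrt{2y+\mu_1^2}}.$$ Here $P(y)=\prod_{k=0}^{\frac{\gamma_2}{2}-1}(y-\mathrm y(s_2-k))$ and $Q(y)=\prod_{k=0}^{-\frac{\gamma_1}{2}-1}(y-\mathrm y(s_1-k))$ in the former case, and $P(y)=\prod_{k=1}^{\frac{\gamma_1-1}{2}}(y-\mathrm y(s_1+k))$ and $Q(y)=\prod_{k=1}^{-\frac{\gamma_2+1}{2}}(y-\mathrm y(s_2+k))$ in the latter. (2) If either ($\gamma_1\in2\mathbb N$ and $\gamma_2\in-2\mathbb N$) or ($\gamma_1\in-2\mathbb N+1$ and $\gamma_2\in2\mathbb N-1$), then there exist polynomials $P$ and $Q$ such that $$\phi_1(y)=c\,\frac{P(y)\sqrt{2y+\mu_1^2}}{Q(y)\tan\left(\frac{\pi}{2}\sqrt{2y+\mu_1^2}\right)}.$$ Here $P(y)=\prod_{k=1}^{\frac{\gamma_1}{2}-1}(y-\mathrm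 y(s_1+k))$ and $Q(y)=\prod_{k=1}^{-\frac{\gamma_2}{2}}(y-\mathrm y(s_2+k))$ in the former case, and $P(y)=\prod_{k=0}^{\frac{\gamma_2-1}{2}-1}(y-\mathrm y(s_2-k))$ and $Q(y)=\prod_{k=0}^{-\frac{\gamma_1+1}{2}}(y-\mathrm y(s_1-k))$ in the latter. (3) If $\gamma_1\in\mathbb N$ and $\gamma_2\in\mathbb N$, then there exists a polynomial $P\in\mathbb R[X]$ such that $$\phi_1(y)=c\,\frac{P(y)\sqrt{2y+\mu_1^2}}{\sin\left(\pi\sqrt{2y+\mu_1^2}\right)}.$$ Here $P(y)=\prod_{k=1}^{\lfloor\frac{\gamma_1-1}{2}\rfloor}(y-\mathrm y(s_1+k))\prod_{k=0}^{\lfloor\frac{\gamma_2}{2}-1\rfloor}(y-\mathrm y(s_2-k))$.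
   Context: $\mathbb N=\{1,2,3,\dots\}$, so $-2\mathbb N+1=\{-1,-3,\dots\}$ and $2\mathbb N-1=\{1,3,\dots\}$; empty products equal $1$. The functions $z\mapsto\sin(\sqrt z)/\sqrt z$ and $z\mapsto\tan(\sqrt z)/\sqrt z$ are meromorphic on $\mathbb C$ (independent of the choice of square root). Parameters: $r_1,r_2\in\mathbb R$ and $\mu_1,\mu_2>0$ with $\mu_1+\mu_2=1$, such that ($1-r_1r_2>0$, or $r_1>0$ and $r_2>0$), $\mu_1-r_2\mu_2>0$, $\mu_2-r_1\mu_1>0$, $r_1\neq -1$ and $r_2\neq -1$. Process: $\mathbf G=(G_1,G_2)$ is the degenerate obliquely reflected Brownian motion in $\mathbb R_+^2$, i.e. the continuous semimartingale with values in $\mathbb R_+^2$ satisfying $$G_1(t)=G_1(0)-\mu_1t+\widetilde W_1(t)+L_1(t)+r_2L_2(t),\qquad G_2(t)=G_2(0)-\mu_2t+\widetilde W_2(t)+r_1L_1(t)+L_2(t),$$ where $(\widetilde W_1,\widetilde W_2)$ is a centered Brownian motion with (singular) covariance matrix $\begin{pmatrix}1&-1\\-1&1\end{pmatrix}$ and $L_i$ (the local time of $G_i$ at $0$) is continuous, nondecreasing, $L_i(0)=0$, and increases only when $G_i=0$. Under the assumptions above this process is positive recurrent with a unique invariant probability measure $\boldsymbol\pi$. For Borel $A\subset(0,\infty)$, $\boldsymbol\nu_1(A)=\mathbb E_{\boldsymbol\pi}\int_0^2\mathbf 1_A(G_2(t))\,\mathrm dL_1(t)$, and $\phi_1(y)=\int_{(0,\infty)}e^{yv}\,\boldsymbol\nu_1(\mathrm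 dv)$ for $\mathfrak{Re}(y)\le0$. Further notation: $\mathrm y(s)=2s(s-\mu_1)$, $s_1=\dfrac{r_1\mu_1-\mu_2}{1+r_1}$, $s_2=\dfrac{\mu_1-r_2\mu_2}{1+r_2}$, $\gamma=s_2-s_1$, $\gamma_1=\mu_1-2s_1$, $\gamma_2=\mu_2+2s_2$. *)

theory Defs
  imports "HOL-Probability.Probability" "HOL-Computational_Algebra.Polynomial"
begin

definition centered_normal :: "real \<Rightarrow> real measure" where
  "centered_normal v =
     (if v = 0 then return borel 0 else density lborel (normal_density 0 (sqrt v)))"

text \<open>Time is \<open>[0, \<infinity>)\<close>: processes are indexed by \<^typ>\<open>real\<close>, but only their values at nonnegative
  times are constrained. The increments are Gaussian vectors, i.e. all their linear functionals
  are normally distributed; \<open>\<Sigma>\<close> may be singular.\<close>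

definition brownian_motion ::
  "'a measure \<Rightarrow> (real \<Rightarrow> 'a measure) \<Rightarrow> real ^ 'n ^ 'n \<Rightarrow> (real \<Rightarrow> 'a \<Rightarrow> real ^ 'n) \<Rightarrow> bool" where
  "brownian_motion M F \<Sigma> W \<longleftrightarrow>
     (\<forall>t\<ge>0. W t \<in> borel_measurable (F t)) \<and>
     (AE \<omega> in M. W 0 \<omega> = 0 \<and> continuous_on {0..} (\<lambda>t. W t \<omega>)) \<and>
     (\<forall>s\<ge>0. \<forall>t\<ge>s.
        prob_space.indep_set M (sets (F s))
          (sets (vimage_algebra (space M) (\<lambda>\<omega>. W t \<omega> - W s \<omega>) borel)) \<and>
        (\<forall>\<theta>. distr M borel (\<lambda>\<omega>. \<theta> \<bullet> (W t \<omega> - W s \<omega>))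
              = centered_normal ((t - s) * (\<theta> \<bullet> (\<Sigma> *v \<theta>)))))"

text \<open>The Lebesgue--Stieltjes measure \<open>dl\<close> on \<open>[0, \<infinity>)\<close> of a continuous nondecreasing
  \<open>l : [0, \<infinity>) \<rightarrow> \<real>\<close>.\<close>

definition stieltjes :: "(real \<Rightarrow> real) \<Rightarrow> real measure" where
  "stieltjes l = interval_measure (\<lambda>t. l (max 0 t))"

text \<open>That \<open>L\<^sub>i\<close> increases only when \<open>G\<^sub>i = 0\<close> means \<open>\<integral> 1{G\<^sub>i \<noteq> 0} dL\<^sub>i = 0\<close>.\<close>

definition degenerate_reflected_BM ::
  "real \<Rightarrow> real \<Rightarrow> real \<Rightarrow> real \<Rightarrow> 'a measure \<Rightarrow> (real \<Rightarrow> 'a measure) \<Rightarrow>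
   (real \<Rightarrow> 'a \<Rightarrow> real ^ 2) \<Rightarrow> (real \<Rightarrow> 'a \<Rightarrow> real ^ 2) \<Rightarrow> (real \<Rightarrow> 'a \<Rightarrow> real ^ 2) \<Rightarrow> bool" where
  "degenerate_reflected_BM r\<^sub>1 r\<^sub>2 \<mu>\<^sub>1 \<mu>\<^sub>2 M F W G L \<longleftrightarrow>
     prob_space M \<and> filtration (space M) F \<and> (\<forall>t. subalgebra M (F t)) \<and>
     brownian_motion M F (vector [vector [1, -1], vector [-1, 1]]) W \<and>
     (\<forall>t\<ge>0. G t \<in> borel_measurable (F t) \<and> L t \<in> borel_measurable (F t)) \<and>
     (AE \<omega> in M.
        continuous_on {0..} (\<lambda>t. G t \<omega>) \<and> continuous_on {0..} (\<lambda>t. L t \<omega>) \<and>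
        (\<forall>t\<ge>0. \<forall>i. 0 \<le> G t \<omega> $ i) \<and>
        (\<forall>t\<ge>0.
           G t \<omega> $ 1 = G 0 \<omega> $ 1 - \<mu>\<^sub>1 * t + W t \<omega> $ 1 + L t \<omega> $ 1 + r\<^sub>2 * L t \<omega> $ 2 \<and>
           G t \<omega> $ 2 = G 0 \<omega> $ 2 - \<mu>\<^sub>2 * t + W t \<omega> $ 2 + r\<^sub>1 * L t \<omega> $ 1 + L t \<omega> $ 2) \<and>
        (\<forall>i. L 0 \<omega> $ i = 0 \<and> mono_on {0..} (\<lambda>t. L t \<omega> $ i) \<and>
             (AE t in stieltjes (\<lambda>t. L t \<omega> $ i). G t \<omega> $ i = 0)))"

text \<open>\<open>\<pi>\<close> is an invariant law of the Markov process realized by \<open>G\<close>: started from \<open>G 0\<close> with law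
  \<open>\<pi>\<close>, i.e. under \<open>P\<^sub>\<pi>\<close>, the process has law \<open>\<pi>\<close> at every time. In particular integration with
  respect to \<open>M\<close> is the expectation \<open>E\<^sub>\<pi>\<close>.\<close>

definition invariant_law :: "(real ^ 2) measure \<Rightarrow> 'a measure \<Rightarrow> (real \<Rightarrow> 'a \<Rightarrow> real ^ 2) \<Rightarrow> bool" where
  "invariant_law \<pi> M G \<longleftrightarrow> (\<forall>t\<ge>0. distr M borel (G t) = \<pi>)"

definition lateral_measure_1 ::
  "'a measure \<Rightarrow> (real \<Rightarrow> 'a \<Rightarrow> real ^ 2) \<Rightarrow> (real \<Rightarrow> 'a \<Rightarrow> real ^ 2) \<Rightarrow> real measure" where
  "lateral_measure_1 M G L =
     measure_of {0<..} (sets (restrict_space borel {0<..}))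
       (\<lambda>A. \<integral>\<^sup>+\<omega>. (\<integral>\<^sup>+t\<in>{0..2}. indicator A (G t \<omega> $ 2) \<partial>stieltjes (\<lambda>t. L t \<omega> $ 1)) \<partial>M)"

definition laplace :: "real measure \<Rightarrow> complex \<Rightarrow> complex" where
  "laplace \<nu> y = (\<integral>v. exp (y * of_real v) \<partial>\<nu>)"

definition y_par :: "real \<Rightarrow> real \<Rightarrow> real" where
  "y_par \<mu>\<^sub>1 s = 2 * s * (s - \<mu>\<^sub>1)"

abbreviation cpoly :: "real poly \<Rightarrow> complex \<Rightarrow> complex" where
  "cpoly P z \<equiv> poly (map_poly of_real P) z"

text \<open>Equality on the closed left half-plane with a function having isolated singularities, all
  those in the half-plane being removable and filled in: the value at \<open>y\<close> is the limit at \<open>y\<close>.\<close>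

definition eq_on_left_half_plane :: "(complex \<Rightarrow> complex) \<Rightarrow> (complex \<Rightarrow> complex) \<Rightarrow> bool" where
  "eq_on_left_half_plane \<phi> f \<longleftrightarrow> (\<forall>y. Re y \<le> 0 \<longrightarrow> (f \<longlongrightarrow> \<phi> y) (at y))"

end

theory Submission
  imports Defs "HOL-Complex_Analysis.Complex_Analysis"
begin

text \<open>Write \<open>\<Phi>\<^sub>1\<close> and \<open>\<Phi>\<^sub>2\<close> for the Laplace transforms of the two lateral measures, the corner \<open>0\<close>
  included. The kernel of the process vanishes on the curve
  \<open>x = 2 s (s + \<mu>\<^sub>2)\<close>, \<open>y = 2 s (s - \<mu>\<^sub>1)\<close>, and there invariance reduces to
  \<open>(1 + r\<^sub>1) (s - s\<^sub>1) \<Phi>\<^sub>1(y) + (1 + r\<^sub>2) (s - s\<^sub>2) \<Phi>\<^sub>2(x) = 0\<close>. Only the imaginary axis \<open>Re s = 0\<close> is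
  used. On it the noise enters \<open>exp (x G\<^sub>1 + y G\<^sub>2)\<close> through an imaginary multiple of one Brownian
  motion, so the exponential martingale is bounded on bounded time intervals; the relation follows
  from independence of increments, stationarity and Riemann sums along the paths
  (\<open>exponential_increment\<close>, \<open>stationary_curve_equation\<close>).
  The local times are integrable because a suitable positive combination of \<open>G\<^sub>1\<close> and \<open>G\<^sub>2\<close> is
  pushed upwards by both of them, while its increments over a fixed time have mean zero
  (\<open>L_integrable\<close>).

  The function \<open>s \<mapsto> \<Phi>\<^sub>1(y(s))\<close> is analytic on the strip \<open>0 < Re s < \<mu>\<^sub>1\<close> and symmetric about
  \<open>\<mu>\<^sub>1 / 2\<close>; \<open>s \<mapsto> \<Phi>\<^sub>2(x(s))\<close> is analytic on \<open>-\<mu>\<^sub>2 < Re s < 0\<close> and symmetric about \<open>-\<mu>\<^sub>2 / 2\<close>. The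
  relation on the imaginary axis glues them to one function on a strip of width \<open>\<mu>\<^sub>1 + \<mu>\<^sub>2 = 1\<close>, and
  the two reflections compose to the translation by \<open>1\<close>. A product of four reciprocal Gamma
  functions satisfies the reciprocal difference equation, so that the product of the two is entire of
  period one (\<open>glued_product_periodic\<close>). Since \<open>\<gamma>\<^sub>1\<close> and \<open>\<gamma>\<^sub>2\<close> are integers, the reflection formula
  turns the Gamma factors into sines and polynomials, which bounds the growth: the product is a
  combination of \<open>1\<close> and \<open>exp (\<plusminus>2 \<pi> \<i> s)\<close> (\<open>glued_product_trig_polynomial\<close>). If
  \<open>\<gamma>\<^sub>1, \<gamma>\<^sub>2 > 0\<close> the growth is slower than that of the exponentials, and only the constant survives. If
  the signs differ, two Gamma factors vanish at the same point \<open>a\<close>, and the double zero leaves only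
  a multiple of \<open>sin\<^sup>2 (\<pi> (s - a))\<close>.

  Thus \<open>\<Phi>\<^sub>1\<close> is determined up to a constant. The resulting formula tends to \<open>0\<close> as \<open>y \<rightarrow> -\<infinity>\<close>, which
  shows that the corner carries no mass (\<open>atom_zero\<close>); hence \<open>\<Phi>\<^sub>1\<close> is the transform of the measure on
  the open half-line. With \<open>w = s - \<mu>\<^sub>1 / 2\<close>, half the square root in the statement, every linear
  factor produced by the Gamma functions belongs to a product symmetric under \<open>w \<mapsto> -w\<close>, and pairing
  opposite factors gives the polynomials in \<open>y\<close> (\<open>pochhammer_centred\<close>).\<close>

(* Formal power series claim the same infix symbol as vector components. *)
no_notation fps_nth (infixl "$" 75)

section \<open>Laplace transforms of measures on the half-line\<close>

definition half_line_measure :: "real measure \<Rightarrow> bool" where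
  "half_line_measure m \<longleftrightarrow> finite_measure m \<and> sets m = sets borel \<and> (AE v in m. 0 \<le> v)"

lemma norm_exp_mult_le_one:
  assumes "Re y \<le> 0" "0 \<le> v"
  shows "norm (exp (y * of_real v)) \<le> 1"
  using assms by (simp add: mult_nonpos_nonneg)

lemma laplace_integrable:
  assumes "half_line_measure m" "Re y \<le> 0"
  shows "integrable m (\<lambda>v. exp (y * of_real v))"
proof -
  interpret finite_measure m using assms by (simp add: half_line_measure_def)
  have [measurable_cong]: "sets m = sets borel" using assms by (simp add: half_line_measure_def)
  have ae: "AE v in m. 0 \<le> v" using assms by (simp add: half_line_measure_def)
  show ?thesis
    by (rule integrable_const_bound[where B=1])
       (use ae assms(2) norm_exp_mult_le_one in \<open>auto elim!: eventually_mono simp del: norm_exp_eq_Re\<close>)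
qed

lemma laplace_bound:
  assumes "half_line_measure m" "Re y \<le> 0"
  shows "norm (laplace m y) \<le> measure m UNIV"
proof -
  interpret finite_measure m using assms by (simp add: half_line_measure_def)
  have [measurable_cong]: "sets m = sets borel" using assms by (simp add: half_line_measure_def)
  have sp: "space m = UNIV" using assms sets_eq_imp_space_eq[of m borel] by (simp add: half_line_measure_def)
  have ae: "AE v in m. 0 \<le> v" using assms by (simp add: half_line_measure_def)
  have "norm (laplace m y) \<le> (\<integral>v. norm (exp (y * of_real v)) \<partial>m)"
    unfolding laplace_def by (rule integral_norm_bound)
  also have "\<dots> \<le> (\<integral>v. 1 \<partial>m)"
    by (rule integral_mono_AE)
       (use ae assms laplace_integrable[OF assms] norm_exp_mult_le_one in \<open>auto elim!: eventually_mono simp del: norm_exp_eq_Re\<close>)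
  finally show ?thesis using sp by simp
qed

lemma laplace_continuous_on:
  assumes "half_line_measure m"
  shows "continuous_on {y. Re y \<le> 0} (laplace m)"
proof -
  interpret finite_measure m using assms by (simp add: half_line_measure_def)
  have [measurable_cong]: "sets m = sets borel" using assms by (simp add: half_line_measure_def)
  have ae: "AE v in m. 0 \<le> v" using assms by (simp add: half_line_measure_def)
  show ?thesis
    unfolding continuous_on_sequentially comp_def
  proof (intro allI ballI impI, elim conjE)
    fix X :: "nat \<Rightarrow> complex" and a
    assume a: "a \<in> {y. Re y \<le> 0}" and X: "\<forall>n. X n \<in> {y. Re y \<le> 0}" and lim: "X \<longlonglongrightarrow> a"
    show "(\<lambda>n. laplace m (X n)) \<longlonglongrightarrow> laplace m a"
      unfolding laplace_def
    proof (rule integral_dominated_convergence[where w="\<lambda>_. 1"])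
      show "AE v in m. (\<lambda>n. exp (X n * of_real v)) \<longlonglongrightarrow> exp (a * of_real v)"
        by (intro AE_I2 tendsto_intros lim)
      show "AE v in m. norm (exp (X n * of_real v)) \<le> 1" for n
        using ae X norm_exp_mult_le_one by (auto elim!: eventually_mono simp del: norm_exp_eq_Re)
    qed auto
  qed
qed

text \<open>Staying at distance \<open>d\<close> inside the half-plane gains the factor \<open>exp (- d v)\<close>, which absorbs the
  factor \<open>v\<close> from differentiation; the bound is the dominating constant for differentiating under
  the integral.\<close>

lemma norm_exp_diff_quotient_le:
  fixes h :: complex
  assumes h: "h \<noteq> 0" "norm h \<le> d" and v: "0 \<le> v" and y: "Re y \<le> - 2 * d" and d: "d > 0"
  shows "norm ((exp ((y + h) * of_real v) - exp (y * of_real v)) / h) \<le> 1 / d"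
proof -
  have "norm (exp (of_real v * (y + h)) - exp (of_real v * y)) \<le> (1 / d) * norm ((y + h) - y)"
  proof (rule field_differentiable_bound[where S="{z. Re z \<le> - d}" and f'="\<lambda>z. of_real v * exp (of_real v * z)"])
    show "convex {z. Re z \<le> - d}" using convex_halfspace_Re_le by blast
    show "((\<lambda>z. exp (of_real v * z)) has_field_derivative of_real v * exp (of_real v * z)) (at z within {z. Re z \<le> - d})" for z :: complex
      by (auto intro!: derivative_eq_intros)
    show "norm (of_real v * exp (of_real v * z)) \<le> 1 / d" if "z \<in> {z. Re z \<le> - d}" for z :: complex
    proof -
      have "v * Re z \<le> v * (-d)" using that v by (intro mult_left_mono) auto
      then have "norm (of_real v * exp (of_real v * z)) \<le> v * exp (- (v * d))"
        using v by (simp add: norm_mult mult_left_mono)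
      also have "\<dots> = (v * d) * exp (- (v * d)) / d" using d by simp
      also have "(v * d) * exp (- (v * d)) \<le> 1"
        using exp_ge_add_one_self[of "v * d"] by (simp add: exp_minus divide_simps del: exp_ge_add_one_self)
      finally show ?thesis using d by (simp add: divide_right_mono)
    qed
    have "\<bar>Re h\<bar> \<le> d" using h abs_Re_le_cmod[of h] by linarith
    then show "y + h \<in> {z. Re z \<le> - d}" "y \<in> {z. Re z \<le> - d}" using y d by auto
  qed
  then have "norm (exp ((y + h) * of_real v) - exp (y * of_real v)) \<le> norm h / d"
    by (simp add: mult.commute)
  then show ?thesis using h d by (simp add: norm_divide field_simps)
qed

lemma laplace_holomorphic_on:
  assumes "half_line_measure m"
  shows "laplace m holomorphic_on {y. Re y < 0}"
proof -
  interpret finite_measure m using assms by (simp add: half_line_measure_def)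
  have [measurable_cong]: "sets m = sets borel" using assms by (simp add: half_line_measure_def)
  have ae: "AE v in m. 0 \<le> v" using assms by (simp add: half_line_measure_def)
  have "laplace m field_differentiable (at y)" if y: "Re y < 0" for y
  proof -
    define d where "d = - Re y / 2"
    have d: "d > 0" "Re y \<le> - 2 * d" using y by (auto simp: d_def)
    have "((\<lambda>h. (laplace m (y + h) - laplace m y) / h) \<longlongrightarrow> (\<integral>v. of_real v * exp (y * of_real v) \<partial>m)) (at 0)"
    proof (subst tendsto_at_iff_sequentially, intro allI impI)
      fix X :: "nat \<Rightarrow> complex" assume X0: "\<forall>i. X i \<in> UNIV - {0}" and X: "X \<longlonglongrightarrow> 0"
      \<comment> \<open>Only the tail of the sequence matters; replacing the rest makes one bound valid for all indices.\<close>
      define Y where "Y n = (if norm (X n) \<le> d then X n else of_real d)" for n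
      have YX: "eventually (\<lambda>n. Y n = X n) sequentially"
        using tendstoD[OF X, of d] d by (auto simp: Y_def dist_norm elim!: eventually_mono)
      have Y0: "Y n \<noteq> 0" "norm (Y n) \<le> d" for n using X0 d by (auto simp: Y_def)
      have Y: "Y \<longlonglongrightarrow> 0" using X YX by (simp cong: tendsto_cong)
      have ReY: "Re (y + Y n) \<le> 0" for n
        using abs_Re_le_cmod[of "Y n"] Y0[of n] d by (simp add: d_def) 
      have "(\<lambda>n. (\<integral>v. (exp ((y + Y n) * of_real v) - exp (y * of_real v)) / Y n \<partial>m)) \<longlonglongrightarrow> (\<integral>v. of_real v * exp (y * of_real v) \<partial>m)"
      proof (rule integral_dominated_convergence[where w="\<lambda>_. 1 / d"])
        show "AE v in m. (\<lambda>n. (exp ((y + Y n) * of_real v) - exp (y * of_real v)) / Y n) \<longlonglongrightarrow> of_real v * exp (y * of_real v)"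
        proof (intro AE_I2)
          fix v :: real
          have "((\<lambda>y. exp (y * of_real v)) has_field_derivative of_real v * exp (y * of_real v)) (at y)"
            by (auto intro!: derivative_eq_intros)
          then have "((\<lambda>h. (exp ((y + h) * of_real v) - exp (y * of_real v)) / h) \<longlongrightarrow> of_real v * exp (y * of_real v)) (at 0)"
            by (simp add: DERIV_def)
          then show "(\<lambda>n. (exp ((y + Y n) * of_real v) - exp (y * of_real v)) / Y n) \<longlonglongrightarrow> of_real v * exp (y * of_real v)"
            using Y Y0 unfolding tendsto_at_iff_sequentially comp_def by blast
        qed
        show "AE v in m. norm ((exp ((y + Y n) * of_real v) - exp (y * of_real v)) / Y n) \<le> 1 / d" for n
          using ae norm_exp_diff_quotient_le[OF Y0 _ d(2) d(1)] by (auto elim!: eventually_mono)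
      qed auto
      moreover have "(\<integral>v. (exp ((y + Y n) * of_real v) - exp (y * of_real v)) / Y n \<partial>m) = (laplace m (y + Y n) - laplace m y) / Y n" for n
        using laplace_integrable[OF assms ReY] laplace_integrable[OF assms, of y] y
        by (simp add: laplace_def Bochner_Integration.integral_diff)
      ultimately have "(\<lambda>n. (laplace m (y + Y n) - laplace m y) / Y n) \<longlonglongrightarrow> (\<integral>v. of_real v * exp (y * of_real v) \<partial>m)"
        by (simp only:)
      then show "((\<lambda>h. (laplace m (y + h) - laplace m y) / h) \<circ> X) \<longlonglongrightarrow> (\<integral>v. of_real v * exp (y * of_real v) \<partial>m)"
        by (rule Lim_transform_eventually) (use YX in \<open>auto elim!: eventually_mono\<close>)
    qed
    then show ?thesis unfolding field_differentiable_def DERIV_def by blast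
  qed
  then show ?thesis
    by (auto simp: holomorphic_on_def intro: field_differentiable_at_within)
qed

lemma laplace_of_real:
  "laplace m (of_real r) = of_real (\<integral>v. exp (r * v) \<partial>m)"
proof -
  have "exp (of_real r * of_real v :: complex) = of_real (exp (r * v))" for v
    by (simp flip: of_real_mult exp_of_real)
  then show ?thesis unfolding laplace_def by (simp only: integral_complex_of_real)
qed

text \<open>As \<open>Re y \<rightarrow> -\<infinity>\<close> the exponential concentrates at \<open>v = 0\<close>.\<close>

lemma laplace_tendsto_atom:
  assumes m: "half_line_measure m" and X: "filterlim (\<lambda>n. Re (X n)) at_bot sequentially"
  shows "(\<lambda>n. laplace m (X n)) \<longlonglongrightarrow> of_real (measure m {0})"
proof -
  interpret finite_measure m using assms by (simp add: half_line_measure_def)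
  have [measurable_cong]: "sets m = sets borel" using assms by (simp add: half_line_measure_def)
  have ae: "AE v in m. 0 \<le> v" using assms by (simp add: half_line_measure_def)
  define Y where "Y n = (if Re (X n) \<le> 0 then X n else 0)" for n
  have YX: "eventually (\<lambda>n. Y n = X n) sequentially"
    using X unfolding filterlim_at_bot by (auto simp: Y_def elim!: eventually_mono allE[of _ 0])
  have ReY: "Re (Y n) \<le> 0" for n by (simp add: Y_def)
  have Ylim: "filterlim (\<lambda>n. Re (Y n)) at_bot sequentially"
    using X by (rule filterlim_mono_eventually) (use YX in \<open>auto elim!: eventually_mono\<close>)
  have "(\<lambda>n. laplace m (Y n)) \<longlonglongrightarrow> (\<integral>v. indicator {0} v \<partial>m)"
    unfolding laplace_def
  proof (rule integral_dominated_convergence[where w="\<lambda>_. 1"])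
    show "AE v in m. (\<lambda>n. exp (Y n * of_real v)) \<longlonglongrightarrow> indicator {0} v"
      using ae
    proof eventually_elim
      fix v :: real assume v: "0 \<le> v"
      show "(\<lambda>n. exp (Y n * of_real v)) \<longlonglongrightarrow> indicator {0} v"
      proof (cases "v = 0")
        case False
        then have "filterlim (\<lambda>n. v * Re (Y n)) at_bot sequentially"
          using filterlim_tendsto_pos_mult_at_bot[OF tendsto_const _ Ylim, of v] v by simp
        then have "(\<lambda>n. exp (v * Re (Y n))) \<longlonglongrightarrow> 0"
          by (rule filterlim_compose[OF exp_at_bot])
        then have "(\<lambda>n. norm (exp (Y n * of_real v))) \<longlonglongrightarrow> 0" by (simp add: mult.commute)
        then show ?thesis using False by (simp add: tendsto_norm_zero_iff del: norm_exp_eq_Re)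
      qed simp
    qed
    show "AE v in m. norm (exp (Y n * of_real v)) \<le> 1" for n
      using ae ReY norm_exp_mult_le_one by (auto elim!: eventually_mono simp del: norm_exp_eq_Re)
  qed auto
  also have "(\<integral>v. indicator {0} v \<partial>m) = (\<integral>v. complex_of_real (indicator {0} v) \<partial>m)"
    by (intro Bochner_Integration.integral_cong) (auto simp: indicator_def)
  also have "\<dots> = complex_of_real (measure m {0})"
    by (subst integral_complex_of_real) simp
  finally show ?thesis
    by (rule Lim_transform_eventually) (use YX in \<open>auto elim!: eventually_mono\<close>)
qed

lemma laplace_restrict_positive:
  assumes m: "half_line_measure m" and 0: "measure m {0} = 0"
  shows "laplace (restrict_space m {0<..}) y = laplace m y"
proof -
  interpret finite_measure m using m by (simp add: half_line_measure_def)
  have sm [measurable_cong]: "sets m = sets borel" using m by (simp add: half_line_measure_def)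
  have sp: "space m = UNIV" using sets_eq_imp_space_eq[OF sm] by simp
  have "AE v in m. v \<noteq> 0"
    by (rule AE_I[of _ _ "{0}"]) (use 0 sm emeasure_eq_measure in auto)
  moreover have "AE v in m. 0 \<le> v" using m by (simp add: half_line_measure_def)
  ultimately have pos: "AE v in m. 0 < v" by eventually_elim simp
  have "laplace (restrict_space m {0<..}) y = (\<integral>v. indicator {0<..} v *\<^sub>R exp (y * of_real v) \<partial>m)"
    unfolding laplace_def by (rule integral_restrict_space) (simp add: sm sp)
  also have "\<dots> = laplace m y"
    unfolding laplace_def by (rule integral_cong_AE) (use pos in \<open>auto elim!: eventually_mono\<close>)
  finally show ?thesis .
qed

section \<open>Entire functions of period one\<close>

lemma periodic_of_int:
  fixes f :: "complex \<Rightarrow> 'b"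
  assumes "\<And>s. f (s + 1) = f s"
  shows "f (s + of_int n) = f s"
proof -
  have nat: "f (s + of_nat k) = f s" for s k
  proof (induction k)
    case (Suc k)
    have "f (s + of_nat (Suc k)) = f ((s + of_nat k) + 1)" by (simp add: add_ac)
    then show ?case using Suc assms by simp
  qed simp
  show ?thesis
  proof (cases "n \<ge> 0")
    case True then show ?thesis using nat[of s "nat n"] by (simp add: of_nat_nat)
  next
    case False then show ?thesis using nat[of "s + of_int n" "nat (-n)"] by (simp add: of_nat_nat)
  qed
qed

text \<open>Translates of \<open>P\<close> fit together continuously along the lines \<open>Re s \<in> c + \<int>\<close>, and a continuous
  function that is holomorphic off a line is holomorphic.\<close>

lemma strip_periodic_extension:
  fixes P :: "complex \<Rightarrow> complex" and c :: real
  assumes cont: "continuous_on {s. c \<le> Re s \<and> Re s \<le> c + 1} P"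
    and hol: "P holomorphic_on {s. c < Re s \<and> Re s < c + 1}"
    and per: "\<And>s. Re s = c \<Longrightarrow> P (s + 1) = P s"
  obtains f where "f holomorphic_on UNIV" "\<And>s. f (s + 1) = f s"
    "\<And>s. c \<le> Re s \<Longrightarrow> Re s \<le> c + 1 \<Longrightarrow> f s = P s"
proof -
  define f where "f s = P (s - of_int \<lfloor>Re s - c\<rfloor>)" for s
  have f1: "f (s + 1) = f s" for s
  proof -
    have "Re (s + 1) - c = (Re s - c) + 1" by simp
    then have "\<lfloor>Re (s + 1) - c\<rfloor> = \<lfloor>Re s - c\<rfloor> + 1" by linarith
    then show ?thesis by (simp add: f_def)
  qed
  have fi: "f (s - of_int n) = f s" for s n
    using periodic_of_int[of f s "- n", OF f1] by simp
  have fP: "f s = P s" if "c \<le> Re s" "Re s \<le> c + 1" for s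
  proof (cases "Re s = c + 1")
    case True
    then have "f s = P (s - 1)" by (simp add: f_def)
    also have "\<dots> = P s" using per[of "s - 1"] True by simp
    finally show ?thesis .
  next
    case False
    then have "\<lfloor>Re s - c\<rfloor> = 0" using that by linarith
    then show ?thesis by (simp add: f_def)
  qed
  have fP': "f s = P (s + 1)" if "c - 1 \<le> Re s" "Re s \<le> c" for s
    using fP[of "s + 1"] f1[of s] that by simp
  define S where "S = {s. c - 1 < Re s \<and> Re s < c + 1}"
  have oS: "open S"
    unfolding S_def by (intro open_Collect_conj open_Collect_less continuous_intros)
  have holS: "f holomorphic_on S"
  proof (rule holomorphic_on_paste_across_line[OF oS, of 1 _ c])
    have "(\<lambda>s. P (s + 1)) holomorphic_on {s. c - 1 < Re s \<and> Re s < c}"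
      by (rule holomorphic_on_compose_gen[OF _ hol, of "\<lambda>s. s + 1", unfolded o_def])
        (auto intro!: holomorphic_intros)
    then show "f holomorphic_on S \<inter> {z. 1 \<bullet> z < c}"
      by (rule holomorphic_transform[THEN holomorphic_on_subset]) (auto simp: S_def inner_complex_def fP')
    show "f holomorphic_on S \<inter> {z. c < 1 \<bullet> z}"
      by (rule holomorphic_transform[OF hol, THEN holomorphic_on_subset]) (auto simp: S_def inner_complex_def fP)
    have "continuous_on ({s. c - 1 \<le> Re s \<and> Re s \<le> c} \<union> {s. c \<le> Re s \<and> Re s \<le> c + 1}) f"
    proof (rule continuous_on_closed_Un)
      show "closed {s. c - 1 \<le> Re s \<and> Re s \<le> c}" "closed {s. c \<le> Re s \<and> Re s \<le> c + 1}"
        by (intro closed_Collect_conj closed_Collect_le continuous_intros)+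
      have "continuous_on {s. c - 1 \<le> Re s \<and> Re s \<le> c} (\<lambda>s. P (s + 1))"
        by (rule continuous_on_compose2[OF cont]) (auto intro!: continuous_intros)
      then show "continuous_on {s. c - 1 \<le> Re s \<and> Re s \<le> c} f"
        by (rule continuous_on_eq) (auto simp: fP')
      show "continuous_on {s. c \<le> Re s \<and> Re s \<le> c + 1} f"
        by (rule continuous_on_eq[OF cont]) (auto simp: fP)
    qed
    then show "continuous_on S f" by (rule continuous_on_subset) (auto simp: S_def)
  qed simp
  have "f field_differentiable (at s)" for s
  proof -
    define n where "n = \<lfloor>Re s - c\<rfloor>"
    have "s - of_int n \<in> S" unfolding S_def n_def by (simp, linarith)
    then have "f field_differentiable (at (s - of_int n))"
      using holS oS by (metis holomorphic_on_imp_differentiable_at)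
    then have "(f \<circ> (\<lambda>s. s - of_int n)) field_differentiable (at s)"
      by (intro field_differentiable_compose) (auto intro!: derivative_intros)
    moreover have "f \<circ> (\<lambda>s. s - of_int n) = f" by (auto simp: o_def fi)
    ultimately show ?thesis by simp
  qed
  then have "f holomorphic_on UNIV" by (auto simp: holomorphic_on_def)
  then show ?thesis using that f1 fP by blast
qed

text \<open>A crude form that lets polynomial growth be absorbed into the exponential slack of
  \<open>periodic_entire_trig_polynomial\<close>.\<close>

lemma one_plus_power_le_exp:
  fixes x :: real
  assumes "0 \<le> x"
  shows "(1 + x) ^ N \<le> real N ^ N * exp x"
proof (cases "N = 0")
  case False
  have "1 + x \<le> real N * (1 + x / real N)" using False by (simp add: field_simps)
  also have "\<dots> \<le> real N * exp (x / real N)" by (intro mult_left_mono exp_ge_add_one_self) auto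
  finally have "(1 + x) ^ N \<le> (real N * exp (x / real N)) ^ N" using assms by (intro power_mono) auto
  also have "\<dots> = real N ^ N * exp x" using False by (simp add: power_mult_distrib flip: exp_of_nat_mult)
  finally show ?thesis .
qed (use assms in simp)

text \<open>In the variable \<open>z = exp (2 \<pi> \<i> s)\<close> the growth condition reads \<open>|g z| \<le> C max (|z|, 1/|z|)\<^sup>3\<^sup>/\<^sup>2\<close>. So
  \<open>z\<^sup>2 g z\<close> vanishes at the origin and is \<open>O(|z|\<^sup>7\<^sup>/\<^sup>2)\<close> at infinity: it is a polynomial
  of degree at most three without constant term.\<close>

lemma periodic_entire_trig_polynomial:
  fixes f :: "complex \<Rightarrow> complex"
  assumes hol: "f holomorphic_on UNIV" and per: "\<And>s. f (s + 1) = f s"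
    and bound: "\<And>s. norm (f s) \<le> C * exp (3 * pi * \<bar>Im s\<bar>)"
  obtains a b c where "\<And>s. f s = a * exp (- (2 * pi * \<i> * s)) + b + c * exp (2 * pi * \<i> * s)"
proof -
  have C: "C \<ge> 0" using bound[of 0] norm_ge_zero[of "f 0"] by (simp del: norm_ge_zero)
  note fi = periodic_of_int[of f, OF per]
  define g where "g z = f (Ln z / (2 * pi * \<i>))" for z
  have g: "f s = g z" if "z = exp (2 * pi * \<i> * s)" for s z
  proof -
    have "exp (2 * pi * \<i> * s) = exp (Ln z)" using that by simp
    then obtain n :: int where n: "2 * pi * \<i> * s = Ln z + (of_int (2 * n) * pi) * \<i>"
      by (subst (asm) exp_eq) auto
    then have "s = Ln z / (2 * pi * \<i>) + of_int n" by (simp add: field_simps)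
    then show ?thesis by (simp add: g_def fi)
  qed
  have gdiff: "g field_differentiable (at z0)" if "z0 \<noteq> 0" for z0
  proof -
    define l where "l z = (Ln (z / z0) + Ln z0) / (2 * pi * \<i>)" for z
    have "Re (z / z0) > 0 \<Longrightarrow> g z = f (l z)" for z
    proof -
      assume *: "Re (z / z0) > 0"
      then have "z \<noteq> 0" by auto
      then have "exp (2 * pi * \<i> * l z) = z" using that by (simp add: l_def exp_add)
      then show ?thesis using g by metis
    qed
    moreover have "open {z. Re (z / z0) > 0}"
      using that by (intro open_Collect_less continuous_intros) auto
    moreover have "z0 \<in> {z. Re (z / z0) > 0}" using that by simp
    ultimately have ev: "eventually (\<lambda>z. f (l z) = g z) (nhds z0)"
      by (intro eventually_nhds[THEN iffD2]) force
    have "l field_differentiable (at z0)"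
      unfolding l_def using that
      by (intro field_differentiable_divide field_differentiable_add
          field_differentiable_compose[of "\<lambda>z. z / z0" _ Ln, unfolded o_def] field_differentiable_at_Ln)
        (auto intro!: derivative_intros)
    moreover have "f field_differentiable (at (l z0))"
      using hol by (metis UNIV_I holomorphic_on_imp_differentiable_at open_UNIV)
    ultimately have "(f \<circ> l) field_differentiable (at z0)" by (rule field_differentiable_compose)
    then obtain D where "((\<lambda>z. f (l z)) has_field_derivative D) (at z0)"
      by (auto simp: field_differentiable_def o_def)
    then have "(g has_field_derivative D) (at z0)"
      using DERIV_cong_ev[OF refl ev refl] by simp
    then show ?thesis by (auto simp: field_differentiable_def)
  qed
  have gb: "norm (g z) \<le> C * exp (3 / 2 * \<bar>ln (norm z)\<bar>)" if "z \<noteq> 0" for z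
  proof -
    have "Im (Ln z / (2 * pi * \<i>)) = - ln (norm z) / (2 * pi)"
      using that by (simp add: Im_divide power2_eq_square)
    then have "3 * pi * \<bar>Im (Ln z / (2 * pi * \<i>))\<bar> = 3 / 2 * \<bar>ln (norm z)\<bar>" by simp
    then show ?thesis using bound[of "Ln z / (2 * pi * \<i>)"] by (simp only: g_def)
  qed
  define k where "k z = (if z = 0 then 0 else z\<^sup>2 * g z)" for z
  have kb1: "norm (k z) \<le> C * sqrt (norm z)" if "norm z \<le> 1" for z
  proof (cases "z = 0")
    case False
    define r where "r = norm z"
    have r: "0 < r" "r \<le> 1" using that False by (auto simp: r_def)
    have "exp (3 / 2 * \<bar>ln r\<bar>) = r powr (- 3/2)" using r by (simp add: powr_def)
    then have "norm (k z) \<le> r ^ 2 * (C * r powr (- 3/2))"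
      using gb[OF False] False by (simp add: k_def norm_mult norm_power r_def mult_left_mono)
    also have "\<dots> = C * (r powr 2 * r powr (- 3/2))" using r by (simp add: powr_numeral)
    also have "r powr 2 * r powr (- 3/2) = sqrt r" using r by (simp add: powr_half_sqrt del: powr_numeral flip: powr_add)
    finally show ?thesis by (simp add: r_def)
  qed (simp add: k_def)
  have kb2: "norm (k z) \<le> C * norm z powr (7/2)" if "norm z \<ge> 1" for z
  proof -
    define r where "r = norm z"
    have r: "1 \<le> r" using that by (auto simp: r_def)
    have z: "z \<noteq> 0" using that by auto
    have "exp (3 / 2 * \<bar>ln r\<bar>) = r powr (3/2)" using r by (simp add: powr_def)
    then have "norm (k z) \<le> r ^ 2 * (C * r powr (3/2))"
      using gb[OF z] z by (simp add: k_def norm_mult norm_power r_def mult_left_mono)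
    also have "\<dots> = C * (r powr 2 * r powr (3/2))" using r by (simp add: powr_numeral)
    also have "r powr 2 * r powr (3/2) = r powr (7/2)" by (simp flip: powr_add)
    finally show ?thesis by (simp add: r_def)
  qed
  have kdiff: "k field_differentiable (at z)" if "z \<noteq> 0" for z
  proof -
    have "(\<lambda>z. z\<^sup>2 * g z) field_differentiable (at z)"
      using gdiff[OF that] by (intro derivative_intros)
    then obtain D where "((\<lambda>z. z\<^sup>2 * g z) has_field_derivative D) (at z)"
      by (auto simp: field_differentiable_def)
    moreover have ev: "eventually (\<lambda>z. z\<^sup>2 * g z = k z) (nhds z)"
      using that t1_space_nhds[OF that] by (auto simp: k_def elim: eventually_mono)
    ultimately have "(k has_field_derivative D) (at z)"
      using DERIV_cong_ev[OF refl ev refl] by simp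
    then show ?thesis by (auto simp: field_differentiable_def)
  qed
  have "isCont k 0"
  proof -
    have "((\<lambda>z. C * sqrt (norm z)) \<longlongrightarrow> C * sqrt (norm (0::complex))) (at (0::complex))"
      by (intro tendsto_mult tendsto_const tendsto_real_sqrt tendsto_norm tendsto_ident_at)
    then have "((\<lambda>z. C * sqrt (norm (z::complex))) \<longlongrightarrow> 0) (at 0)" by simp
    then have "(k \<longlongrightarrow> 0) (at 0)"
    proof (rule Lim_null_comparison[rotated])
      show "\<forall>\<^sub>F z in at 0. norm (k z) \<le> C * sqrt (norm z)"
        unfolding eventually_at by (intro exI[of _ 1]) (auto intro!: kb1)
    qed
    then show ?thesis by (simp add: isCont_def k_def)
  qed
  moreover have "isCont k z" if "z \<noteq> 0" for z
    using kdiff[OF that] field_differentiable_imp_continuous_at by blast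
  ultimately have "continuous_on UNIV k"
    by (metis continuous_at_imp_continuous_on)
  moreover have "k holomorphic_on UNIV - {0}"
    using kdiff by (auto simp: holomorphic_on_def intro: field_differentiable_at_within)
  ultimately have khol: "k holomorphic_on UNIV"
    by (intro no_isolated_singularity[of UNIV k "{0}"]) auto
  define a where "a j = (deriv ^^ j) k 0 / fact j" for j
  have kpoly: "k z = (\<Sum>j\<le>4. a j * z ^ j)" for z
    unfolding a_def
  proof (rule Liouville_polynomial[OF khol, of 1 C])
    fix z :: complex assume z: "1 \<le> norm z"
    have "norm z powr (7/2) \<le> norm z powr 4" using z by (intro powr_mono) auto
    also have "\<dots> = norm z ^ 4" using z by (simp add: powr_numeral)
    finally show "norm (k z) \<le> C * norm z ^ 4" using kb2[OF z] mult_left_mono[OF _ C] order_trans by blast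
  qed
  have a0: "a 0 = 0" using kpoly[of 0] by (simp add: k_def eval_nat_numeral)
  \<comment> \<open>The exponent \<open>7 / 2\<close> is smaller than \<open>4\<close>.\<close>
  have a4: "a 4 = 0"
  proof -
    have e: "norm (a 4) \<le> C * r powr (-1/2) + norm (a 1) * r powr -3 + norm (a 2) * r powr - 2 + norm (a 3) * r powr -1" if r: "r \<ge> 1" for r :: real
    proof -
      define z where "z = complex_of_real r"
      have "a 4 * z ^ 4 = k z - a 1 * z - a 2 * z^2 - a 3 * z^3"
        using kpoly[of z] a0 by (simp add: eval_nat_numeral algebra_simps)
      then have "norm (a 4 * z ^ 4) \<le> norm (k z) + norm (a 1 * z) + norm (a 2 * z^2) + norm (a 3 * z^3)"
        using norm_triangle_ineq4[of "k z" "a 1 * z"] norm_triangle_ineq4[of "k z - a 1 * z" "a 2 * z^2"]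
          norm_triangle_ineq4[of "k z - a 1 * z - a 2 * z^2" "a 3 * z^3"] by simp
      also have "norm (k z) \<le> C * r powr (7/2)" using kb2[of z] r by (simp add: z_def)
      finally have "norm (a 4) * r ^ 4 \<le> C * r powr (7/2) + norm (a 1) * r + norm (a 2) * r^2 + norm (a 3) * r^3"
        using r by (simp add: z_def norm_mult norm_power)
      then have "norm (a 4) \<le> (C * r powr (7/2) + norm (a 1) * r + norm (a 2) * r^2 + norm (a 3) * r^3) / r ^ 4"
        using r by (simp add: pos_le_divide_eq)
      also have "\<dots> = C * (r powr (7/2) / r powr 4) + norm (a 1) * (r powr 1 / r powr 4) + norm (a 2) * (r powr 2 / r powr 4) + norm (a 3) * (r powr 3 / r powr 4)"
        using r by (simp add: add_divide_distrib powr_numeral)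
      also have "\<dots> = C * r powr (-1/2) + norm (a 1) * r powr -3 + norm (a 2) * r powr - 2 + norm (a 3) * r powr -1"
        by (simp only: powr_diff [symmetric]) simp
      finally show ?thesis .
    qed
    have lim: "((\<lambda>r. C * r powr (-1/2) + norm (a 1) * r powr -3 + norm (a 2) * r powr - 2 + norm (a 3) * r powr -1) \<longlongrightarrow> C * 0 + norm (a 1) * 0 + norm (a 2) * 0 + norm (a 3) * 0) at_top"
      by (intro tendsto_intros tendsto_neg_powr filterlim_ident) auto
    have "norm (a 4) \<le> C * 0 + norm (a 1) * 0 + norm (a 2) * 0 + norm (a 3) * 0"
      by (rule tendsto_lowerbound[OF lim eventually_at_top_linorderI[OF e]]) auto
    then show ?thesis by simp
  qed
  have "f s = a 1 * exp (- (2 * pi * \<i> * s)) + a 2 + a 3 * exp (2 * pi * \<i> * s)" for s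
  proof -
    define z where "z = exp (2 * pi * \<i> * s)"
    have z: "z \<noteq> 0" by (simp add: z_def)
    have "z\<^sup>2 * g z = a 1 * z + a 2 * z^2 + a 3 * z^3"
      using kpoly[of z] a0 a4 z by (simp add: k_def eval_nat_numeral algebra_simps)
    also have "\<dots> = z\<^sup>2 * (a 1 * inverse z + a 2 + a 3 * z)"
      using z by (simp add: algebra_simps power2_eq_square power3_eq_cube)
    finally have "g z = a 1 * inverse z + a 2 + a 3 * z" using z by simp
    then show ?thesis using g[OF z_def] by (simp add: z_def exp_minus)
  qed
  then show ?thesis using that by blast
qed

lemma coefficient_nonpos_if_dominated:
  fixes x K B :: real
  assumes "\<And>t::real. 1 \<le> t \<Longrightarrow> x * exp (2 * pi * t) \<le> K * exp (2 * pi * t) / t + B"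
  shows "x \<le> 0"
proof -
  have e: "x \<le> K / t + B * exp (- (2 * pi * t))" if t: "t \<ge> 1" for t
    using assms[OF t] t by (simp add: exp_minus field_simps)
  have "((\<lambda>t. K / t + B * exp (- (2 * pi * t))) \<longlongrightarrow> 0) at_top"
    by real_asymp
  then show ?thesis
    by (rule tendsto_lowerbound[OF _ eventually_at_top_linorderI[OF e]]) auto
qed

text \<open>Along a vertical line the two exponentials have modulus proportional to \<open>exp (\<plusminus>2 \<pi> t)\<close>, one of
  them dominating in each direction.\<close>

lemma trig_polynomial_const_if_small:
  fixes a b c :: complex and \<sigma> :: real
  assumes small: "\<And>t::real. 1 \<le> \<bar>t\<bar> \<Longrightarrow>
    norm (a * exp (- (2 * pi * \<i> * (of_real \<sigma> + \<i> * of_real t))) + b + c * exp (2 * pi * \<i> * (of_real \<sigma> + \<i> * of_real t)))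
      \<le> K * exp (2 * pi * \<bar>t\<bar>) / \<bar>t\<bar>"
  shows "a = 0" "c = 0"
proof -
  define A where "A t = a * exp (- (2 * pi * \<i> * (of_real \<sigma> + \<i> * of_real t)))" for t
  define D where "D t = c * exp (2 * pi * \<i> * (of_real \<sigma> + \<i> * of_real t))" for t
  have A: "norm (A t) = norm a * exp (2 * pi * t)" and D: "norm (D t) = norm c * exp (- (2 * pi * t))" for t
    by (simp_all add: A_def D_def norm_mult)
  have tri: "norm u \<le> norm (u + b + v) + norm b + norm v" "norm v \<le> norm (u + b + v) + norm b + norm u" for u v
    using norm_triangle_ineq4[of "u + b + v" "b + v"] norm_triangle_ineq4[of "u + b + v" "b + u"]
      norm_triangle_ineq[of b v] norm_triangle_ineq[of b u] by (simp_all add: algebra_simps)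
  have "norm a \<le> 0"
  proof (rule coefficient_nonpos_if_dominated)
    fix t :: real assume t: "1 \<le> t"
    have "norm (D t) \<le> norm c * 1" unfolding D using t by (intro mult_left_mono) auto
    then show "norm a * exp (2 * pi * t) \<le> K * exp (2 * pi * t) / t + (norm b + norm c)"
      using tri(1)[of "A t" "D t"] small[of t, folded A_def D_def] t A[of t] by simp
  qed
  then show "a = 0" by simp
  have "norm c \<le> 0"
  proof (rule coefficient_nonpos_if_dominated)
    fix t :: real assume t: "1 \<le> t"
    have "norm (A (-t)) \<le> norm a * 1" unfolding A using t by (intro mult_left_mono) auto
    moreover have "norm (D (-t)) = norm c * exp (2 * pi * t)" by (simp add: D)
    ultimately show "norm c * exp (2 * pi * t) \<le> K * exp (2 * pi * t) / t + (norm b + norm a)"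
      using tri(2)[of "D (-t)" "A (-t)"] small[of "-t", folded A_def D_def] t by simp
  qed
  then show "c = 0" by simp
qed

lemma trig_polynomial_double_zero:
  fixes f :: "complex \<Rightarrow> complex" and a b c z0 :: complex
  assumes f: "\<And>s. f s = a * exp (- (2 * pi * \<i> * s)) + b + c * exp (2 * pi * \<i> * s)"
    and zero: "f z0 = 0" and dzero: "(f has_field_derivative 0) (at z0)"
  obtains d where "\<And>s. f s = d * sin (of_real pi * (s - z0)) ^ 2"
proof -
  define e where "e = exp (2 * pi * \<i> * z0)"
  have e0: "e \<noteq> 0" by (simp add: e_def)
  have em: "exp (- (2 * pi * \<i> * z0)) = inverse e" by (simp add: e_def exp_minus)
  have "((\<lambda>s. a * exp (- (2 * pi * \<i> * s)) + b + c * exp (2 * pi * \<i> * s)) has_field_derivative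
      (- (2 * pi * \<i>) * (a * exp (- (2 * pi * \<i> * z0)) - c * exp (2 * pi * \<i> * z0)))) (at z0)"
    by (auto intro!: derivative_eq_intros simp: algebra_simps)
  then have "(f has_field_derivative (- (2 * pi * \<i>) * (a * inverse e - c * e))) (at z0)"
    unfolding em e_def[symmetric] by (simp add: f[abs_def] fun_eq_iff)
  then have "- (2 * pi * \<i>) * (a * inverse e - c * e) = 0"
    using dzero DERIV_unique by blast
  then have 1: "a * inverse e = c * e" by simp
  have 2: "a * inverse e + b + c * e = 0" using zero f[of z0] em e_def by simp
  have b: "b = - 2 * (c * e)" using 1 2 by (simp add: add_eq_0_iff2 algebra_simps) 
  have a: "a = c * e * e" using 1 e0 by (simp add: field_simps)
  have "f s = (-4 * (c * e)) * sin (of_real pi * (s - z0)) ^ 2" for s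
  proof -
    define u where "u = exp (\<i> * (of_real pi * (s - z0)))"
    have u0: "u \<noteq> 0" by (simp add: u_def)
    have um: "exp (- (\<i> * (of_real pi * (s - z0)))) = inverse u" by (simp add: u_def exp_minus)
    have "u * u * e = exp (2 * pi * \<i> * s)" unfolding u_def e_def exp_add[symmetric] by (rule arg_cong[of _ _ exp]) (simp add: algebra_simps)
    then have "f s = a * inverse (u * u * e) + b + c * (u * u * e)" using f[of s] by (simp add: exp_minus)
    also have "\<dots> = (c * e) * (inverse u * inverse u - 2 + u * u)" unfolding a b using e0 u0 by (simp add: field_simps)
    also have "\<dots> = (c * e) * (u - inverse u)^2" using u0 by (simp add: field_simps power2_eq_square)
    also have "(u - inverse u)^2 = (2 * \<i> * sin (of_real pi * (s - z0)))^2"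
      by (simp add: sin_exp_eq um flip: u_def)
    finally show ?thesis by (simp add: power_mult_distrib)
  qed
  then show ?thesis using that by blast
qed

lemma has_derivative_zero_of_double_zero:
  fixes p q r :: "complex \<Rightarrow> complex"
  assumes "p field_differentiable (at z)" "q field_differentiable (at z)" "r field_differentiable (at z)"
    and "p z = 0" "q z = 0"
  shows "((\<lambda>s. r s * (p s * q s)) has_field_derivative 0) (at z)"
proof -
  obtain P Q R where "(p has_field_derivative P) (at z)" "(q has_field_derivative Q) (at z)" "(r has_field_derivative R) (at z)"
    using assms by (auto simp: field_differentiable_def)
  then have "((\<lambda>s. r s * (p s * q s)) has_field_derivative (R * (p z * q z) + (P * q z + Q * p z) * r z)) (at z)"
    by (intro DERIV_mult)
  then show ?thesis using assms by simp
qed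

section \<open>Products of two reciprocal Gamma functions\<close>

lemma norm_sin_le_exp: "norm (sin z) \<le> exp \<bar>Im z\<bar>"
proof -
  have "norm (sin z) = norm (exp (\<i> * z) - exp (- (\<i> * z))) / 2" by (simp add: sin_exp_eq norm_divide norm_mult)
  also have "norm (exp (\<i> * z) - exp (- (\<i> * z))) \<le> norm (exp (\<i> * z)) + norm (exp (- (\<i> * z)))"
    by (rule norm_triangle_ineq4)
  also have "\<dots> \<le> exp \<bar>Im z\<bar> + exp \<bar>Im z\<bar>" by (intro add_mono) auto
  finally show ?thesis by simp
qed

lemma norm_sin_ge_exp:
  assumes "1 \<le> Im z"
  shows "exp (Im z) / 4 \<le> norm (sin z)"
proof -
  have "norm (sin z) = norm (exp (- (\<i> * z)) - exp (\<i> * z)) / 2" 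
    by (simp add: sin_exp_eq norm_divide norm_mult norm_minus_commute)
  moreover have "norm (exp (- (\<i> * z)) - exp (\<i> * z)) \<ge> norm (exp (- (\<i> * z))) - norm (exp (\<i> * z))"
    by (rule norm_triangle_ineq2)
  then have "norm (exp (- (\<i> * z)) - exp (\<i> * z)) \<ge> exp (Im z) - exp (- Im z)" by simp
  moreover have "exp (- Im z) \<le> 1" "2 \<le> exp (Im z)" using assms exp_ge_add_one_self[of "Im z"] by (simp, linarith)
  ultimately show ?thesis by linarith
qed

text \<open>An entire function for every integer \<open>p\<close>; for \<open>p = 1\<close> it is \<open>sin (\<pi> z) / \<pi>\<close>, and other values of \<open>p\<close>
  change it only by a rational factor.\<close>

definition rGamma_pair :: "int \<Rightarrow> complex \<Rightarrow> complex" where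
  "rGamma_pair p z = rGamma z * rGamma (of_int p - z)"

lemma rGamma_pair_pos:
  assumes "p \<ge> 1"
  shows "sin (of_real pi * z) / of_real pi = pochhammer (1 - z) (nat (p - 1)) * rGamma_pair p z"
proof -
  have *: "(1 - z) + of_nat (nat (p - 1)) = of_int p - z" using assms by (simp add: of_nat_nat)
  then have "rGamma (1 - z) = pochhammer (1 - z) (nat (p - 1)) * rGamma (of_int p - z)"
    using pochhammer_rGamma[of "1 - z" "nat (p - 1)"] by (simp only: *)
  then show ?thesis unfolding rGamma_pair_def using rGamma_reflection_complex[of z] by (metis mult.assoc mult.commute)
qed

lemma rGamma_pair_nonpos:
  assumes "p \<le> 0"
  shows "rGamma_pair p z = pochhammer (of_int p - z) (nat (1 - p)) * (sin (of_real pi * z) / of_real pi)"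
proof -
  have *: "(of_int p - z) + of_nat (nat (1 - p)) = 1 - z" using assms by (simp add: of_nat_nat)
  then have "rGamma (of_int p - z) = pochhammer (of_int p - z) (nat (1 - p)) * rGamma (1 - z)"
    using pochhammer_rGamma[of "of_int p - z" "nat (1 - p)"] by (simp only: *)
  then show ?thesis unfolding rGamma_pair_def using rGamma_reflection_complex[of z] by (metis mult.assoc mult.commute)
qed

lemma norm_pochhammer_ge: "\<bar>Im a\<bar> ^ n \<le> norm (pochhammer a n)"
proof -
  have "\<bar>Im a\<bar> ^ n = (\<Prod>i=0..<n. \<bar>Im a\<bar>)" by simp
  also have "\<dots> \<le> (\<Prod>i=0..<n. norm (a + of_nat i))"
  proof (intro prod_mono conjI)
    fix i show "\<bar>Im a\<bar> \<le> norm (a + of_nat i)" using abs_Im_le_cmod[of "a + of_nat i"] by simp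
  qed auto
  finally show ?thesis by (simp add: pochhammer_prod flip: prod_norm)
qed

lemma norm_pochhammer_le: "norm (pochhammer (a::complex) n) \<le> (norm a + real n) ^ n"
proof -
  have "norm (pochhammer a n) = (\<Prod>i=0..<n. norm (a + of_nat i))" by (simp add: pochhammer_prod flip: prod_norm)
  also have "\<dots> \<le> (\<Prod>i=0..<n. norm a + real n)"
  proof (intro prod_mono conjI)
    fix i assume "i \<in> {0..<n}"
    then show "norm (a + of_nat i) \<le> norm a + real n" using norm_triangle_ineq[of a "of_nat i"] by simp
  qed auto
  finally show ?thesis by simp
qed

text \<open>The factor \<open>exp (norm z)\<close> stands for a power of \<open>norm z\<close>. It is affordable because
  three of them, at slope \<open>1\<close> each, still fit under \<open>exp (\<pi> |Im z|)\<close>.\<close>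

lemma rGamma_pair_growth:
  "\<exists>C\<ge>0. \<forall>z. 1 \<le> \<bar>Im z\<bar> \<longrightarrow> norm (rGamma_pair p z) \<le> C * exp (norm z + pi * \<bar>Im z\<bar>)"
proof (cases "p \<ge> 1")
  case True
  show ?thesis
  proof (intro exI[of _ 1] conjI allI impI)
    fix z :: complex assume z: "1 \<le> \<bar>Im z\<bar>"
    have "1 \<le> norm (pochhammer (1 - z) (nat (p - 1)))"
      using norm_pochhammer_ge[of "1 - z" "nat (p - 1)"] one_le_power[OF z, of "nat (p - 1)"] by simp
    then have "1 * norm (rGamma_pair p z) \<le> norm (pochhammer (1 - z) (nat (p - 1))) * norm (rGamma_pair p z)"
      by (intro mult_right_mono) auto
    also have "\<dots> = norm (sin (of_real pi * z) / of_real pi)"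
      unfolding rGamma_pair_pos[OF True] by (simp add: norm_mult)
    also have "\<dots> \<le> exp (pi * \<bar>Im z\<bar>) / pi"
      using norm_sin_le_exp[of "of_real pi * z"] by (simp add: norm_divide abs_mult divide_right_mono)
    also have "\<dots> \<le> exp (pi * \<bar>Im z\<bar>) / 1" using pi_gt3 by (intro divide_left_mono) auto
    also have "\<dots> \<le> exp (norm z + pi * \<bar>Im z\<bar>)" by simp
    finally show "norm (rGamma_pair p z) \<le> 1 * exp (norm z + pi * \<bar>Im z\<bar>)" by simp
  qed simp
next
  case False
  define n where "n = nat (1 - p)"
  define K where "K = real_of_int \<bar>p\<bar> + real n + 1"
  have K: "K \<ge> 1" by (simp add: K_def)
  show ?thesis
  proof (intro exI[of _ "K ^ n * real n ^ n"] conjI allI impI)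
    fix z :: complex
    have "norm (of_int p - z) + real n \<le> K + norm z"
      using norm_triangle_ineq4[of "of_int p" z] by (simp add: K_def)
    also have "K + norm z \<le> K * (1 + norm z)" using K mult_right_mono[of 1 K "norm z"] by (simp add: algebra_simps)
    finally have "norm (pochhammer (of_int p - z) n) \<le> (K * (1 + norm z)) ^ n"
      using norm_pochhammer_le[of "of_int p - z" n] power_mono[of "norm (of_int p - z) + real n" _ n] by (meson add_nonneg_nonneg norm_ge_zero of_nat_0_le_iff order_trans)
    also have "(K * (1 + norm z)) ^ n \<le> K ^ n * (real n ^ n * exp (norm z))"
      using K one_plus_power_le_exp[of "norm z" n] by (simp add: power_mult_distrib mult_left_mono)
    finally have 1: "norm (pochhammer (of_int p - z) n) \<le> K ^ n * real n ^ n * exp (norm z)"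
      by (simp add: mult_ac)
    have "norm (sin (of_real pi * z) / of_real pi) \<le> exp (pi * \<bar>Im z\<bar>) / pi"
      using norm_sin_le_exp[of "of_real pi * z"] by (simp add: norm_divide abs_mult divide_right_mono)
    also have "\<dots> \<le> exp (pi * \<bar>Im z\<bar>) / 1" using pi_gt3 by (intro divide_left_mono) auto
    finally have 2: "norm (sin (of_real pi * z) / of_real pi) \<le> exp (pi * \<bar>Im z\<bar>)" by simp
    have "norm (rGamma_pair p z) = norm (pochhammer (of_int p - z) n) * norm (sin (of_real pi * z) / of_real pi)"
      using False by (simp only: rGamma_pair_nonpos norm_mult n_def not_le)
    also have "\<dots> \<le> (K ^ n * real n ^ n * exp (norm z)) * exp (pi * \<bar>Im z\<bar>)"
      using 1 2 K by (intro mult_mono) auto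
    finally show "norm (rGamma_pair p z) \<le> K ^ n * real n ^ n * exp (norm z + pi * \<bar>Im z\<bar>)"
      by (simp add: exp_add mult_ac)
  qed (use K in auto)
qed

lemma rGamma_pair_upper:
  assumes "p \<ge> 1" "1 \<le> \<bar>Im z\<bar>"
  shows "norm (rGamma_pair p z) \<le> exp (pi * \<bar>Im z\<bar>) / \<bar>Im z\<bar> ^ nat (p - 1)"
proof -
  have "\<bar>Im z\<bar> ^ nat (p - 1) \<le> norm (pochhammer (1 - z) (nat (p - 1)))"
    using norm_pochhammer_ge[of "1 - z" "nat (p - 1)"] by simp
  then have "\<bar>Im z\<bar> ^ nat (p - 1) * norm (rGamma_pair p z) \<le> norm (pochhammer (1 - z) (nat (p - 1))) * norm (rGamma_pair p z)"
    by (intro mult_right_mono) auto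
  also have "\<dots> = norm (sin (of_real pi * z) / of_real pi)"
    unfolding rGamma_pair_pos[OF assms(1)] by (simp add: norm_mult)
  also have "\<dots> \<le> exp (pi * \<bar>Im z\<bar>) / pi"
    using norm_sin_le_exp[of "of_real pi * z"] by (simp add: norm_divide abs_mult divide_right_mono)
  also have "\<dots> \<le> exp (pi * \<bar>Im z\<bar>) / 1" using pi_gt3 by (intro divide_left_mono) auto
  finally show ?thesis using assms by (simp add: pos_le_divide_eq mult.commute)
qed

text \<open>Together with the corresponding upper bounds for the sines, this decides which quotients decay
  along vertical lines.\<close>

lemma rGamma_pair_lower:
  "\<exists>c>0. \<forall>t\<ge>1. c * t powr (1 - of_int p) * exp (pi * t) \<le> norm (rGamma_pair p (of_real \<sigma> + \<i> * of_real t))"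
proof (cases "p \<ge> 1")
  case True
  define n where "n = nat (p - 1)"
  define K where "K = 2 + \<bar>\<sigma>\<bar> + real n"
  have K: "K > 0" by (simp add: K_def)
  show ?thesis
  proof (intro exI[of _ "1 / (4 * pi * K ^ n)"] conjI allI impI)
    fix t :: real assume t: "t \<ge> 1"
    define z where "z = of_real \<sigma> + \<i> * of_real t"
    have "norm (1 - z) \<le> 1 + \<bar>\<sigma>\<bar> + t"
      using norm_triangle_ineq4[of 1 z] norm_triangle_ineq[of "of_real \<sigma>" "\<i> * of_real t"] t
      by (simp add: z_def norm_mult)
    moreover have "1 + \<bar>\<sigma>\<bar> + t + real n \<le> K * t"
    proof -
      have "1 + \<bar>\<sigma>\<bar> + real n \<le> (1 + \<bar>\<sigma>\<bar> + real n) * t"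
        using t by (intro mult_right_mono[of 1 t, THEN order_trans[rotated], simplified] mult_left_mono[of 1 t "1 + \<bar>\<sigma>\<bar> + real n", simplified]) auto
      then show ?thesis by (simp add: K_def algebra_simps)
    qed
    ultimately have "(norm (1 - z) + real n) ^ n \<le> (K * t) ^ n" by (intro power_mono) auto
    then have p: "norm (pochhammer (1 - z) n) \<le> K ^ n * t ^ n"
      using norm_pochhammer_le[of "1 - z" n] by (simp add: power_mult_distrib)
    have "1 * 1 \<le> pi * t" using t pi_gt3 by (intro mult_mono) auto
    then have "exp (pi * t) / (4 * pi) \<le> norm (sin (of_real pi * z) / of_real pi)"
      using norm_sin_ge_exp[of "of_real pi * z"] by (simp add: z_def norm_divide field_simps)
    also have "\<dots> = norm (pochhammer (1 - z) n) * norm (rGamma_pair p z)"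
      unfolding rGamma_pair_pos[OF True] n_def by (simp add: norm_mult)
    also have "\<dots> \<le> K ^ n * t ^ n * norm (rGamma_pair p z)" using p by (intro mult_right_mono) auto
    finally have "exp (pi * t) / (4 * pi) / (K ^ n * t ^ n) \<le> norm (rGamma_pair p z)"
      using K t by (simp add: pos_divide_le_eq mult_ac)
    moreover have pw: "t powr (1 - of_int p) = inverse (t ^ n)"
    proof -
      have "(1 - real_of_int p) = - real n" using True by (simp add: n_def)
      then show ?thesis using t by (simp add: powr_minus powr_realpow)
    qed
    have "1 / (4 * pi * K ^ n) * t powr (1 - of_int p) * exp (pi * t) = exp (pi * t) / (4 * pi) / (K ^ n * t ^ n)"
      unfolding pw using t K by (simp add: divide_simps)
    ultimately show "1 / (4 * pi * K ^ n) * t powr (1 - of_int p) * exp (pi * t) \<le> norm (rGamma_pair p (of_real \<sigma> + \<i> * of_real t))"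
      by (simp only: z_def)
  qed (use K in auto)
next
  case False
  define n where "n = nat (1 - p)"
  show ?thesis
  proof (intro exI[of _ "1 / (4 * pi)"] conjI allI impI)
    fix t :: real assume t: "t \<ge> 1"
    define z where "z = of_real \<sigma> + \<i> * of_real t"
    have "t ^ n \<le> norm (pochhammer (of_int p - z) n)"
      using norm_pochhammer_ge[of "of_int p - z" n] t by (simp add: z_def)
    moreover have "1 * 1 \<le> pi * t" using t pi_gt3 by (intro mult_mono) auto
    then have "exp (pi * t) / (4 * pi) \<le> norm (sin (of_real pi * z) / of_real pi)"
      using norm_sin_ge_exp[of "of_real pi * z"] by (simp add: z_def norm_divide field_simps)
    ultimately have "t ^ n * (exp (pi * t) / (4 * pi)) \<le> norm (pochhammer (of_int p - z) n) * norm (sin (of_real pi * z) / of_real pi)"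
      using t by (intro mult_mono) auto
    also have "\<dots> = norm (rGamma_pair p z)"
      using False by (simp only: rGamma_pair_nonpos norm_mult n_def not_le)
    finally have le: "t ^ n * (exp (pi * t) / (4 * pi)) \<le> norm (rGamma_pair p z)" .
    have "(1 - real_of_int p) = real n" using False by (simp add: n_def)
    then have "t powr (1 - of_int p) = t ^ n" using t by (simp add: powr_realpow)
    then show "1 / (4 * pi) * t powr (1 - of_int p) * exp (pi * t) \<le> norm (rGamma_pair p (of_real \<sigma> + \<i> * of_real t))"
      using le by (simp add: z_def mult_ac)
  qed auto
qed

section \<open>The boundary value problem on the curve\<close>

text \<open>The parameters \<open>k\<^sub>i\<close> stand for \<open>1 + r\<^sub>i\<close> and the integers \<open>n\<^sub>i\<close> for \<open>\<gamma>\<^sub>i\<close>. The relation is imposed on the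
  imaginary axis only.\<close>

locale curve_equation =
  fixes \<mu>\<^sub>1 \<mu>\<^sub>2 s\<^sub>1 s\<^sub>2 k\<^sub>1 k\<^sub>2 :: real and n\<^sub>1 n\<^sub>2 :: int and m\<^sub>1 m\<^sub>2 :: "real measure"
  assumes mu_pos: "0 < \<mu>\<^sub>1" "0 < \<mu>\<^sub>2" and mu_sum: "\<mu>\<^sub>1 + \<mu>\<^sub>2 = 1"
    and s1_nz: "s\<^sub>1 \<noteq> 0" and k_nz: "k\<^sub>1 \<noteq> 0" "k\<^sub>2 \<noteq> 0"
    and n1: "of_int n\<^sub>1 = \<mu>\<^sub>1 - 2 * s\<^sub>1" and n2: "of_int n\<^sub>2 = \<mu>\<^sub>2 + 2 * s\<^sub>2"
    and meas: "half_line_measure m\<^sub>1" "half_line_measure m\<^sub>2"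
    and curve: "\<And>s. Re s = 0 \<Longrightarrow> s \<noteq> 0 \<Longrightarrow>
      of_real k\<^sub>1 * (s - of_real s\<^sub>1) * laplace m\<^sub>1 (2 * s * (s - of_real \<mu>\<^sub>1))
      + of_real k\<^sub>2 * (s - of_real s\<^sub>2) * laplace m\<^sub>2 (2 * s * (s + of_real \<mu>\<^sub>2)) = 0"
begin

definition curve_y :: "complex \<Rightarrow> complex" where "curve_y s = 2 * s * (s - of_real \<mu>\<^sub>1)"
definition curve_x :: "complex \<Rightarrow> complex" where "curve_x s = 2 * s * (s + of_real \<mu>\<^sub>2)"

text \<open>The two expressions agree on the imaginary axis; the minus sign comes from the curve relation.\<close>

definition glued :: "complex \<Rightarrow> complex" where
  "glued s = (if 0 \<le> Re s then of_real k\<^sub>1 * (s - of_real s\<^sub>1) * laplace m\<^sub>1 (curve_y s)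
          else - (of_real k\<^sub>2 * (s - of_real s\<^sub>2) * laplace m\<^sub>2 (curve_x s)))"

definition reduced_denominator :: "complex \<Rightarrow> complex" where
  "reduced_denominator s = rGamma (s - of_real s\<^sub>1 + 1) * rGamma (of_real (\<mu>\<^sub>1 - s\<^sub>1) - s)
         * (rGamma (s + of_real (s\<^sub>2 + \<mu>\<^sub>2)) * rGamma (1 + of_real s\<^sub>2 - s))"

text \<open>The reciprocal of \<open>\<Gamma>(s - s\<^sub>1) \<Gamma>(\<mu>\<^sub>1 - s\<^sub>1 - s) \<Gamma>(s + s\<^sub>2 + \<mu>\<^sub>2) \<Gamma>(1 + s\<^sub>2 - s)\<close>. This product of Gamma
  functions is invariant under \<open>s \<mapsto> \<mu>\<^sub>1 - s\<close> and satisfies the same difference equation as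
  \<open>s \<mapsto> \<Phi>\<^sub>1(y(s))\<close>.\<close>

definition denominator :: "complex \<Rightarrow> complex" where
  "denominator s = rGamma_pair n\<^sub>1 (s - of_real s\<^sub>1) * rGamma_pair (n\<^sub>2 + 1) (s - of_real s\<^sub>2 + of_int n\<^sub>2)"

lemma denominator_eq: "denominator s = (s - of_real s\<^sub>1) * reduced_denominator s"
proof -
  have "of_int n\<^sub>1 = (of_real (\<mu>\<^sub>1 - 2 * s\<^sub>1) :: complex)" "of_int n\<^sub>2 = (of_real (\<mu>\<^sub>2 + 2 * s\<^sub>2) :: complex)"
    by (simp_all only: n1[symmetric] n2[symmetric] of_real_of_int_eq)
  then have e: "of_int n\<^sub>1 - (s - of_real s\<^sub>1) = of_real (\<mu>\<^sub>1 - s\<^sub>1) - s" "s - of_real s\<^sub>2 + of_int n\<^sub>2 = s + of_real (s\<^sub>2 + \<mu>\<^sub>2)"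
    "of_int (n\<^sub>2 + 1) - (s - of_real s\<^sub>2 + of_int n\<^sub>2) = 1 + of_real s\<^sub>2 - s"
    by (simp_all add: algebra_simps)
  then show ?thesis
    unfolding denominator_def reduced_denominator_def rGamma_pair_def e rGamma_plus1[of "s - of_real s\<^sub>1", symmetric] by (simp only: mult.assoc)
qed

lemma denominator_holomorphic: "denominator holomorphic_on A"
  unfolding denominator_def rGamma_pair_def by (intro holomorphic_intros)

lemma reduced_denominator_holomorphic: "reduced_denominator holomorphic_on A"
  unfolding reduced_denominator_def by (intro holomorphic_intros)

lemma curve_holomorphic [holomorphic_intros]: "curve_y holomorphic_on A" "curve_x holomorphic_on A"
  unfolding curve_y_def[abs_def] curve_x_def[abs_def] by (intro holomorphic_intros)+

lemma curve_continuous [continuous_intros]: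
  "continuous_on A f \<Longrightarrow> continuous_on A (\<lambda>t. curve_y (f t))"
  "continuous_on A f \<Longrightarrow> continuous_on A (\<lambda>t. curve_x (f t))"
  unfolding curve_y_def curve_x_def by (intro continuous_intros; assumption)+

lemma Re_curve_y: "Re (curve_y s) = 2 * ((Re s - \<mu>\<^sub>1 / 2)\<^sup>2 - (Im s)\<^sup>2) - \<mu>\<^sub>1\<^sup>2 / 2"
  by (simp add: curve_y_def power2_eq_square algebra_simps)

lemma Re_curve_y_le: "Re (curve_y s) \<le> 0" if "0 \<le> Re s" "Re s \<le> \<mu>\<^sub>1"
proof -
  have "Re s * (Re s - \<mu>\<^sub>1) \<le> 0" using that by (intro mult_nonneg_nonpos) auto
  moreover have "Re (curve_y s) = 2 * (Re s * (Re s - \<mu>\<^sub>1)) - 2 * (Im s * Im s)" by (simp add: curve_y_def algebra_simps)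
  ultimately show ?thesis using zero_le_square[of "Im s"] by linarith
qed

lemma Re_curve_y_less: "Re (curve_y s) < 0" if "0 < Re s" "Re s < \<mu>\<^sub>1"
proof -
  have "Re s * (Re s - \<mu>\<^sub>1) < 0" using that by (intro mult_pos_neg) auto
  moreover have "Re (curve_y s) = 2 * (Re s * (Re s - \<mu>\<^sub>1)) - 2 * (Im s * Im s)" by (simp add: curve_y_def algebra_simps)
  ultimately show ?thesis using zero_le_square[of "Im s"] by linarith
qed

lemma Re_curve_x_le: "Re (curve_x s) \<le> 0" if "- \<mu>\<^sub>2 \<le> Re s" "Re s \<le> 0"
proof -
  have "Re s * (Re s + \<mu>\<^sub>2) \<le> 0" using that by (intro mult_nonpos_nonneg) auto
  moreover have "Re (curve_x s) = 2 * (Re s * (Re s + \<mu>\<^sub>2)) - 2 * (Im s * Im s)" by (simp add: curve_x_def algebra_simps)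
  ultimately show ?thesis using zero_le_square[of "Im s"] by linarith
qed

lemma Re_curve_x_less: "Re (curve_x s) < 0" if "- \<mu>\<^sub>2 < Re s" "Re s < 0"
proof -
  have "Re s * (Re s + \<mu>\<^sub>2) < 0" using that by (intro mult_neg_pos) auto
  moreover have "Re (curve_x s) = 2 * (Re s * (Re s + \<mu>\<^sub>2)) - 2 * (Im s * Im s)" by (simp add: curve_x_def algebra_simps)
  ultimately show ?thesis using zero_le_square[of "Im s"] by linarith
qed

text \<open>The missing point \<open>s = 0\<close> is added by continuity along the axis.\<close>

lemma curve_axis:
  assumes "Re s = 0"
  shows "of_real k\<^sub>1 * (s - of_real s\<^sub>1) * laplace m\<^sub>1 (curve_y s) = - (of_real k\<^sub>2 * (s - of_real s\<^sub>2) * laplace m\<^sub>2 (curve_x s))"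
proof -
  define q where "q t = of_real k\<^sub>1 * (\<i> * of_real t - of_real s\<^sub>1) * laplace m\<^sub>1 (curve_y (\<i> * of_real t))
      + of_real k\<^sub>2 * (\<i> * of_real t - of_real s\<^sub>2) * laplace m\<^sub>2 (curve_x (\<i> * of_real t))" for t :: real
  have q0: "q t = 0" if "t \<noteq> 0" for t
    using curve[of "\<i> * of_real t"] that by (simp add: q_def curve_y_def curve_x_def)
  have "continuous_on UNIV (\<lambda>t. laplace m\<^sub>1 (curve_y (\<i> * of_real t)))"
    by (rule continuous_on_compose2[OF laplace_continuous_on[OF meas(1)]])
       (use mu_pos in \<open>auto intro!: Re_curve_y_le continuous_intros\<close>)
  moreover have "continuous_on UNIV (\<lambda>t. laplace m\<^sub>2 (curve_x (\<i> * of_real t)))"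
    by (rule continuous_on_compose2[OF laplace_continuous_on[OF meas(2)]])
       (use mu_pos in \<open>auto intro!: Re_curve_x_le continuous_intros\<close>)
  ultimately have cq: "continuous_on UNIV q"
    unfolding q_def by (intro continuous_intros)
  have "(q \<longlongrightarrow> q 0) (at 0)" using cq by (simp add: continuous_on_eq_continuous_at isCont_def)
  moreover have "(q \<longlongrightarrow> 0) (at 0)"
    by (rule tendsto_eventually) (use q0 in \<open>auto simp: eventually_at_filter\<close>)
  ultimately have "q 0 = 0" using tendsto_unique[of "at (0::real)"] by auto
  then have "q (Im s) = 0" using q0 by metis
  moreover have "\<i> * of_real (Im s) = s" using assms by (simp add: complex_eq_iff)
  ultimately show ?thesis by (simp add: q_def eq_neg_iff_add_eq_0)
qed

lemma glued_right: "glued s = of_real k\<^sub>1 * (s - of_real s\<^sub>1) * laplace m\<^sub>1 (curve_y s)" if "0 \<le> Re s"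
  using that by (simp add: glued_def)

lemma glued_left: "glued s = - (of_real k\<^sub>2 * (s - of_real s\<^sub>2) * laplace m\<^sub>2 (curve_x s))" if "Re s \<le> 0"
  using that curve_axis[of s] by (cases "Re s = 0") (simp_all add: glued_def)

lemma glued_continuous: "continuous_on {s. - \<mu>\<^sub>2 \<le> Re s \<and> Re s \<le> - \<mu>\<^sub>2 + 1} glued"
proof -
  have "continuous_on ({s. - \<mu>\<^sub>2 \<le> Re s \<and> Re s \<le> 0} \<union> {s. 0 \<le> Re s \<and> Re s \<le> \<mu>\<^sub>1}) glued"
  proof (rule continuous_on_closed_Un)
    show "closed {s. - \<mu>\<^sub>2 \<le> Re s \<and> Re s \<le> 0}" "closed {s. 0 \<le> Re s \<and> Re s \<le> \<mu>\<^sub>1}"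
      by (intro closed_Collect_conj closed_Collect_le continuous_intros)+
    have "continuous_on {s. - \<mu>\<^sub>2 \<le> Re s \<and> Re s \<le> 0} (\<lambda>s. laplace m\<^sub>2 (curve_x s))"
      by (rule continuous_on_compose2[OF laplace_continuous_on[OF meas(2)]])
        (auto intro!: continuous_intros Re_curve_x_le)
    then have "continuous_on {s. - \<mu>\<^sub>2 \<le> Re s \<and> Re s \<le> 0} (\<lambda>s. - (of_real k\<^sub>2 * (s - of_real s\<^sub>2) * laplace m\<^sub>2 (curve_x s)))"
      by (intro continuous_intros)
    then show "continuous_on {s. - \<mu>\<^sub>2 \<le> Re s \<and> Re s \<le> 0} glued"
      by (rule continuous_on_eq) (simp add: glued_left)
    have "continuous_on {s. 0 \<le> Re s \<and> Re s \<le> \<mu>\<^sub>1} (\<lambda>s. laplace m\<^sub>1 (curve_y s))"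
      by (rule continuous_on_compose2[OF laplace_continuous_on[OF meas(1)]])
        (auto intro!: continuous_intros Re_curve_y_le)
    then have "continuous_on {s. 0 \<le> Re s \<and> Re s \<le> \<mu>\<^sub>1} (\<lambda>s. of_real k\<^sub>1 * (s - of_real s\<^sub>1) * laplace m\<^sub>1 (curve_y s))"
      by (intro continuous_intros)
    then show "continuous_on {s. 0 \<le> Re s \<and> Re s \<le> \<mu>\<^sub>1} glued"
      by (rule continuous_on_eq) (simp add: glued_right)
  qed
  then show ?thesis by (rule continuous_on_subset) (use mu_sum in auto)
qed

lemma glued_holomorphic: "glued holomorphic_on {s. - \<mu>\<^sub>2 < Re s \<and> Re s < - \<mu>\<^sub>2 + 1}" (is "_ holomorphic_on ?S")
proof (rule holomorphic_on_paste_across_line[of _ 1 _ 0])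
  show "open ?S" by (intro open_Collect_conj open_Collect_less continuous_intros)
  show "continuous_on ?S glued" by (rule continuous_on_subset[OF glued_continuous]) auto
  have "(\<lambda>s. laplace m\<^sub>2 (curve_x s)) holomorphic_on {s. - \<mu>\<^sub>2 < Re s \<and> Re s < 0}"
    by (rule holomorphic_on_compose_gen[OF _ laplace_holomorphic_on[OF meas(2)], unfolded o_def])
      (auto intro!: Re_curve_x_less holomorphic_intros)
  then have "(\<lambda>s. - (of_real k\<^sub>2 * (s - of_real s\<^sub>2) * laplace m\<^sub>2 (curve_x s))) holomorphic_on {s. - \<mu>\<^sub>2 < Re s \<and> Re s < 0}"
    by (intro holomorphic_intros)
  then show "glued holomorphic_on ?S \<inter> {z. 1 \<bullet> z < 0}"
    by (rule holomorphic_transform[THEN holomorphic_on_subset]) (auto simp: glued_left inner_complex_def)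
  have "(\<lambda>s. laplace m\<^sub>1 (curve_y s)) holomorphic_on {s. 0 < Re s \<and> Re s < \<mu>\<^sub>1}"
    by (rule holomorphic_on_compose_gen[OF _ laplace_holomorphic_on[OF meas(1)], unfolded o_def])
      (auto intro!: Re_curve_y_less holomorphic_intros)
  then have "(\<lambda>s. of_real k\<^sub>1 * (s - of_real s\<^sub>1) * laplace m\<^sub>1 (curve_y s)) holomorphic_on {s. 0 < Re s \<and> Re s < \<mu>\<^sub>1}"
    by (intro holomorphic_intros)
  then show "glued holomorphic_on ?S \<inter> {z. 0 < 1 \<bullet> z}"
    by (rule holomorphic_transform[THEN holomorphic_on_subset]) (use mu_sum in \<open>auto simp: glued_right inner_complex_def\<close>)
qed simp

text \<open>Reflect \<open>s + 1\<close> about \<open>\<mu>\<^sub>1 / 2\<close> to the imaginary axis, pass to the other transform there, and reflect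
  about \<open>- \<mu>\<^sub>2 / 2\<close> to \<open>s\<close>. Each linear factor picked up on the way is one shift of a reciprocal Gamma
  function.\<close>

lemma glued_product_periodic:
  assumes "Re s = - \<mu>\<^sub>2"
  shows "glued (s + 1) * reduced_denominator (s + 1) = glued s * reduced_denominator s"
proof -
  define z where "z = - of_real \<mu>\<^sub>2 - s"
  have z0: "Re z = 0" using assms by (simp add: z_def)
  have mu: "of_real \<mu>\<^sub>1 + of_real \<mu>\<^sub>2 = (1::complex)" using mu_sum by (simp flip: of_real_add)
  have mu1: "of_real \<mu>\<^sub>1 = (1 - of_real \<mu>\<^sub>2 :: complex)" using mu by (simp add: algebra_simps)
  have yz: "curve_y (s + 1) = curve_y z" by (simp add: curve_y_def z_def mu1 algebra_simps)
  have xz: "curve_x s = curve_x z" by (simp add: curve_x_def z_def algebra_simps)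
  \<comment> \<open>The point \<open>z\<close> is imaginary and \<open>s\<^sub>1\<close> is real and nonzero.\<close>
  have zs: "z - of_real s\<^sub>1 \<noteq> 0" using z0 s1_nz by (auto simp: complex_eq_iff)
  have E1: "glued (s + 1) = of_real k\<^sub>1 * (s + 1 - of_real s\<^sub>1) * laplace m\<^sub>1 (curve_y z)"
    using glued_right[of "s + 1"] assms mu_sum mu_pos by (simp add: yz)
  have E0: "glued s = - (of_real k\<^sub>2 * (s - of_real s\<^sub>2) * laplace m\<^sub>2 (curve_x z))"
    using glued_left[of s] assms mu_pos by (simp add: xz)
  define A where "A = rGamma (s - of_real s\<^sub>1 + 1)"
  define B where "B = rGamma (of_real (\<mu>\<^sub>1 - s\<^sub>1) - s)"
  define C where "C = rGamma (s + 1 + of_real (s\<^sub>2 + \<mu>\<^sub>2))"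
  define D where "D = rGamma (1 + of_real s\<^sub>2 - s)"
  have a: "(s + 1 - of_real s\<^sub>1) * rGamma ((s + 1) - of_real s\<^sub>1 + 1) = A"
    using rGamma_plus1[of "s + 1 - of_real s\<^sub>1"] by (simp add: A_def algebra_simps)
  have b: "rGamma (of_real (\<mu>\<^sub>1 - s\<^sub>1) - (s + 1)) = (z - of_real s\<^sub>1) * B"
  proof -
    have "of_real (\<mu>\<^sub>1 - s\<^sub>1) - (s + 1) = z - of_real s\<^sub>1" using mu by (simp add: z_def algebra_simps)
    moreover have "z - of_real s\<^sub>1 + 1 = of_real (\<mu>\<^sub>1 - s\<^sub>1) - s" using mu by (simp add: z_def algebra_simps)
    ultimately show ?thesis using rGamma_plus1[of "z - of_real s\<^sub>1"] by (simp only: B_def)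
  qed
  have c: "rGamma (s + of_real (s\<^sub>2 + \<mu>\<^sub>2)) = (- (z - of_real s\<^sub>2)) * C"
    using rGamma_plus1[of "s + of_real (s\<^sub>2 + \<mu>\<^sub>2)"] by (simp add: C_def z_def algebra_simps)
  have d: "rGamma (1 + of_real s\<^sub>2 - (s + 1)) = (- (s - of_real s\<^sub>2)) * D"
    using rGamma_plus1[of "of_real s\<^sub>2 - s"] by (simp add: D_def algebra_simps)
  have "glued (s + 1) * reduced_denominator (s + 1) * (z - of_real s\<^sub>1)
     = (of_real k\<^sub>1 * (z - of_real s\<^sub>1) * laplace m\<^sub>1 (curve_y z)) * A * ((z - of_real s\<^sub>1) * B) * (C * ((- (s - of_real s\<^sub>2)) * D))"
    unfolding E1 reduced_denominator_def b d a[symmetric] C_def[symmetric] by (simp only: mult_ac)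
  also have "\<dots> = - (of_real k\<^sub>2 * (z - of_real s\<^sub>2) * laplace m\<^sub>2 (curve_x z)) * A * ((z - of_real s\<^sub>1) * B) * (C * ((- (s - of_real s\<^sub>2)) * D))"
    unfolding curve_axis[OF z0] ..
  also have "\<dots> = glued s * reduced_denominator s * (z - of_real s\<^sub>1)"
    unfolding E0 reduced_denominator_def A_def[symmetric] B_def[symmetric] D_def[symmetric] c by (simp add: algebra_simps)
  finally show ?thesis using zs by simp
qed

text \<open>Away from the real axis the reduced denominator is no larger than the denominator, to which the
  growth of \<open>rGamma_pair\<close> applies; near the real axis compactness suffices.\<close>

lemma glued_product_bound:
  obtains C where "\<And>s. - \<mu>\<^sub>2 \<le> Re s \<Longrightarrow> Re s \<le> \<mu>\<^sub>1 \<Longrightarrow> norm (glued s * reduced_denominator s) \<le> C * exp (3 * pi * \<bar>Im s\<bar>)"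
proof -
  define K where "K = \<bar>k\<^sub>1\<bar> * (1 + \<bar>s\<^sub>1\<bar>) * measure m\<^sub>1 UNIV + \<bar>k\<^sub>2\<bar> * (1 + \<bar>s\<^sub>2\<bar>) * measure m\<^sub>2 UNIV"
  have K: "K \<ge> 0" by (simp add: K_def)
  have aux: "norm (of_real k * (s - of_real a) * w) \<le> \<bar>k\<bar> * (1 + \<bar>a\<bar>) * B * (1 + norm s)" if "norm w \<le> B" for k a B :: real and s w :: complex
  proof -
    have "norm (s - of_real a) \<le> norm s + \<bar>a\<bar>" using norm_triangle_ineq4[of s "of_real a"] by simp
    also have "\<dots> \<le> (1 + \<bar>a\<bar>) * (1 + norm s)" by (simp add: algebra_simps)
    finally have "norm (s - of_real a) \<le> (1 + \<bar>a\<bar>) * (1 + norm s)" .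
    then have "\<bar>k\<bar> * norm (s - of_real a) * norm w \<le> \<bar>k\<bar> * ((1 + \<bar>a\<bar>) * (1 + norm s)) * B"
      using that by (intro mult_mono mult_left_mono) auto
    then show ?thesis by (simp add: norm_mult mult_ac)
  qed
  have Eb: "norm (glued s) \<le> K * exp (norm s)" if s: "- \<mu>\<^sub>2 \<le> Re s" "Re s \<le> \<mu>\<^sub>1" for s
  proof -
    have "norm (glued s) \<le> K * (1 + norm s)"
    proof (cases "0 \<le> Re s")
      case True
      then have "norm (glued s) \<le> \<bar>k\<^sub>1\<bar> * (1 + \<bar>s\<^sub>1\<bar>) * measure m\<^sub>1 UNIV * (1 + norm s)"
        unfolding glued_right[OF True] using s by (intro aux laplace_bound meas Re_curve_y_le)
      also have "\<dots> \<le> K * (1 + norm s)" by (intro mult_right_mono) (auto simp: K_def)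
      finally show ?thesis .
    next
      case False
      then have "norm (glued s) \<le> \<bar>k\<^sub>2\<bar> * (1 + \<bar>s\<^sub>2\<bar>) * measure m\<^sub>2 UNIV * (1 + norm s)"
        using s glued_left[of s] by (simp only: norm_minus_cancel) (intro aux laplace_bound meas Re_curve_x_le, auto)
      also have "\<dots> \<le> K * (1 + norm s)" by (intro mult_right_mono) (auto simp: K_def)
      finally show ?thesis .
    qed
    also have "\<dots> \<le> K * exp (norm s)" using K by (intro mult_left_mono exp_ge_add_one_self)
    finally show ?thesis .
  qed
  obtain C1 where C1: "C1 \<ge> 0" "\<And>z. 1 \<le> \<bar>Im z\<bar> \<Longrightarrow> norm (rGamma_pair n\<^sub>1 z) \<le> C1 * exp (norm z + pi * \<bar>Im z\<bar>)"
    using rGamma_pair_growth by blast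
  obtain C2 where C2: "C2 \<ge> 0" "\<And>z. 1 \<le> \<bar>Im z\<bar> \<Longrightarrow> norm (rGamma_pair (n\<^sub>2 + 1) z) \<le> C2 * exp (norm z + pi * \<bar>Im z\<bar>)"
    using rGamma_pair_growth by blast
  \<comment> \<open>The part of the exponent not coming from \<open>Im s\<close>, real parts in the strip being at most \<open>1\<close> in modulus.\<close>
  define T where "T = 3 + \<bar>s\<^sub>1\<bar> + \<bar>s\<^sub>2\<bar> + \<bar>real_of_int n\<^sub>2\<bar>"
  have far: "norm (glued s * reduced_denominator s) \<le> K * C1 * C2 * exp T * exp (3 * pi * \<bar>Im s\<bar>)"
    if s: "- \<mu>\<^sub>2 \<le> Re s" "Re s \<le> \<mu>\<^sub>1" and t: "1 \<le> \<bar>Im s\<bar>" for s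
  proof -
    define z1 where "z1 = s - of_real s\<^sub>1"
    define z2 where "z2 = s - of_real s\<^sub>2 + of_int n\<^sub>2"
    have ns: "norm s \<le> 1 + \<bar>Im s\<bar>" using cmod_le[of s] s mu_sum mu_pos by linarith
    have nz1: "norm z1 \<le> 1 + \<bar>Im s\<bar> + \<bar>s\<^sub>1\<bar>" using norm_triangle_ineq4[of s "of_real s\<^sub>1"] ns by (simp add: z1_def)
    have nz2: "norm z2 \<le> 1 + \<bar>Im s\<bar> + \<bar>s\<^sub>2\<bar> + \<bar>real_of_int n\<^sub>2\<bar>"
      using norm_triangle_ineq4[of s "of_real s\<^sub>2"] norm_triangle_ineq[of "s - of_real s\<^sub>2" "of_int n\<^sub>2"] ns by (simp add: z2_def)
    have "1 \<le> norm (s - of_real s\<^sub>1)" using abs_Im_le_cmod[of "s - of_real s\<^sub>1"] t by simp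
    then have "1 * norm (reduced_denominator s) \<le> norm (denominator s)" unfolding denominator_eq norm_mult by (intro mult_right_mono) auto
    also have "norm (denominator s) = norm (rGamma_pair n\<^sub>1 z1) * norm (rGamma_pair (n\<^sub>2 + 1) z2)"
      by (simp add: denominator_def z1_def z2_def norm_mult)
    also have "\<dots> \<le> (C1 * exp (norm z1 + pi * \<bar>Im s\<bar>)) * (C2 * exp (norm z2 + pi * \<bar>Im s\<bar>))"
      using C1(2)[of z1] C2(2)[of z2] t C1(1) by (intro mult_mono) (auto simp: z1_def z2_def)
    finally have gb: "norm (reduced_denominator s) \<le> (C1 * exp (norm z1 + pi * \<bar>Im s\<bar>)) * (C2 * exp (norm z2 + pi * \<bar>Im s\<bar>))" by simp
    have "norm (glued s * reduced_denominator s) \<le> (K * exp (norm s)) * ((C1 * exp (norm z1 + pi * \<bar>Im s\<bar>)) * (C2 * exp (norm z2 + pi * \<bar>Im s\<bar>)))"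
      unfolding norm_mult using Eb[OF s] gb K by (intro mult_mono) auto
    also have "\<dots> = K * C1 * C2 * exp (norm s + ((norm z1 + pi * \<bar>Im s\<bar>) + (norm z2 + pi * \<bar>Im s\<bar>)))"
      unfolding exp_add[of "norm s"] exp_add[of "norm z1 + pi * \<bar>Im s\<bar>"] by (simp only: mult_ac)
    also have "\<dots> = K * C1 * C2 * exp (norm s + norm z1 + norm z2 + 2 * pi * \<bar>Im s\<bar>)"
      by (rule arg_cong[where f="\<lambda>u. K * C1 * C2 * exp u"]) (simp add: algebra_simps)
    also have "\<dots> \<le> K * C1 * C2 * exp (T + 3 * pi * \<bar>Im s\<bar>)"
    proof (intro mult_left_mono)
      have "3 * \<bar>Im s\<bar> \<le> pi * \<bar>Im s\<bar>" using pi_gt3 by (intro mult_right_mono) auto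
      then show "exp (norm s + norm z1 + norm z2 + 2 * pi * \<bar>Im s\<bar>) \<le> exp (T + 3 * pi * \<bar>Im s\<bar>)"
        using ns nz1 nz2 by (simp add: T_def algebra_simps)
    qed (use K C1 C2 in auto)
    finally show ?thesis by (simp add: exp_add mult_ac)
  qed
  have "compact (cbox (Complex (- \<mu>\<^sub>2) (-1)) (Complex \<mu>\<^sub>1 1))" by (rule compact_cbox)
  moreover have "continuous_on (cbox (Complex (- \<mu>\<^sub>2) (-1)) (Complex \<mu>\<^sub>1 1)) (\<lambda>s. glued s * reduced_denominator s)"
  proof (intro continuous_on_mult holomorphic_on_imp_continuous_on[OF reduced_denominator_holomorphic])
    show "continuous_on (cbox (Complex (- \<mu>\<^sub>2) (-1)) (Complex \<mu>\<^sub>1 1)) glued"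
      by (rule continuous_on_subset[OF glued_continuous]) (use mu_sum in \<open>auto simp: in_cbox_complex_iff\<close>)
  qed
  ultimately have "bounded ((\<lambda>s. glued s * reduced_denominator s) ` cbox (Complex (- \<mu>\<^sub>2) (-1)) (Complex \<mu>\<^sub>1 1))"
    using compact_continuous_image compact_imp_bounded by blast
  then obtain B where B: "\<And>s. s \<in> cbox (Complex (- \<mu>\<^sub>2) (-1)) (Complex \<mu>\<^sub>1 1) \<Longrightarrow> norm (glued s * reduced_denominator s) \<le> B"
    unfolding bounded_iff by auto
  define C where "C = max B (K * C1 * C2 * exp T)"
  have "0 \<le> K * C1 * C2 * exp T" using K C1(1) C2(1) by simp
  also have "\<dots> \<le> C" by (simp add: C_def)
  finally have C0: "C \<ge> 0" .
  have "norm (glued s * reduced_denominator s) \<le> C * exp (3 * pi * \<bar>Im s\<bar>)" if s: "- \<mu>\<^sub>2 \<le> Re s" "Re s \<le> \<mu>\<^sub>1" for s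
  proof (cases "1 \<le> \<bar>Im s\<bar>")
    case True
    have "K * C1 * C2 * exp T * exp (3 * pi * \<bar>Im s\<bar>) \<le> C * exp (3 * pi * \<bar>Im s\<bar>)"
      by (intro mult_right_mono) (auto simp: C_def)
    then show ?thesis using far[OF s True] by linarith
  next
    case False
    then have "- 1 \<le> Im s \<and> Im s \<le> 1" by linarith
    then have "norm (glued s * reduced_denominator s) \<le> B" using B[of s] s by (simp add: in_cbox_complex_iff)
    also have "B \<le> C * 1" by (simp add: C_def)
    also have "\<dots> \<le> C * exp (3 * pi * \<bar>Im s\<bar>)" using C0 by (intro mult_left_mono) auto
    finally show ?thesis .
  qed
  then show ?thesis using that by blast
qed

lemma glued_product_trig_polynomial:
  obtains a b c where "\<And>s. - \<mu>\<^sub>2 \<le> Re s \<Longrightarrow> Re s \<le> \<mu>\<^sub>1 \<Longrightarrow>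
    glued s * reduced_denominator s = a * exp (- (2 * pi * \<i> * s)) + b + c * exp (2 * pi * \<i> * s)"
proof -
  have ms: "- \<mu>\<^sub>2 + 1 = \<mu>\<^sub>1" using mu_sum by simp
  obtain f where f: "f holomorphic_on UNIV" "\<And>s. f (s + 1) = f s"
    "\<And>s. - \<mu>\<^sub>2 \<le> Re s \<Longrightarrow> Re s \<le> \<mu>\<^sub>1 \<Longrightarrow> f s = glued s * reduced_denominator s"
  proof (rule strip_periodic_extension[of "- \<mu>\<^sub>2" "\<lambda>s. glued s * reduced_denominator s"])
    show "continuous_on {s. - \<mu>\<^sub>2 \<le> Re s \<and> Re s \<le> - \<mu>\<^sub>2 + 1} (\<lambda>s. glued s * reduced_denominator s)"
      by (intro continuous_on_mult glued_continuous holomorphic_on_imp_continuous_on[OF reduced_denominator_holomorphic])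
    show "(\<lambda>s. glued s * reduced_denominator s) holomorphic_on {s. - \<mu>\<^sub>2 < Re s \<and> Re s < - \<mu>\<^sub>2 + 1}"
      by (intro holomorphic_on_mult glued_holomorphic reduced_denominator_holomorphic)
  qed (use glued_product_periodic ms in auto)
  obtain C where C: "\<And>s. - \<mu>\<^sub>2 \<le> Re s \<Longrightarrow> Re s \<le> \<mu>\<^sub>1 \<Longrightarrow> norm (glued s * reduced_denominator s) \<le> C * exp (3 * pi * \<bar>Im s\<bar>)"
    using glued_product_bound by blast
  have fi: "f (s - of_int n) = f s" for s n
    using periodic_of_int[of f s "- n", OF f(2)] by simp
  have "norm (f s) \<le> C * exp (3 * pi * \<bar>Im s\<bar>)" for s
  proof -
    define z where "z = s - of_int \<lfloor>Re s + \<mu>\<^sub>2\<rfloor>"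
    have z: "- \<mu>\<^sub>2 \<le> Re z" "Re z \<le> \<mu>\<^sub>1" "Im z = Im s" using ms by (simp_all add: z_def) linarith+
    then show ?thesis using C[of z] f(3)[of z] fi[of s "\<lfloor>Re s + \<mu>\<^sub>2\<rfloor>"] by (simp add: z_def)
  qed
  then obtain a b c where "\<And>s. f s = a * exp (- (2 * pi * \<i> * s)) + b + c * exp (2 * pi * \<i> * s)"
    using periodic_entire_trig_polynomial[OF f(1,2)] by metis
  then show ?thesis using that f(3) by metis
qed

lemma glued_product_right:
  assumes "0 \<le> Re s"
  shows "glued s * reduced_denominator s = of_real k\<^sub>1 * laplace m\<^sub>1 (curve_y s) * denominator s"
  unfolding glued_right[OF assms] denominator_eq by (simp only: mult_ac)

text \<open>For \<open>n\<^sub>2 \<ge> 1\<close> the second pair of Gamma factors gains a factor \<open>1 / |t|\<close> over the sines, while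
  \<open>\<Phi>\<^sub>1\<close> is bounded.\<close>

lemma glued_product_constant:
  assumes n: "n\<^sub>1 \<ge> 1" "n\<^sub>2 \<ge> 1"
  obtains \<kappa> where "\<And>s. - \<mu>\<^sub>2 \<le> Re s \<Longrightarrow> Re s \<le> \<mu>\<^sub>1 \<Longrightarrow> glued s * reduced_denominator s = \<kappa>"
proof -
  obtain a b c where abc: "\<And>s. - \<mu>\<^sub>2 \<le> Re s \<Longrightarrow> Re s \<le> \<mu>\<^sub>1 \<Longrightarrow>
    glued s * reduced_denominator s = a * exp (- (2 * pi * \<i> * s)) + b + c * exp (2 * pi * \<i> * s)"
    using glued_product_trig_polynomial by blast
  have small: "norm (a * exp (- (2 * pi * \<i> * (of_real (\<mu>\<^sub>1 / 2) + \<i> * of_real t))) + b + c * exp (2 * pi * \<i> * (of_real (\<mu>\<^sub>1 / 2) + \<i> * of_real t)))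
      \<le> \<bar>k\<^sub>1\<bar> * measure m\<^sub>1 UNIV * exp (2 * pi * \<bar>t\<bar>) / \<bar>t\<bar>" if t: "1 \<le> \<bar>t\<bar>" for t :: real
  proof -
    define s where "s = complex_of_real (\<mu>\<^sub>1 / 2) + \<i> * of_real t"
    have s: "0 \<le> Re s" "Re s \<le> \<mu>\<^sub>1" "- \<mu>\<^sub>2 \<le> Re s" "Im s = t" using mu_pos by (simp_all add: s_def)
    have "norm (rGamma_pair n\<^sub>1 (s - of_real s\<^sub>1)) \<le> exp (pi * \<bar>t\<bar>) / \<bar>t\<bar> ^ nat (n\<^sub>1 - 1)"
      using rGamma_pair_upper[OF n(1), of "s - of_real s\<^sub>1"] s t by simp
    also have "\<dots> \<le> exp (pi * \<bar>t\<bar>) / 1" using t by (intro divide_left_mono) (auto intro: one_le_power)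
    finally have 1: "norm (rGamma_pair n\<^sub>1 (s - of_real s\<^sub>1)) \<le> exp (pi * \<bar>t\<bar>)" by simp
    have "norm (rGamma_pair (n\<^sub>2 + 1) (s - of_real s\<^sub>2 + of_int n\<^sub>2)) \<le> exp (pi * \<bar>t\<bar>) / \<bar>t\<bar> ^ nat n\<^sub>2"
      using rGamma_pair_upper[of "n\<^sub>2 + 1" "s - of_real s\<^sub>2 + of_int n\<^sub>2"] n s t by simp
    also have "\<dots> \<le> exp (pi * \<bar>t\<bar>) / \<bar>t\<bar> ^ 1" using t n by (intro divide_left_mono power_increasing mult_pos_pos) auto
    finally have 2: "norm (rGamma_pair (n\<^sub>2 + 1) (s - of_real s\<^sub>2 + of_int n\<^sub>2)) \<le> exp (pi * \<bar>t\<bar>) / \<bar>t\<bar>" by simp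
    have "norm (glued s * reduced_denominator s) \<le> (\<bar>k\<^sub>1\<bar> * measure m\<^sub>1 UNIV) * (exp (pi * \<bar>t\<bar>) * (exp (pi * \<bar>t\<bar>) / \<bar>t\<bar>))"
      unfolding glued_product_right[OF s(1)] denominator_def norm_mult norm_of_real
      using laplace_bound[OF meas(1) Re_curve_y_le[OF s(1,2)]] 1 2
      by (intro mult_mono) auto
    also have "\<dots> = \<bar>k\<^sub>1\<bar> * measure m\<^sub>1 UNIV * exp (2 * pi * \<bar>t\<bar>) / \<bar>t\<bar>"
      by (simp add: mult.assoc exp_double power2_eq_square)
    finally show ?thesis unfolding abc[OF s(3,2)] unfolding s_def .
  qed
  have "a = 0" "c = 0" using trig_polynomial_const_if_small[OF small] by auto
  then show ?thesis using that abc by simp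
qed

text \<open>Both factors of one pair vanish at \<open>a\<^sub>0\<close>, so the trigonometric polynomial has a double zero there.\<close>

lemma glued_product_sin_squared:
  fixes a\<^sub>0 :: real
  assumes a0: "- \<mu>\<^sub>2 < a\<^sub>0" "a\<^sub>0 < \<mu>\<^sub>1"
    and dz: "(rGamma (a\<^sub>0 - s\<^sub>1 + 1) = 0 \<and> rGamma (\<mu>\<^sub>1 - s\<^sub>1 - a\<^sub>0) = 0) \<or>
      (rGamma (a\<^sub>0 + (s\<^sub>2 + \<mu>\<^sub>2)) = 0 \<and> rGamma (1 + s\<^sub>2 - a\<^sub>0) = 0)"
  obtains \<kappa> where "\<And>s. - \<mu>\<^sub>2 \<le> Re s \<Longrightarrow> Re s \<le> \<mu>\<^sub>1 \<Longrightarrow> glued s * reduced_denominator s = \<kappa> * sin (of_real pi * (s - of_real a\<^sub>0)) ^ 2"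
proof -
  obtain a b c where abc: "\<And>s. - \<mu>\<^sub>2 \<le> Re s \<Longrightarrow> Re s \<le> \<mu>\<^sub>1 \<Longrightarrow>
    glued s * reduced_denominator s = a * exp (- (2 * pi * \<i> * s)) + b + c * exp (2 * pi * \<i> * s)"
    using glued_product_trig_polynomial by blast
  define f where "f s = a * exp (- (2 * pi * \<i> * s)) + b + c * exp (2 * pi * \<i> * s)" for s
  define A where "A s = rGamma (s - of_real s\<^sub>1 + 1)" for s :: complex
  define B where "B s = rGamma (of_real (\<mu>\<^sub>1 - s\<^sub>1) - s)" for s :: complex
  define C where "C s = rGamma (s + of_real (s\<^sub>2 + \<mu>\<^sub>2))" for s :: complex
  define D where "D s = rGamma (1 + of_real s\<^sub>2 - s)" for s :: complex
  have reduced_denominator: "reduced_denominator s = A s * B s * (C s * D s)" for s by (simp add: reduced_denominator_def A_def B_def C_def D_def)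
  define S where "S = {s. - \<mu>\<^sub>2 < Re s \<and> Re s < \<mu>\<^sub>1}"
  have S: "open S" "complex_of_real a\<^sub>0 \<in> S" "glued holomorphic_on S"
    using a0 glued_holomorphic mu_sum unfolding S_def
    by (auto intro!: open_Collect_conj open_Collect_less continuous_intros elim: holomorphic_on_subset)
  have dE: "glued field_differentiable (at (of_real a\<^sub>0))"
    using S holomorphic_on_imp_differentiable_at by blast
  have d: "A field_differentiable (at z)" "B field_differentiable (at z)" "C field_differentiable (at z)" "D field_differentiable (at z)" for z
    unfolding A_def B_def C_def D_def
    by (rule holomorphic_on_imp_differentiable_at[of _ UNIV]; (intro holomorphic_intros)?; simp)+
  have vals: "A (of_real a\<^sub>0) = of_real (rGamma (a\<^sub>0 - s\<^sub>1 + 1))" "B (of_real a\<^sub>0) = of_real (rGamma (\<mu>\<^sub>1 - s\<^sub>1 - a\<^sub>0))"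
     "C (of_real a\<^sub>0) = of_real (rGamma (a\<^sub>0 + (s\<^sub>2 + \<mu>\<^sub>2)))" "D (of_real a\<^sub>0) = of_real (rGamma (1 + s\<^sub>2 - a\<^sub>0))"
    by (simp_all add: A_def B_def C_def D_def flip: rGamma_complex_of_real)
  have "((\<lambda>s. glued s * reduced_denominator s) has_field_derivative 0) (at (of_real a\<^sub>0)) \<and> glued (of_real a\<^sub>0) * reduced_denominator (of_real a\<^sub>0) = 0"
    using dz
  proof
    assume z: "rGamma (a\<^sub>0 - s\<^sub>1 + 1) = 0 \<and> rGamma (\<mu>\<^sub>1 - s\<^sub>1 - a\<^sub>0) = 0"
    have "((\<lambda>s. (glued s * (C s * D s)) * (A s * B s)) has_field_derivative 0) (at (of_real a\<^sub>0))"
      by (intro has_derivative_zero_of_double_zero field_differentiable_mult d dE) (use z in \<open>simp_all add: vals\<close>)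
    moreover have "(\<lambda>s. (glued s * (C s * D s)) * (A s * B s)) = (\<lambda>s. glued s * reduced_denominator s)" by (auto simp: reduced_denominator mult_ac)
    ultimately show ?thesis using z by (simp add: reduced_denominator vals)
  next
    assume z: "rGamma (a\<^sub>0 + (s\<^sub>2 + \<mu>\<^sub>2)) = 0 \<and> rGamma (1 + s\<^sub>2 - a\<^sub>0) = 0"
    have "((\<lambda>s. (glued s * (A s * B s)) * (C s * D s)) has_field_derivative 0) (at (of_real a\<^sub>0))"
      by (intro has_derivative_zero_of_double_zero field_differentiable_mult d dE) (use z in \<open>simp_all add: vals\<close>)
    moreover have "(\<lambda>s. (glued s * (A s * B s)) * (C s * D s)) = (\<lambda>s. glued s * reduced_denominator s)" by (auto simp: reduced_denominator mult_ac)
    ultimately show ?thesis using z by (simp add: reduced_denominator vals)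
  qed
  moreover have fS: "f s = glued s * reduced_denominator s" if "s \<in> S" for s using abc[of s] that by (auto simp: f_def S_def)
  ultimately have "f (of_real a\<^sub>0) = 0" "((\<lambda>s. glued s * reduced_denominator s) has_field_derivative 0) (at (of_real a\<^sub>0))" using S by auto
  moreover have ev: "eventually (\<lambda>s. glued s * reduced_denominator s = f s) (nhds (of_real a\<^sub>0))"
    using eventually_nhds_in_open[OF S(1,2)] fS by (auto elim: eventually_mono)
  ultimately have "f (of_real a\<^sub>0) = 0" "(f has_field_derivative 0) (at (of_real a\<^sub>0))"
    using DERIV_cong_ev[OF refl ev refl] by auto
  then obtain \<kappa> where "\<And>s. f s = \<kappa> * sin (of_real pi * (s - of_real a\<^sub>0)) ^ 2"
    using trig_polynomial_double_zero[of f a b c "of_real a\<^sub>0"] f_def by metis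
  then show ?thesis using that abc f_def by metis
qed

text \<open>Moving away from the real axis decreases \<open>Re (y(s))\<close>.\<close>

lemma islimpt_left_region:
  assumes "Re (curve_y s) \<le> 0"
  shows "s islimpt {s. Re (curve_y s) < 0}"
  unfolding islimpt_approachable
proof (intro allI impI)
  fix e :: real assume e: "e > 0"
  define d where "d = (if Im s \<ge> 0 then e / 2 else - (e / 2))"
  define z where "z = s + \<i> * of_real d"
  have "(Im s)\<^sup>2 < (Im z)\<^sup>2"
    using e by (intro power2_strict_mono) (auto simp: z_def d_def)
  then have "Re (curve_y z) < 0" using assms by (simp add: Re_curve_y z_def)
  moreover have "z \<noteq> s" using e by (simp add: z_def d_def)
  moreover have "dist z s < e" using e by (simp add: z_def d_def dist_norm norm_mult)
  ultimately show "\<exists>x'\<in>{s. Re (curve_y s) < 0}. x' \<noteq> s \<and> dist x' s < e" by blast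
qed

text \<open>With \<open>w = s - \<mu>\<^sub>1 / 2\<close> the region is \<open>Re (w\<^sup>2) < \<mu>\<^sub>1\<^sup>2 / 4\<close>, which is starlike about \<open>w = 0\<close>.\<close>

lemma connected_left_region: "connected {s. Re (curve_y s) < 0}"
proof (rule starlike_imp_connected, unfold starlike_def, intro bexI ballI subsetI)
  show "complex_of_real (\<mu>\<^sub>1 / 2) \<in> {s. Re (curve_y s) < 0}" using mu_pos by (simp add: Re_curve_y)
  fix s z assume s: "s \<in> {s. Re (curve_y s) < 0}" and z: "z \<in> closed_segment (complex_of_real (\<mu>\<^sub>1 / 2)) s"
  from z obtain t where t: "0 \<le> t" "t \<le> 1" "z = (1 - t) *\<^sub>R complex_of_real (\<mu>\<^sub>1 / 2) + t *\<^sub>R s" by (auto simp: closed_segment_def)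
  define w where "w = (Re s - \<mu>\<^sub>1 / 2)\<^sup>2 - (Im s)\<^sup>2"
  have 1: "Re z - \<mu>\<^sub>1 / 2 = t * (Re s - \<mu>\<^sub>1 / 2)" "Im z = t * Im s" by (simp_all add: t(3) algebra_simps)
  have "(Re z - \<mu>\<^sub>1 / 2)\<^sup>2 - (Im z)\<^sup>2 = t\<^sup>2 * w"
    unfolding 1 w_def power_mult_distrib by (rule right_diff_distrib[symmetric])
  moreover have "t\<^sup>2 * w < \<mu>\<^sub>1\<^sup>2 / 4"
  proof (cases "w \<ge> 0")
    case True
    then have "t\<^sup>2 * w \<le> 1 * w" using t by (intro mult_right_mono) (auto simp: power_le_one)
    then show ?thesis using s by (simp add: Re_curve_y w_def)
  next
    case False
    then have "t\<^sup>2 * w \<le> 0" by (intro mult_nonneg_nonpos) auto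
    also have "0 < \<mu>\<^sub>1\<^sup>2 / 4" using mu_pos by simp
    finally show ?thesis .
  qed
  ultimately show "z \<in> {s. Re (curve_y s) < 0}" by (simp add: Re_curve_y)
qed

lemma denominator_nonzero: "denominator s \<noteq> 0" if "Im s \<noteq> 0"
proof -
  have "rGamma w \<noteq> 0" if "Im w \<noteq> 0" for w :: complex
    using that by (auto simp: rGamma_eq_zero_iff elim!: nonpos_Ints_cases)
  then show ?thesis using that by (simp add: denominator_def rGamma_pair_def)
qed

lemma laplace_curve_y_continuous: "continuous_on {s. Re (curve_y s) \<le> 0} (\<lambda>s. laplace m\<^sub>1 (curve_y s))"
  by (rule continuous_on_compose2[OF laplace_continuous_on[OF meas(1)]]) (auto intro!: continuous_intros)

lemma solution_continuation:
  assumes u: "u holomorphic_on UNIV"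
    and strip: "\<And>s. 0 < Re s \<Longrightarrow> Re s < \<mu>\<^sub>1 \<Longrightarrow> of_real k\<^sub>1 * laplace m\<^sub>1 (curve_y s) * denominator s = u s"
    and s: "Re (curve_y s) \<le> 0"
  shows "of_real k\<^sub>1 * laplace m\<^sub>1 (curve_y s) * denominator s = u s"
proof -
  define D where "D = {s. Re (curve_y s) < 0}"
  define q where "q s = of_real k\<^sub>1 * laplace m\<^sub>1 (curve_y s) * denominator s - u s" for s
  have oD: "open D" unfolding D_def by (intro open_Collect_less continuous_intros)
  have "(\<lambda>s. laplace m\<^sub>1 (curve_y s)) holomorphic_on D"
    by (rule holomorphic_on_compose_gen[OF _ laplace_holomorphic_on[OF meas(1)], unfolded o_def])
      (auto intro!: holomorphic_intros simp: D_def)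
  then have qD: "q holomorphic_on D"
    unfolding q_def by (intro holomorphic_intros denominator_holomorphic holomorphic_on_subset[OF u]) auto
  have q0: "q z = 0" if "z \<in> D" for z
  proof (rule analytic_continuation[OF qD oD])
    show "connected D" unfolding D_def by (rule connected_left_region)
    show "{s. 0 < Re s \<and> Re s < \<mu>\<^sub>1} \<subseteq> D" using Re_curve_y_less by (auto simp: D_def)
    show "of_real (\<mu>\<^sub>1 / 2) \<in> D" using mu_pos by (simp add: D_def Re_curve_y)
    have "open {s. 0 < Re s \<and> Re s < \<mu>\<^sub>1}" by (intro open_Collect_conj open_Collect_less continuous_intros)
    then show "complex_of_real (\<mu>\<^sub>1 / 2) islimpt {s. 0 < Re s \<and> Re s < \<mu>\<^sub>1}"
      using mu_pos by (intro interior_limit_point) (simp add: interior_open)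
  qed (use strip that in \<open>auto simp: q_def\<close>)
  have "closed {s. Re (curve_y s) \<le> 0}" by (intro closed_Collect_le continuous_intros)
  then have cl: "closure D \<subseteq> {s. Re (curve_y s) \<le> 0}" by (intro closure_minimal) (auto simp: D_def)
  have "continuous_on {s. Re (curve_y s) \<le> 0} q"
    unfolding q_def by (intro continuous_intros laplace_curve_y_continuous holomorphic_on_imp_continuous_on[OF denominator_holomorphic]
       continuous_on_subset[OF holomorphic_on_imp_continuous_on[OF u]]) auto
  then have "continuous_on (closure D) q" using cl continuous_on_subset by blast
  moreover have "s \<in> closure D" using islimpt_left_region[OF s] by (simp add: closure_def D_def)
  ultimately have "q s = 0" using continuous_constant_on_closure[of D q 0 s] q0 by auto
  then show ?thesis by (simp add: q_def)
qed

text \<open>A quotient of entire functions has a limit or a pole; the pole is excluded because \<open>\<Phi>\<^sub>1\<close> is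
  bounded on the part of the neighbourhood where the quotient equals it. This covers the boundary
  \<open>Re y = 0\<close>, beyond which the transform need not exist.\<close>

lemma solution_tendsto_curve:
  assumes u: "u holomorphic_on UNIV"
    and sol: "\<And>s. Re (curve_y s) \<le> 0 \<Longrightarrow> of_real k\<^sub>1 * laplace m\<^sub>1 (curve_y s) * denominator s = u s"
    and s: "Re (curve_y s) \<le> 0"
  shows "((\<lambda>s. u s / denominator s) \<longlongrightarrow> of_real k\<^sub>1 * laplace m\<^sub>1 (curve_y s)) (at s)"
proof -
  define D where "D = {s. Re (curve_y s) < 0}"
  define q where "q s = u s / denominator s" for s
  have nb: "at s within D \<noteq> bot" using islimpt_left_region[OF s] by (simp add: D_def trivial_limit_within)
  have hi: "denominator \<i> \<noteq> 0" by (rule denominator_nonzero) simp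
  have hev: "eventually (\<lambda>z. denominator z \<noteq> 0) (at s)"
    using non_zero_neighbour_alt[OF denominator_holomorphic open_UNIV connected_UNIV UNIV_I UNIV_I hi]
    by (rule eventually_mono) blast
  have "((\<lambda>s. of_real k\<^sub>1 * laplace m\<^sub>1 (curve_y s)) \<longlongrightarrow> of_real k\<^sub>1 * laplace m\<^sub>1 (curve_y s)) (at s within {s. Re (curve_y s) \<le> 0})"
    using laplace_curve_y_continuous s by (intro tendsto_intros) (simp add: continuous_on)
  then have lm: "((\<lambda>s. of_real k\<^sub>1 * laplace m\<^sub>1 (curve_y s)) \<longlongrightarrow> of_real k\<^sub>1 * laplace m\<^sub>1 (curve_y s)) (at s within D)"
    by (rule tendsto_within_subset) (auto simp: D_def)
  have "eventually (\<lambda>z. denominator z \<noteq> 0) (at s within D)"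
    by (rule filter_leD[OF _ hev]) (simp add: at_le)
  moreover have "eventually (\<lambda>z. z \<in> D) (at s within D)" by (simp add: eventually_at_filter)
  ultimately have "eventually (\<lambda>z. of_real k\<^sub>1 * laplace m\<^sub>1 (curve_y z) = q z) (at s within D)"
  proof eventually_elim
    fix z assume "denominator z \<noteq> 0" "z \<in> D"
    then show "of_real k\<^sub>1 * laplace m\<^sub>1 (curve_y z) = q z"
      using sol[of z] by (simp add: D_def q_def field_simps)
  qed
  with lm have lim: "(q \<longlongrightarrow> of_real k\<^sub>1 * laplace m\<^sub>1 (curve_y s)) (at s within D)"
    by (rule Lim_transform_eventually)
  have "u analytic_on {s}" "denominator analytic_on {s}"
    using u denominator_holomorphic[of UNIV] by (meson analytic_on_subset analytic_on_open open_UNIV subset_UNIV)+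
  then have "not_essential q s"
    unfolding q_def by (intro not_essential_divide not_essential_analytic isolated_singularity_at_analytic)
  moreover have "\<not> is_pole q s"
  proof
    assume "is_pole q s"
    then have "filterlim q at_infinity (at s within D)"
      unfolding is_pole_def by (rule filterlim_mono[OF _ order_refl at_le[OF subset_UNIV]])
    then show False using lim not_tendsto_and_filterlim_at_infinity[OF nb] by blast
  qed
  ultimately obtain x where x: "(q \<longlongrightarrow> x) (at s)" unfolding not_essential_def by blast
  then have "(q \<longlongrightarrow> x) (at s within D)" by (rule tendsto_within_subset) simp
  then have "x = of_real k\<^sub>1 * laplace m\<^sub>1 (curve_y s)" using lim nb tendsto_unique by blast
  then show ?thesis using x by (simp add: q_def[abs_def])
qed

definition curve_point :: "complex \<Rightarrow> complex" where "curve_point y = (of_real \<mu>\<^sub>1 + csqrt (2 * y + of_real (\<mu>\<^sub>1\<^sup>2))) / 2"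

lemma curve_y_curve_point: "curve_y (curve_point y) = y"
proof -
  have "csqrt (2 * y + of_real (\<mu>\<^sub>1\<^sup>2)) * csqrt (2 * y + of_real (\<mu>\<^sub>1\<^sup>2)) = 2 * y + of_real (\<mu>\<^sub>1\<^sup>2)"
    by (simp flip: power2_eq_square)
  then show ?thesis by (simp add: curve_y_def curve_point_def field_simps power2_eq_square)
qed

text \<open>The square root chosen in \<open>curve_point\<close> jumps across a cut, but near \<open>y\<close> its values stay close to one
  of the two preimages \<open>s\<close> and \<open>\<mu>\<^sub>1 - s\<close>, and the limit is the same at both.\<close>

lemma solution_tendsto:
  assumes u: "u holomorphic_on UNIV"
    and sol: "\<And>s. Re (curve_y s) \<le> 0 \<Longrightarrow> of_real k\<^sub>1 * laplace m\<^sub>1 (curve_y s) * denominator s = u s"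
    and y: "Re y \<le> 0"
  shows "((\<lambda>y. u (curve_point y) / denominator (curve_point y)) \<longlongrightarrow> of_real k\<^sub>1 * laplace m\<^sub>1 y) (at y)"
proof (rule tendstoI)
  fix e :: real assume e: "e > 0"
  define s where "s = curve_point y"
  define s' where "s' = of_real \<mu>\<^sub>1 - s"
  have ys: "curve_y s = y" "curve_y s' = y" using curve_y_curve_point[of y] by (simp_all add: s_def s'_def curve_y_def algebra_simps)
  have "((\<lambda>s. u s / denominator s) \<longlongrightarrow> of_real k\<^sub>1 * laplace m\<^sub>1 y) (at s)" "((\<lambda>s. u s / denominator s) \<longlongrightarrow> of_real k\<^sub>1 * laplace m\<^sub>1 y) (at s')"
    using solution_tendsto_curve[OF u sol, of s] solution_tendsto_curve[OF u sol, of s'] ys y by auto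
  from this[THEN tendstoD, OF e] obtain d d' where d: "d > 0" "\<And>z. z \<noteq> s \<Longrightarrow> dist z s < d \<Longrightarrow> dist (u z / denominator z) (of_real k\<^sub>1 * laplace m\<^sub>1 y) < e"
     and d': "d' > 0" "\<And>z. z \<noteq> s' \<Longrightarrow> dist z s' < d' \<Longrightarrow> dist (u z / denominator z) (of_real k\<^sub>1 * laplace m\<^sub>1 y) < e"
    unfolding eventually_at by auto
  show "\<forall>\<^sub>F z in at y. dist (u (curve_point z) / denominator (curve_point z)) (of_real k\<^sub>1 * laplace m\<^sub>1 y) < e"
    unfolding eventually_at
  proof (intro exI[of _ "2 * (d * d')"] conjI ballI impI)
    fix z assume "z \<noteq> y \<and> dist z y < 2 * (d * d')"
    then have z: "z \<noteq> y" "norm (z - y) < 2 * (d * d')" by (auto simp: dist_norm)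
    have f: "z - y = 2 * ((curve_point z - s) * (curve_point z - s'))"
    proof -
      have "z - y = curve_y (curve_point z) - curve_y s" by (simp add: curve_y_curve_point ys)
      also have "\<dots> = 2 * ((curve_point z - s) * (curve_point z - s'))" by (simp add: curve_y_def s'_def algebra_simps)
      finally show ?thesis .
    qed
    have ne: "curve_point z \<noteq> s" "curve_point z \<noteq> s'" using f z(1) by auto
    have "norm (curve_point z - s) < d \<or> norm (curve_point z - s') < d'"
    proof (rule ccontr)
      assume "\<not> ?thesis"
      then have "d * d' \<le> norm (curve_point z - s) * norm (curve_point z - s')" using d(1) d'(1) by (intro mult_mono) auto
      then show False using z(2) unfolding f by (simp add: norm_mult)
    qed
    then show "dist (u (curve_point z) / denominator (curve_point z)) (of_real k\<^sub>1 * laplace m\<^sub>1 y) < e"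
      using d(2)[OF ne(1)] d'(2)[OF ne(2)] by (auto simp: dist_norm)
  qed (use d d' in auto)
qed

text \<open>Along \<open>s = \<mu>\<^sub>1 / 2 + \<i> t\<close> the variable \<open>y\<close> tends to \<open>- \<infinity>\<close>, where \<open>\<Phi>\<^sub>1\<close> tends to the mass of the corner
  while \<open>u / denominator\<close> tends to \<open>0\<close>.\<close>

lemma atom_zero:
  assumes sol: "\<And>s. Re (curve_y s) \<le> 0 \<Longrightarrow> of_real k\<^sub>1 * laplace m\<^sub>1 (curve_y s) * denominator s = u s"
    and u: "((\<lambda>t::real. norm (u (of_real (\<mu>\<^sub>1 / 2) + \<i> * of_real t)) * t powr of_int (n\<^sub>1 + n\<^sub>2 - 1) * exp (- (2 * pi * t))) \<longlongrightarrow> 0) at_top"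
  shows "measure m\<^sub>1 {0} = 0"
proof -
  define s where "s t = complex_of_real (\<mu>\<^sub>1 / 2) + \<i> * of_real t" for t :: real
  have Re: "Re (curve_y (s t)) = - 2 * t\<^sup>2 - \<mu>\<^sub>1\<^sup>2 / 2" for t by (simp add: Re_curve_y s_def)
  then have Re0: "Re (curve_y (s t)) \<le> 0" for t using zero_le_power2[of t] zero_le_power2[of \<mu>\<^sub>1] unfolding Re by linarith
  obtain c1 where c1: "c1 > 0" "\<And>t. t \<ge> 1 \<Longrightarrow> c1 * t powr (1 - of_int n\<^sub>1) * exp (pi * t) \<le> norm (rGamma_pair n\<^sub>1 (of_real (\<mu>\<^sub>1 / 2 - s\<^sub>1) + \<i> * of_real t))"
    using rGamma_pair_lower by metis
  obtain c2 where c2: "c2 > 0" "\<And>t. t \<ge> 1 \<Longrightarrow> c2 * t powr (1 - of_int (n\<^sub>2 + 1)) * exp (pi * t) \<le> norm (rGamma_pair (n\<^sub>2 + 1) (of_real (\<mu>\<^sub>1 / 2 - s\<^sub>2 + of_int n\<^sub>2) + \<i> * of_real t))"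
    using rGamma_pair_lower by metis
  have hb: "c1 * c2 * t powr (of_int (1 - n\<^sub>1 - n\<^sub>2)) * exp (2 * pi * t) \<le> norm (denominator (s t))" if t: "t \<ge> 1" for t
  proof -
    have "(c1 * t powr (1 - of_int n\<^sub>1) * exp (pi * t)) * (c2 * t powr (1 - of_int (n\<^sub>2 + 1)) * exp (pi * t)) \<le> norm (denominator (s t))"
    proof -
      have "s t - of_real s\<^sub>1 = of_real (\<mu>\<^sub>1 / 2 - s\<^sub>1) + \<i> * of_real t" "s t - of_real s\<^sub>2 + of_int n\<^sub>2 = of_real (\<mu>\<^sub>1 / 2 - s\<^sub>2 + of_int n\<^sub>2) + \<i> * of_real t"
        by (simp_all add: s_def)
      then show ?thesis
        unfolding denominator_def norm_mult using c1 c2 t by (simp only:) (intro mult_mono, auto)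
    qed
    moreover have "t powr (1 - of_int n\<^sub>1) * t powr (1 - of_int (n\<^sub>2 + 1)) = t powr (of_int (1 - n\<^sub>1 - n\<^sub>2))"
      by (simp flip: powr_add)
    moreover have "exp (pi * t) * exp (pi * t) = exp (2 * pi * t)" by (simp flip: exp_add)
    ultimately show ?thesis by (metis (no_types, opaque_lifting) mult.assoc mult.left_commute)
  qed
  have e: "norm (of_real k\<^sub>1 * laplace m\<^sub>1 (curve_y (s t))) \<le> (norm (u (s t)) * t powr of_int (n\<^sub>1 + n\<^sub>2 - 1) * exp (- (2 * pi * t))) / (c1 * c2)" if t: "t \<ge> 1" for t
  proof -
    define P where "P = t powr (of_int (1 - n\<^sub>1 - n\<^sub>2)) * exp (2 * pi * t)"
    have P: "P > 0" using t by (simp add: P_def)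
    have Pi: "inverse P = t powr of_int (n\<^sub>1 + n\<^sub>2 - 1) * exp (- (2 * pi * t))"
      unfolding P_def using t by (simp add: exp_minus algebra_simps flip: powr_minus)
    have "norm (of_real k\<^sub>1 * laplace m\<^sub>1 (curve_y (s t))) * (c1 * c2 * P) \<le> norm (of_real k\<^sub>1 * laplace m\<^sub>1 (curve_y (s t))) * norm (denominator (s t))"
      using hb[OF t] by (intro mult_left_mono) (auto simp: P_def mult_ac)
    also have "\<dots> = norm (u (s t))" using sol[OF Re0[of t]] by (metis norm_mult)
    finally have "norm (of_real k\<^sub>1 * laplace m\<^sub>1 (curve_y (s t))) \<le> norm (u (s t)) / (c1 * c2 * P)"
      using P c1 c2 by (simp add: pos_le_divide_eq)
    also have "\<dots> = (norm (u (s t)) * inverse P) / (c1 * c2)" by (simp add: field_simps)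
    finally show ?thesis unfolding Pi by (simp only: mult.assoc)
  qed
  have "((\<lambda>t. of_real k\<^sub>1 * laplace m\<^sub>1 (curve_y (s t))) \<longlongrightarrow> 0) at_top"
  proof (rule Lim_null_comparison)
    show "\<forall>\<^sub>F t in at_top. norm (of_real k\<^sub>1 * laplace m\<^sub>1 (curve_y (s t))) \<le> (norm (u (s t)) * t powr of_int (n\<^sub>1 + n\<^sub>2 - 1) * exp (- (2 * pi * t))) / (c1 * c2)"
      by (rule eventually_at_top_linorderI[of 1]) (rule e)
    show "((\<lambda>t. (norm (u (s t)) * t powr of_int (n\<^sub>1 + n\<^sub>2 - 1) * exp (- (2 * pi * t))) / (c1 * c2)) \<longlongrightarrow> 0) at_top"
      using tendsto_divide[OF u tendsto_const, of "c1 * c2"] c1 c2 by (simp add: s_def)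
  qed
  then have 0: "(\<lambda>n. of_real k\<^sub>1 * laplace m\<^sub>1 (curve_y (s (real n)))) \<longlonglongrightarrow> 0"
    by (rule filterlim_compose[OF _ filterlim_real_sequentially])
  have "filterlim (\<lambda>n. Re (curve_y (s (real n)))) at_bot sequentially"
    unfolding Re by real_asymp
  then have "(\<lambda>n. of_real k\<^sub>1 * laplace m\<^sub>1 (curve_y (s (real n)))) \<longlonglongrightarrow> of_real k\<^sub>1 * of_real (measure m\<^sub>1 {0})"
    by (intro tendsto_intros laplace_tendsto_atom meas)
  then have "of_real k\<^sub>1 * complex_of_real (measure m\<^sub>1 {0}) = 0" using 0 LIMSEQ_unique by blast
  then show ?thesis using k_nz by simp
qed

text \<open>Evaluating at the real point \<open>\<mu>\<^sub>1 / 4\<close> of the strip, where all quantities are real, shows that the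
  constant is real.\<close>

lemma solution_real_limit:
  assumes u: "u holomorphic_on UNIV" and ur: "u (of_real (\<mu>\<^sub>1 / 4)) = of_real u\<^sub>0" "u\<^sub>0 \<noteq> 0"
    and strip: "\<And>s. - \<mu>\<^sub>2 \<le> Re s \<Longrightarrow> Re s \<le> \<mu>\<^sub>1 \<Longrightarrow> glued s * reduced_denominator s = \<kappa> * u s"
    and growth: "((\<lambda>t::real. norm (u (of_real (\<mu>\<^sub>1 / 2) + \<i> * of_real t)) * t powr of_int (n\<^sub>1 + n\<^sub>2 - 1) * exp (- (2 * pi * t))) \<longlongrightarrow> 0) at_top"
  obtains c :: real where "measure m\<^sub>1 {0} = 0"
    "\<And>y. Re y \<le> 0 \<Longrightarrow> ((\<lambda>y. of_real c * (u (curve_point y) / denominator (curve_point y))) \<longlongrightarrow> laplace m\<^sub>1 y) (at y)"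
proof -
  have ku: "(\<lambda>s. \<kappa> * u s) holomorphic_on UNIV" using u by (intro holomorphic_intros)
  have sol: "of_real k\<^sub>1 * laplace m\<^sub>1 (curve_y s) * denominator s = \<kappa> * u s" if "Re (curve_y s) \<le> 0" for s
  proof (rule solution_continuation[OF ku _ that])
    fix z assume z: "0 < Re z" "Re z < \<mu>\<^sub>1"
    then have "glued z * reduced_denominator z = \<kappa> * u z" using mu_pos by (intro strip) auto
    then show "of_real k\<^sub>1 * laplace m\<^sub>1 (curve_y z) * denominator z = \<kappa> * u z" using glued_product_right[of z] z by simp
  qed
  have at0: "measure m\<^sub>1 {0} = 0"
  proof (rule atom_zero[of "\<lambda>s. \<kappa> * u s", OF sol])
    show "((\<lambda>t::real. norm (\<kappa> * u (of_real (\<mu>\<^sub>1 / 2) + \<i> * of_real t)) * t powr of_int (n\<^sub>1 + n\<^sub>2 - 1) * exp (- (2 * pi * t))) \<longlongrightarrow> 0) at_top"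
      using tendsto_mult_left[OF growth, of "norm \<kappa>"] by (simp add: norm_mult mult.assoc)
  qed
  define r where "r = \<mu>\<^sub>1 / 4"
  have "curve_y (of_real r) = of_real (2 * r * (r - \<mu>\<^sub>1))" by (simp add: curve_y_def)
  then obtain L where L: "laplace m\<^sub>1 (curve_y (of_real r)) = of_real L" using laplace_of_real by metis
  have "\<exists>H. denominator (of_real r) = of_real H"
  proof -
    have "denominator (of_real r) = of_real (rGamma (r - s\<^sub>1) * rGamma (of_int n\<^sub>1 - (r - s\<^sub>1)) *
       (rGamma (r - s\<^sub>2 + of_int n\<^sub>2) * rGamma (of_int (n\<^sub>2 + 1) - (r - s\<^sub>2 + of_int n\<^sub>2))))"
      by (simp add: denominator_def rGamma_pair_def flip: rGamma_complex_of_real)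
    then show ?thesis by blast
  qed
  then obtain H where H: "denominator (of_real r) = of_real H" by blast
  have "Re (curve_y (of_real r)) \<le> 0" using mu_pos by (intro Re_curve_y_le) (simp_all add: r_def)
  from sol[OF this] have "of_real k\<^sub>1 * of_real L * of_real H = \<kappa> * of_real u\<^sub>0"
    unfolding L H unfolding r_def ur(1) .
  then have kr: "\<kappa> = of_real (k\<^sub>1 * L * H / u\<^sub>0)" using ur(2) by (simp add: field_simps)
  show ?thesis
  proof (rule that[OF at0, of "k\<^sub>1 * L * H / u\<^sub>0 / k\<^sub>1"])
    fix y :: complex assume y: "Re y \<le> 0"
    have "((\<lambda>y. (\<kappa> * u (curve_point y) / denominator (curve_point y)) / of_real k\<^sub>1) \<longlongrightarrow> (of_real k\<^sub>1 * laplace m\<^sub>1 y) / of_real k\<^sub>1) (at y)"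
      using solution_tendsto[OF ku sol y] k_nz by (intro tendsto_divide tendsto_const) auto
    moreover have "(\<kappa> * u (curve_point z) / denominator (curve_point z)) / of_real k\<^sub>1 = of_real (k\<^sub>1 * L * H / u\<^sub>0 / k\<^sub>1) * (u (curve_point z) / denominator (curve_point z))" for z
      unfolding kr by (simp add: field_simps)
    ultimately show "((\<lambda>y. of_real (k\<^sub>1 * L * H / u\<^sub>0 / k\<^sub>1) * (u (curve_point y) / denominator (curve_point y))) \<longlongrightarrow> laplace m\<^sub>1 y) (at y)"
      using k_nz by simp
  qed
qed

theorem laplace_limit_positive:
  assumes n: "n\<^sub>1 \<ge> 1" "n\<^sub>2 \<ge> 1"
  obtains c :: real where "measure m\<^sub>1 {0} = 0"
    "\<And>y. Re y \<le> 0 \<Longrightarrow> ((\<lambda>y. of_real c * (1 / denominator (curve_point y))) \<longlongrightarrow> laplace m\<^sub>1 y) (at y)"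
proof -
  obtain \<kappa> where \<kappa>: "\<And>s. - \<mu>\<^sub>2 \<le> Re s \<Longrightarrow> Re s \<le> \<mu>\<^sub>1 \<Longrightarrow> glued s * reduced_denominator s = \<kappa>"
    using glued_product_constant[OF n] by blast
  have "((\<lambda>t::real. t powr a * exp (- (2 * pi * t))) \<longlongrightarrow> 0) at_top" for a :: real by real_asymp
  then show ?thesis
    using solution_real_limit[of "\<lambda>_. 1" 1 \<kappa>] \<kappa> that by auto
qed

theorem laplace_limit_mixed:
  fixes a\<^sub>0 :: real
  assumes n: "n\<^sub>1 + n\<^sub>2 \<le> 0" and a0: "- \<mu>\<^sub>2 < a\<^sub>0" "a\<^sub>0 < \<mu>\<^sub>1" "sin (pi * (\<mu>\<^sub>1 / 4 - a\<^sub>0)) \<noteq> 0"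
    and dz: "(rGamma (a\<^sub>0 - s\<^sub>1 + 1) = 0 \<and> rGamma (\<mu>\<^sub>1 - s\<^sub>1 - a\<^sub>0) = 0) \<or>
      (rGamma (a\<^sub>0 + (s\<^sub>2 + \<mu>\<^sub>2)) = 0 \<and> rGamma (1 + s\<^sub>2 - a\<^sub>0) = 0)"
  obtains c :: real where "measure m\<^sub>1 {0} = 0"
    "\<And>y. Re y \<le> 0 \<Longrightarrow> ((\<lambda>y. of_real c * (sin (of_real pi * (curve_point y - of_real a\<^sub>0)) ^ 2 / denominator (curve_point y))) \<longlongrightarrow> laplace m\<^sub>1 y) (at y)"
proof -
  obtain \<kappa> where \<kappa>: "\<And>s. - \<mu>\<^sub>2 \<le> Re s \<Longrightarrow> Re s \<le> \<mu>\<^sub>1 \<Longrightarrow> glued s * reduced_denominator s = \<kappa> * sin (of_real pi * (s - of_real a\<^sub>0)) ^ 2"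
    using glued_product_sin_squared[OF a0(1,2) dz] by blast
  define u where "u s = sin (of_real pi * (s - of_real a\<^sub>0)) ^ 2" for s :: complex
  have ur: "u (of_real (\<mu>\<^sub>1 / 4)) = of_real (sin (pi * (\<mu>\<^sub>1 / 4 - a\<^sub>0)) ^ 2)"
  proof -
    have "of_real pi * (of_real (\<mu>\<^sub>1 / 4) - of_real a\<^sub>0) = complex_of_real (pi * (\<mu>\<^sub>1 / 4 - a\<^sub>0))" by simp
    then show ?thesis unfolding u_def by (simp only: sin_of_real of_real_power)
  qed
  have "((\<lambda>t::real. norm (u (of_real (\<mu>\<^sub>1 / 2) + \<i> * of_real t)) * t powr of_int (n\<^sub>1 + n\<^sub>2 - 1) * exp (- (2 * pi * t))) \<longlongrightarrow> 0) at_top"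
  proof (rule Lim_null_comparison)
    show "\<forall>\<^sub>F t in at_top. norm (norm (u (of_real (\<mu>\<^sub>1 / 2) + \<i> * of_real t)) * t powr of_int (n\<^sub>1 + n\<^sub>2 - 1) * exp (- (2 * pi * t))) \<le> 1 / t"
    proof (rule eventually_at_top_linorderI[of 1])
      fix t :: real assume t: "1 \<le> t"
      have "norm (sin (of_real pi * ((of_real (\<mu>\<^sub>1 / 2) + \<i> * of_real t) - of_real a\<^sub>0))) \<le> exp (pi * t)"
        using norm_sin_le_exp[of "of_real pi * ((of_real (\<mu>\<^sub>1 / 2) + \<i> * of_real t) - of_real a\<^sub>0)"] t by (simp add: abs_mult)
      then have "norm (u (of_real (\<mu>\<^sub>1 / 2) + \<i> * of_real t)) \<le> exp (pi * t) ^ 2"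
        unfolding u_def norm_power by (rule power_mono) auto
      also have "\<dots> = exp (2 * pi * t)" by (simp add: power2_eq_square flip: exp_add)
      finally have 1: "norm (u (of_real (\<mu>\<^sub>1 / 2) + \<i> * of_real t)) \<le> exp (2 * pi * t)" .
      have 2: "t powr of_int (n\<^sub>1 + n\<^sub>2 - 1) \<le> t powr (- 1)"
        using n t by (intro powr_mono) linarith+
      have "norm (u (of_real (\<mu>\<^sub>1 / 2) + \<i> * of_real t)) * t powr of_int (n\<^sub>1 + n\<^sub>2 - 1) * exp (- (2 * pi * t))
        \<le> exp (2 * pi * t) * t powr (- 1) * exp (- (2 * pi * t))"
        using 1 2 by (intro mult_right_mono mult_mono) auto
      also have "\<dots> = 1 / t" using t by (simp add: exp_minus powr_minus field_simps)
      finally show "norm (norm (u (of_real (\<mu>\<^sub>1 / 2) + \<i> * of_real t)) * t powr of_int (n\<^sub>1 + n\<^sub>2 - 1) * exp (- (2 * pi * t))) \<le> 1 / t"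
        by simp
    qed
    show "((\<lambda>t::real. 1 / t) \<longlongrightarrow> 0) at_top" by real_asymp
  qed
  moreover have "u holomorphic_on UNIV" unfolding u_def by (intro holomorphic_intros)
  ultimately show ?thesis
    using solution_real_limit[of u "sin (pi * (\<mu>\<^sub>1 / 4 - a\<^sub>0)) ^ 2" \<kappa>] ur \<kappa> a0(3) that by (auto simp: u_def)
qed

end

section \<open>From reciprocal Gamma functions to trigonometric formulas\<close>

lemma map_poly_of_real_mult:
  "map_poly of_real (p * q) = (map_poly of_real p * map_poly of_real q :: complex poly)"
  by (rule poly_eqI) (simp add: coeff_map_poly coeff_mult)

lemma cpoly_prod: "cpoly (prod f A) z = (\<Prod>k\<in>A. cpoly (f k) z)"
proof -
  have "map_poly of_real (prod f A) = (\<Prod>k\<in>A. map_poly of_real (f k) :: complex poly)"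
    by (induction A rule: infinite_finite_induct) (simp_all add: map_poly_of_real_mult)
  then show ?thesis by (simp add: poly_prod)
qed

lemma cpoly_linear: "cpoly [:- a, 1:] z = z - of_real a"
  by (simp add: map_poly_pCons)

lemma prod_symmetric_pairs:
  fixes a :: "nat \<Rightarrow> 'b::comm_monoid_mult"
  shows "(\<Prod>i<N. a i) = (if odd N then a (N div 2) else 1) * (\<Prod>k<N div 2. a k * a (N - 1 - k))"
proof -
  define M where "M = N div 2"
  have "(\<Prod>i<N. a i) = (\<Prod>i<M. a i) * (\<Prod>i\<in>{M..<N}. a i)"
    using prod.atLeastLessThan_concat[of 0 M N a] by (simp add: M_def atLeast0LessThan)
  also have "(\<Prod>i\<in>{M..<N}. a i) = (\<Prod>i\<in>{M..<N - M}. a i) * (\<Prod>i\<in>{N - M..<N}. a i)"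
    by (rule prod.atLeastLessThan_concat[symmetric]) (simp_all add: M_def)
  also have "(\<Prod>i\<in>{N - M..<N}. a i) = (\<Prod>k<M. a (N - 1 - k))"
    by (rule prod.reindex_bij_witness[of _ "\<lambda>k. N - 1 - k" "\<lambda>k. N - 1 - k"]) (auto simp: M_def)
  also have "(\<Prod>i\<in>{M..<N - M}. a i) = (if odd N then a M else 1)"
  proof (cases "odd N")
    case True
    then have "N - M = Suc M" unfolding M_def by presburger
    then show ?thesis using True by simp
  next
    case False
    then have "N - M = M" unfolding M_def by presburger
    then show ?thesis using False by simp
  qed
  finally show ?thesis by (simp add: M_def prod.distrib mult_ac)
qed

text \<open>The roots are the values of \<open>y\<close> at the points \<open>\<mu> / 2 \<plusminus> d\<close> where \<open>d\<close> runs through the positive elements of the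
  arithmetic progression \<open>(N - 1) / 2, (N - 3) / 2, \<dots>\<close>.\<close>

definition centred_poly :: "real \<Rightarrow> nat \<Rightarrow> real poly" where
  "centred_poly \<mu> N = (\<Prod>k<N div 2. [:- y_par \<mu> (\<mu> / 2 + ((real N - 1) / 2 - real k)), 1:])"

lemma y_par_centred: "y_par \<mu> (\<mu> / 2 + d) = 2 * d\<^sup>2 - \<mu>\<^sup>2 / 2"
  by (simp add: y_par_def power2_eq_square algebra_simps)

text \<open>The \<open>N\<close> linear factors are symmetric about \<open>w = 0\<close>: the pair with offsets \<open>\<plusminus>d\<close> gives
  \<open>w\<^sup>2 - d\<^sup>2\<close>, which is half a linear factor in \<open>y\<close>, and for odd \<open>N\<close> the middle factor is \<open>- w\<close>.\<close>

lemma pochhammer_centred: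
  fixes w :: complex
  assumes y: "y = 2 * w\<^sup>2 - of_real (\<mu>\<^sup>2 / 2)"
  shows "pochhammer (- w - (of_nat N - 1) / 2) N = (if odd N then - w else 1) * cpoly (centred_poly \<mu> N) y / 2 ^ (N div 2)"
proof -
  define a where "a i = (- w - (of_nat N - 1) / 2) + of_nat i" for i
  have "pochhammer (- w - (of_nat N - 1) / 2) N = (\<Prod>i<N. a i)"
    by (simp add: pochhammer_prod a_def atLeast0LessThan)
  also have "\<dots> = (if odd N then a (N div 2) else 1) * (\<Prod>k<N div 2. a k * a (N - 1 - k))"
    by (rule prod_symmetric_pairs)
  also have "(if odd N then a (N div 2) else 1) = (if odd N then - w else 1)"
  proof (cases "odd N")
    case True
    then obtain m where "N = 2 * m + 1" by (rule oddE)
    then show ?thesis by (simp add: a_def field_simps)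
  qed simp
  also have "(\<Prod>k<N div 2. a k * a (N - 1 - k)) = (\<Prod>k<N div 2. (y - of_real (y_par \<mu> (\<mu> / 2 + ((real N - 1) / 2 - real k)))) / 2)"
  proof (rule prod.cong)
    fix k assume "k \<in> {..<N div 2}"
    then have k: "Suc k \<le> N" by simp
    define d :: complex where "d = (of_nat N - 1) / 2 - of_nat k"
    have a1: "a k = - w - d" by (simp add: a_def d_def field_simps)
    have a2: "a (N - 1 - k) = - w + d"
      using k by (simp add: a_def d_def of_nat_diff field_simps)
    have a3: "of_real (y_par \<mu> (\<mu> / 2 + ((real N - 1) / 2 - real k))) = 2 * d\<^sup>2 - of_real (\<mu>\<^sup>2 / 2)"
      unfolding y_par_centred by (simp add: d_def)
    show "a k * a (N - 1 - k) = (y - of_real (y_par \<mu> (\<mu> / 2 + ((real N - 1) / 2 - real k)))) / 2"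
      unfolding y a1 a2 a3 by (simp add: power2_eq_square algebra_simps)
  qed simp
  also have "\<dots> = cpoly (centred_poly \<mu> N) y / 2 ^ (N div 2)"
    by (simp add: centred_poly_def cpoly_prod cpoly_linear prod_dividef)
  finally show ?thesis by simp
qed

lemma sin_half_integer_shift:
  assumes "even n"
  obtains e :: real where "e \<noteq> 0" "\<And>w :: complex. sin (of_real pi * (w + of_int n / 2)) = of_real e * sin (of_real pi * w)"
    "\<And>w :: complex. sin (of_real pi * (w + of_int (n + 1) / 2)) = of_real e * cos (of_real pi * w)"
proof -
  obtain m where m: "n = 2 * m" using assms by (rule evenE)
  define e :: real where "e = cos (pi * of_int m)"
  have eq: "complex_of_real pi * of_int m = of_real (pi * of_int m)" by simp
  have c1: "cos (complex_of_real pi * of_int m) = of_real e" unfolding e_def eq by (rule cos_of_real)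
  have c2: "sin (complex_of_real pi * of_int m) = 0"
    unfolding sin_eq_0 by (intro exI[of _ m]) (simp add: mult.commute)
  have "complex_of_real (e\<^sup>2) = 1"
    using sin_cos_squared_add[of "complex_of_real pi * of_int m"] unfolding c1 c2 by simp
  then have ez: "e \<noteq> 0" by auto
  note c = c1 c2
  have 1: "sin (of_real pi * (w + of_int n / 2)) = of_real e * sin (of_real pi * w)" for w :: complex
  proof -
    have "of_real pi * (w + of_int n / 2) = of_real pi * w + complex_of_real pi * of_int m"
      by (simp add: m algebra_simps)
    then show ?thesis by (simp add: sin_add c)
  qed
  have 2: "sin (of_real pi * (w + of_int (n + 1) / 2)) = of_real e * cos (of_real pi * w)" for w :: complex
  proof -
    have "of_real pi * (w + of_int (n + 1) / 2) = (of_real pi * w + complex_of_real pi * of_int m) + of_real pi / 2"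
      by (simp add: m algebra_simps add_divide_distrib)
    then show ?thesis by (simp add: sin_add cos_add c)
  qed
  show ?thesis by (rule that[OF ez 1 2])
qed

text \<open>If the sine vanishes then the square root is an integer, hence so is \<open>2 y + a\<close>; such \<open>y\<close> are
  isolated.\<close>

lemma eventually_sin_csqrt_nonzero:
  "eventually (\<lambda>y. sin (of_real pi * csqrt (2 * y + of_real a)) \<noteq> 0) (at y\<^sub>0)"
proof -
  define f where "f y = sin (of_real pi * (2 * y + of_real a))" for y :: complex
  have "f holomorphic_on UNIV" unfolding f_def by (intro holomorphic_intros)
  moreover have "f ((1 / 2 - of_real a) / 2) \<noteq> 0"
  proof -
    have "of_real pi * (2 * ((1 / 2 - of_real a) / 2) + of_real a) = complex_of_real (pi / 2)"
      by (simp add: field_simps)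
    then show ?thesis unfolding f_def by (simp only: sin_of_real) simp
  qed
  ultimately have "eventually (\<lambda>y. f y \<noteq> 0 \<and> y \<in> UNIV) (at y\<^sub>0)"
    by (intro non_zero_neighbour_alt) auto
  then show ?thesis
  proof eventually_elim
    case (elim y)
    show ?case
    proof
      assume "sin (of_real pi * csqrt (2 * y + of_real a)) = 0"
      then obtain n :: int where "of_real pi * csqrt (2 * y + of_real a) = complex_of_real (of_int n * pi)"
        by (auto simp: sin_eq_0)
      then have "csqrt (2 * y + of_real a) = of_int n" by (simp add: field_simps)
      then have "2 * y + of_real a = of_int n ^ 2" by (metis power2_csqrt)
      then have "f y = sin (complex_of_real (of_int (n\<^sup>2) * pi))" by (simp add: f_def mult.commute)
      also have "\<dots> = 0" unfolding sin_eq_0 by blast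
      finally show False using elim by simp
    qed
  qed
qed

lemma inverse_of_reflected_product:
  fixes S1 S2 T1 T2 p1 p2 c :: "'b::field"
  assumes "S1 / c = T1 * p1" "S2 / c = T2 * p2" "S1 \<noteq> 0" "S2 \<noteq> 0" "c \<noteq> 0"
  shows "1 / (p1 * p2) = T1 * T2 * c\<^sup>2 / (S1 * S2)"
proof -
  have "T1 \<noteq> 0" "T2 \<noteq> 0" "p1 \<noteq> 0" "p2 \<noteq> 0" using assms by auto
  moreover have "S1 = c * T1 * p1" "S2 = c * T2 * p2" using assms by (simp_all add: field_simps)
  ultimately show ?thesis using assms(5) by (simp add: power2_eq_square)
qed

text \<open>When \<open>T1\<close> vanishes both sides are \<open>0\<close> by the convention for division by zero.\<close>

lemma quotient_of_reflected_product:
  fixes u S1 S2 T1 T2 p1 p2 c :: "'b::field"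
  assumes "p1 = T1 * (S1 / c)" "S2 / c = T2 * p2" "S2 \<noteq> 0" "c \<noteq> 0"
  shows "u / (p1 * p2) = u * T2 * c\<^sup>2 / (T1 * (S1 * S2))"
proof -
  have "T2 \<noteq> 0" "p2 \<noteq> 0" using assms by auto
  moreover have "S2 = c * T2 * p2" using assms by (simp add: field_simps)
  ultimately show ?thesis using assms(4) unfolding assms(1) by (simp add: power2_eq_square)
qed

lemma tangent_quotient:
  fixes si co w A B a b c e :: "'b::field"
  assumes "si \<noteq> 0" "co \<noteq> 0" "(2::'b) \<noteq> 0"
  shows "si\<^sup>2 * (A / a) * c\<^sup>2 / (- w * B / b * (e * (si * co))) = (- 2 * c\<^sup>2 * b / (a * e)) * (A * (si / co) / (B * (2 * w)))"
  using assms by (cases "B = 0"; cases "w = 0"; cases "a = 0"; cases "b = 0"; cases "e = 0") (simp_all add: field_simps power2_eq_square)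

lemma cotangent_quotient:
  fixes si co w A B a b c e :: "'b::field"
  assumes "si \<noteq> 0" "co \<noteq> 0" "(2::'b) \<noteq> 0"
  shows "co\<^sup>2 * (- w * A / a) * c\<^sup>2 / (B / b * (e * (si * co))) = (- c\<^sup>2 * b / (2 * a * e)) * (A * (2 * w) / (B * (si / co)))"
  using assms by (cases "B = 0"; cases "w = 0"; cases "a = 0"; cases "b = 0"; cases "e = 0") (simp_all add: field_simps power2_eq_square)

context curve_equation
begin

definition root_y :: "complex \<Rightarrow> complex" where "root_y y = csqrt (2 * y + of_real (\<mu>\<^sub>1\<^sup>2))"

definition centred :: "nat \<Rightarrow> complex \<Rightarrow> complex" where "centred N y = cpoly (centred_poly \<mu>\<^sub>1 N) y"

text \<open>The polynomial by which a pair of reciprocal Gamma functions differs from a sine; every pair leads to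
  the same family, as the next lemma and \<open>pair1_pos\<close>, \<open>pair1_neg\<close>, \<open>pair2_pos\<close>, \<open>pair2_neg\<close> show.\<close>

definition linear_factors :: "nat \<Rightarrow> complex \<Rightarrow> complex" where
  "linear_factors N y = (if odd N then - (root_y y / 2) else 1) * centred N y / 2 ^ (N div 2)"

lemma linear_factors_pochhammer: "linear_factors N y = pochhammer (- (root_y y / 2) - (of_nat N - 1) / 2) N"
proof -
  have "y = 2 * (root_y y / 2)\<^sup>2 - of_real (\<mu>\<^sub>1\<^sup>2 / 2)" by (simp add: root_y_def power_divide field_simps)
  from pochhammer_centred[OF this, of N] show ?thesis by (simp add: linear_factors_def centred_def)
qed

lemma shifts:
  "curve_point y - of_real s\<^sub>1 = root_y y / 2 + of_int n\<^sub>1 / 2" "curve_point y - of_real s\<^sub>2 + of_int n\<^sub>2 = root_y y / 2 + of_int (n\<^sub>2 + 1) / 2"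
proof -
  have n: "of_int n\<^sub>1 = (of_real (\<mu>\<^sub>1 - 2 * s\<^sub>1) :: complex)" "of_int n\<^sub>2 = (of_real (\<mu>\<^sub>2 + 2 * s\<^sub>2) :: complex)"
    by (simp_all only: n1[symmetric] n2[symmetric] of_real_of_int_eq)
  have m: "of_real \<mu>\<^sub>1 = (1 - of_real \<mu>\<^sub>2 :: complex)" using mu_sum by (simp flip: of_real_add add: algebra_simps)
  show "curve_point y - of_real s\<^sub>1 = root_y y / 2 + of_int n\<^sub>1 / 2" unfolding n by (simp add: curve_point_def root_y_def field_simps)
  show "curve_point y - of_real s\<^sub>2 + of_int n\<^sub>2 = root_y y / 2 + of_int (n\<^sub>2 + 1) / 2"
    unfolding of_int_add n by (simp add: curve_point_def root_y_def m field_simps)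
qed

definition sine1 :: "complex \<Rightarrow> complex" where "sine1 y = sin (of_real pi * (root_y y / 2 + of_int n\<^sub>1 / 2))"
definition sine2 :: "complex \<Rightarrow> complex" where "sine2 y = sin (of_real pi * (root_y y / 2 + of_int (n\<^sub>2 + 1) / 2))"
definition pair1 :: "complex \<Rightarrow> complex" where "pair1 y = rGamma_pair n\<^sub>1 (root_y y / 2 + of_int n\<^sub>1 / 2)"
definition pair2 :: "complex \<Rightarrow> complex" where "pair2 y = rGamma_pair (n\<^sub>2 + 1) (root_y y / 2 + of_int (n\<^sub>2 + 1) / 2)"

lemma denominator_curve_point: "denominator (curve_point y) = pair1 y * pair2 y"
  by (simp only: denominator_def shifts pair1_def pair2_def)

lemma pair1_pos: "n\<^sub>1 \<ge> 1 \<Longrightarrow> sine1 y / of_real pi = linear_factors (nat (n\<^sub>1 - 1)) y * pair1 y"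
proof -
  assume n: "n\<^sub>1 \<ge> 1"
  have "1 - (root_y y / 2 + of_int n\<^sub>1 / 2) = - (root_y y / 2) - (of_nat (nat (n\<^sub>1 - 1)) - 1) / 2"
    using n by (simp add: of_nat_nat field_simps)
  then show ?thesis
    using rGamma_pair_pos[OF n, of "root_y y / 2 + of_int n\<^sub>1 / 2"] by (simp only: sine1_def pair1_def linear_factors_pochhammer)
qed

lemma pair1_neg: "n\<^sub>1 \<le> 0 \<Longrightarrow> pair1 y = linear_factors (nat (1 - n\<^sub>1)) y * (sine1 y / of_real pi)"
proof -
  assume n: "n\<^sub>1 \<le> 0"
  have "of_int n\<^sub>1 - (root_y y / 2 + of_int n\<^sub>1 / 2) = - (root_y y / 2) - (of_nat (nat (1 - n\<^sub>1)) - 1) / 2"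
    using n by (simp add: of_nat_nat field_simps)
  then show ?thesis
    using rGamma_pair_nonpos[OF n, of "root_y y / 2 + of_int n\<^sub>1 / 2"] by (simp only: sine1_def pair1_def linear_factors_pochhammer)
qed

lemma pair2_pos: "n\<^sub>2 \<ge> 0 \<Longrightarrow> sine2 y / of_real pi = linear_factors (nat n\<^sub>2) y * pair2 y"
proof -
  assume n: "n\<^sub>2 \<ge> 0"
  then have n': "n\<^sub>2 + 1 \<ge> 1" by simp
  have "1 - (root_y y / 2 + of_int (n\<^sub>2 + 1) / 2) = - (root_y y / 2) - (of_nat (nat n\<^sub>2) - 1) / 2"
    using n by (simp add: of_nat_nat field_simps)
  moreover have "nat (n\<^sub>2 + 1 - 1) = nat n\<^sub>2" by simp
  ultimately show ?thesis
    using rGamma_pair_pos[OF n', of "root_y y / 2 + of_int (n\<^sub>2 + 1) / 2"] by (simp only: sine2_def pair2_def linear_factors_pochhammer)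
qed

lemma pair2_neg: "n\<^sub>2 \<le> -1 \<Longrightarrow> pair2 y = linear_factors (nat (- n\<^sub>2)) y * (sine2 y / of_real pi)"
proof -
  assume n: "n\<^sub>2 \<le> -1"
  then have n': "n\<^sub>2 + 1 \<le> 0" by simp
  have "of_int (n\<^sub>2 + 1) - (root_y y / 2 + of_int (n\<^sub>2 + 1) / 2) = - (root_y y / 2) - (of_nat (nat (- n\<^sub>2)) - 1) / 2"
    using n by (simp add: of_nat_nat field_simps)
  moreover have "nat (1 - (n\<^sub>2 + 1)) = nat (- n\<^sub>2)" by simp
  ultimately show ?thesis
    using rGamma_pair_nonpos[OF n', of "root_y y / 2 + of_int (n\<^sub>2 + 1) / 2"] by (simp only: sine2_def pair2_def linear_factors_pochhammer)
qed

text \<open>For equal parities one of the two sines is a sine and the other a cosine of half the argument.\<close>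

lemma sines:
  assumes "even n\<^sub>1 \<longleftrightarrow> even n\<^sub>2"
  obtains e :: real where "e \<noteq> 0"
    "\<And>y. sine1 y * sine2 y = of_real e * (sin (of_real (pi / 2) * root_y y) * cos (of_real (pi / 2) * root_y y))"
    "\<And>y. sin (of_real (pi / 2) * root_y y) \<noteq> 0 \<Longrightarrow> cos (of_real (pi / 2) * root_y y) \<noteq> 0 \<Longrightarrow> sine1 y \<noteq> 0 \<and> sine2 y \<noteq> 0"
proof (cases "even n\<^sub>1")
  case True
  obtain a b :: real where a: "a \<noteq> 0" "\<And>w :: complex. sin (of_real pi * (w + of_int n\<^sub>1 / 2)) = of_real a * sin (of_real pi * w)"
    and b: "b \<noteq> 0" "\<And>w :: complex. sin (of_real pi * (w + of_int (n\<^sub>2 + 1) / 2)) = of_real b * cos (of_real pi * w)"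
    using sin_half_integer_shift[of n\<^sub>1] sin_half_integer_shift[of n\<^sub>2] True assms by metis
  show ?thesis by (rule that[of "a * b"]) (use a b in \<open>simp_all add: sine1_def sine2_def\<close>)
next
  case False
  obtain a b :: real where a: "a \<noteq> 0" "\<And>w :: complex. sin (of_real pi * (w + of_int (n\<^sub>1 - 1 + 1) / 2)) = of_real a * cos (of_real pi * w)"
    and b: "b \<noteq> 0" "\<And>w :: complex. sin (of_real pi * (w + of_int (n\<^sub>2 + 1) / 2)) = of_real b * sin (of_real pi * w)"
    using sin_half_integer_shift[of "n\<^sub>1 - 1"] sin_half_integer_shift[of "n\<^sub>2 + 1"] False assms by (metis even_diff even_plus_one_iff odd_one)
  show ?thesis by (rule that[of "a * b"]) (use a b in \<open>simp_all add: sine1_def sine2_def mult_ac\<close>)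
qed

lemma root_y_regular:
  "eventually (\<lambda>y. sin (of_real (pi / 2) * root_y y) \<noteq> 0 \<and> cos (of_real (pi / 2) * root_y y) \<noteq> 0) (at y\<^sub>0)"
  using eventually_sin_csqrt_nonzero[of "\<mu>\<^sub>1\<^sup>2" y\<^sub>0]
proof eventually_elim
  case (elim y)
  have "of_real pi * root_y y = 2 * (of_real (pi / 2) * root_y y)" by simp
  then have "sin (of_real pi * root_y y) = 2 * sin (of_real (pi / 2) * root_y y) * cos (of_real (pi / 2) * root_y y)" by (simp only: sin_double)
  then show ?case using elim by (auto simp: root_y_def)
qed

theorem sine_formula:
  assumes n: "n\<^sub>1 \<ge> 1" "n\<^sub>2 \<ge> 1" and par: "even n\<^sub>1 \<longleftrightarrow> even n\<^sub>2"
  obtains c :: real where "measure m\<^sub>1 {0} = 0"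
    "\<And>y. Re y \<le> 0 \<Longrightarrow> ((\<lambda>y. of_real c * (centred (nat (n\<^sub>1 - 1)) y * centred (nat n\<^sub>2) y * root_y y) / sin (of_real pi * root_y y)) \<longlongrightarrow> laplace m\<^sub>1 y) (at y)"
proof -
  obtain c where c: "measure m\<^sub>1 {0} = 0" "\<And>y. Re y \<le> 0 \<Longrightarrow> ((\<lambda>y. of_real c * (1 / denominator (curve_point y))) \<longlongrightarrow> laplace m\<^sub>1 y) (at y)"
    using laplace_limit_positive[OF n] by blast
  obtain e :: real where e: "e \<noteq> 0"
    "\<And>y. sine1 y * sine2 y = of_real e * (sin (of_real (pi / 2) * root_y y) * cos (of_real (pi / 2) * root_y y))"
    "\<And>y. sin (of_real (pi / 2) * root_y y) \<noteq> 0 \<Longrightarrow> cos (of_real (pi / 2) * root_y y) \<noteq> 0 \<Longrightarrow> sine1 y \<noteq> 0 \<and> sine2 y \<noteq> 0"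
    using sines[OF par] by blast
  define N1 where "N1 = nat (n\<^sub>1 - 1)"
  define N2 where "N2 = nat n\<^sub>2"
  have par': "odd N1 \<noteq> odd N2" using n par by (auto simp: N1_def N2_def even_nat_iff)
  define M :: real where "M = 2 ^ (N1 div 2) * 2 ^ (N2 div 2)"
  define k where "k = - (pi\<^sup>2 / (M * e))"
  have eq: "of_real c * (1 / denominator (curve_point y)) = of_real (c * k) * (centred N1 y * centred N2 y * root_y y) / sin (of_real pi * root_y y)"
    if "sin (of_real (pi / 2) * root_y y) \<noteq> 0 \<and> cos (of_real (pi / 2) * root_y y) \<noteq> 0" for y
  proof -
    have LF: "linear_factors N1 y * linear_factors N2 y = - (root_y y / 2) * (centred N1 y * centred N2 y) / of_real M"
      using par' by (auto simp: linear_factors_def M_def)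
    have "of_real pi * root_y y = 2 * (of_real (pi / 2) * root_y y)" by simp
    then have sd: "sin (of_real pi * root_y y) = 2 * sin (of_real (pi / 2) * root_y y) * cos (of_real (pi / 2) * root_y y)" by (simp only: sin_double)
    have "1 / denominator (curve_point y) = linear_factors N1 y * linear_factors N2 y * (of_real pi)\<^sup>2 / (sine1 y * sine2 y)"
      unfolding denominator_curve_point N1_def N2_def
      using e(3) that n by (intro inverse_of_reflected_product pair1_pos pair2_pos) auto
    also have "\<dots> = of_real k * (centred N1 y * centred N2 y * root_y y) / sin (of_real pi * root_y y)"
      unfolding LF e(2) sd k_def using e(1) by (simp add: M_def field_simps)
    finally show ?thesis by simp
  qed
  show ?thesis
  proof (rule that[OF c(1), of "c * k"])
    fix y :: complex assume "Re y \<le> 0"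
    from c(2)[OF this] show "((\<lambda>y. of_real (c * k) * (centred (nat (n\<^sub>1 - 1)) y * centred (nat n\<^sub>2) y * root_y y) / sin (of_real pi * root_y y)) \<longlongrightarrow> laplace m\<^sub>1 y) (at y)"
      unfolding N1_def[symmetric] N2_def[symmetric]
      by (rule Lim_transform_eventually) (rule eventually_mono[OF root_y_regular eq])
  qed
qed

lemma sin_pi_nonzero: "sin (pi * x) \<noteq> 0" if "0 < x" "x < 1" for x :: real
  using sin_gt_zero[of "pi * x"] that by simp

lemma rGamma_of_int_nonpos: "k \<le> 0 \<Longrightarrow> rGamma (real_of_int k) = 0"
  unfolding rGamma_eq_zero_iff nonpos_Ints_def by blast

text \<open>The common zero is at \<open>\<mu>\<^sub>1 / 2\<close>.\<close>

lemma mixed_limit_tan: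
  assumes sum: "n\<^sub>1 + n\<^sub>2 \<le> 0" and cs: "(even n\<^sub>1 \<and> n\<^sub>1 \<le> -1) \<or> (odd n\<^sub>2 \<and> n\<^sub>2 \<le> -1)"
  obtains c :: real where "measure m\<^sub>1 {0} = 0"
    "\<And>y. Re y \<le> 0 \<Longrightarrow> ((\<lambda>y. of_real c * (sin (of_real (pi / 2) * root_y y) ^ 2 / denominator (curve_point y))) \<longlongrightarrow> laplace m\<^sub>1 y) (at y)"
proof -
  have "sin (pi * (\<mu>\<^sub>1 / 4 - \<mu>\<^sub>1 / 2)) = - sin (pi * (\<mu>\<^sub>1 / 4))" by (simp flip: sin_minus add: algebra_simps)
  then have nz: "sin (pi * (\<mu>\<^sub>1 / 4 - \<mu>\<^sub>1 / 2)) \<noteq> 0"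
    using sin_pi_nonzero[of "\<mu>\<^sub>1 / 4"] mu_pos mu_sum by auto
  have dz: "(rGamma (\<mu>\<^sub>1 / 2 - s\<^sub>1 + 1) = 0 \<and> rGamma (\<mu>\<^sub>1 - s\<^sub>1 - \<mu>\<^sub>1 / 2) = 0) \<or>
      (rGamma (\<mu>\<^sub>1 / 2 + (s\<^sub>2 + \<mu>\<^sub>2)) = 0 \<and> rGamma (1 + s\<^sub>2 - \<mu>\<^sub>1 / 2) = 0)"
    using cs
  proof
    assume "even n\<^sub>1 \<and> n\<^sub>1 \<le> -1"
    then obtain k where k: "n\<^sub>1 = 2 * k" "k \<le> -1" by (elim conjE evenE) auto
    have "\<mu>\<^sub>1 / 2 - s\<^sub>1 + 1 = of_int (k + 1)" "\<mu>\<^sub>1 - s\<^sub>1 - \<mu>\<^sub>1 / 2 = of_int k" using n1 k by auto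
    then show ?thesis using k by (simp only: rGamma_of_int_nonpos) simp
  next
    assume "odd n\<^sub>2 \<and> n\<^sub>2 \<le> -1"
    then obtain k where k: "n\<^sub>2 = 2 * k + 1" "k \<le> -1" by (elim conjE oddE) auto
    have "\<mu>\<^sub>1 / 2 + (s\<^sub>2 + \<mu>\<^sub>2) = of_int (k + 1)" "1 + s\<^sub>2 - \<mu>\<^sub>1 / 2 = of_int (k + 1)" using n2 k mu_sum by auto
    then show ?thesis using k by (simp only: rGamma_of_int_nonpos) simp
  qed
  have e: "of_real pi * (curve_point y - of_real (\<mu>\<^sub>1 / 2)) = of_real (pi / 2) * root_y y" for y
    by (simp add: curve_point_def root_y_def field_simps)
  show ?thesis
    using laplace_limit_mixed[OF sum _ _ nz dz, unfolded e] mu_pos that by fastforce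
qed

text \<open>The common zero is at \<open>- \<mu>\<^sub>2 / 2\<close>, which is \<open>\<mu>\<^sub>1 / 2 - 1 / 2\<close>; the shift by one half turns the squared sine
  into a squared cosine.\<close>

lemma mixed_limit_cot:
  assumes sum: "n\<^sub>1 + n\<^sub>2 \<le> 0" and cs: "(odd n\<^sub>1 \<and> n\<^sub>1 \<le> -1) \<or> (even n\<^sub>2 \<and> n\<^sub>2 \<le> -1)"
  obtains c :: real where "measure m\<^sub>1 {0} = 0"
    "\<And>y. Re y \<le> 0 \<Longrightarrow> ((\<lambda>y. of_real c * (cos (of_real (pi / 2) * root_y y) ^ 2 / denominator (curve_point y))) \<longlongrightarrow> laplace m\<^sub>1 y) (at y)"
proof -
  have nz: "sin (pi * (\<mu>\<^sub>1 / 4 - (- \<mu>\<^sub>2 / 2))) \<noteq> 0"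
    using sin_pi_nonzero[of "\<mu>\<^sub>1 / 4 - (- \<mu>\<^sub>2 / 2)"] mu_pos mu_sum by auto
  have dz: "(rGamma (- \<mu>\<^sub>2 / 2 - s\<^sub>1 + 1) = 0 \<and> rGamma (\<mu>\<^sub>1 - s\<^sub>1 - (- \<mu>\<^sub>2 / 2)) = 0) \<or>
      (rGamma (- \<mu>\<^sub>2 / 2 + (s\<^sub>2 + \<mu>\<^sub>2)) = 0 \<and> rGamma (1 + s\<^sub>2 - (- \<mu>\<^sub>2 / 2)) = 0)"
    using cs
  proof
    assume "odd n\<^sub>1 \<and> n\<^sub>1 \<le> -1"
    then obtain k where k: "n\<^sub>1 = 2 * k + 1" "k \<le> -1" by (elim conjE oddE) auto
    have "- \<mu>\<^sub>2 / 2 - s\<^sub>1 + 1 = of_int (k + 1)" "\<mu>\<^sub>1 - s\<^sub>1 - (- \<mu>\<^sub>2 / 2) = of_int (k + 1)" using n1 k mu_sum by auto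
    then show ?thesis using k by (simp only: rGamma_of_int_nonpos) simp
  next
    assume "even n\<^sub>2 \<and> n\<^sub>2 \<le> -1"
    then obtain k where k: "n\<^sub>2 = 2 * k" "k \<le> -1" by (elim conjE evenE) auto
    have "- \<mu>\<^sub>2 / 2 + (s\<^sub>2 + \<mu>\<^sub>2) = of_int k" "1 + s\<^sub>2 - (- \<mu>\<^sub>2 / 2) = of_int (k + 1)" using n2 k by auto
    then show ?thesis using k by (simp only: rGamma_of_int_nonpos) simp
  qed
  have m: "of_real \<mu>\<^sub>1 = (1 - of_real \<mu>\<^sub>2 :: complex)" using mu_sum by (simp flip: of_real_add add: algebra_simps)
  have e: "sin (of_real pi * (curve_point y - of_real (- \<mu>\<^sub>2 / 2))) = cos (of_real (pi / 2) * root_y y)" for y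
  proof -
    have "of_real pi * (curve_point y - of_real (- \<mu>\<^sub>2 / 2)) = of_real (pi / 2) * root_y y + of_real pi / 2"
      by (simp add: curve_point_def root_y_def m field_simps)
    then show ?thesis by (simp add: sin_add)
  qed
  show ?thesis
    using laplace_limit_mixed[OF sum _ _ nz dz, unfolded e] mu_pos that by fastforce
qed

text \<open>The negative one of \<open>n\<^sub>1\<close>, \<open>n\<^sub>2\<close> contributes the denominator \<open>D\<close>, the positive one the numerator \<open>N\<close>.
  The odd one of \<open>N\<close> and \<open>D\<close> brings in the square root.\<close>

theorem tangent_formula:
  assumes sum: "n\<^sub>1 + n\<^sub>2 \<le> 0" and par: "even n\<^sub>1 \<longleftrightarrow> even n\<^sub>2"
    and cs: "(even n\<^sub>1 \<and> n\<^sub>1 \<le> -1 \<and> n\<^sub>2 \<ge> 1 \<and> N = nat n\<^sub>2 \<and> D = nat (1 - n\<^sub>1)) \<or>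
      (odd n\<^sub>2 \<and> n\<^sub>2 \<le> -1 \<and> n\<^sub>1 \<ge> 1 \<and> N = nat (n\<^sub>1 - 1) \<and> D = nat (- n\<^sub>2))"
  obtains c :: real where "measure m\<^sub>1 {0} = 0"
    "\<And>y. Re y \<le> 0 \<Longrightarrow> ((\<lambda>y. of_real c * (centred N y * tan (of_real (pi / 2) * root_y y)) / (centred D y * root_y y)) \<longlongrightarrow> laplace m\<^sub>1 y) (at y)"
proof -
  obtain c where c: "measure m\<^sub>1 {0} = 0"
    "\<And>y. Re y \<le> 0 \<Longrightarrow> ((\<lambda>y. of_real c * (sin (of_real (pi / 2) * root_y y) ^ 2 / denominator (curve_point y))) \<longlongrightarrow> laplace m\<^sub>1 y) (at y)"
    using mixed_limit_tan[OF sum] cs by blast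
  obtain e :: real where e: "e \<noteq> 0"
    "\<And>y. sine1 y * sine2 y = of_real e * (sin (of_real (pi / 2) * root_y y) * cos (of_real (pi / 2) * root_y y))"
    "\<And>y. sin (of_real (pi / 2) * root_y y) \<noteq> 0 \<Longrightarrow> cos (of_real (pi / 2) * root_y y) \<noteq> 0 \<Longrightarrow> sine1 y \<noteq> 0 \<and> sine2 y \<noteq> 0"
    using sines[OF par] by blast
  have par': "even N" "odd D" using par cs by (auto simp: even_nat_iff)
  define k where "k = - 2 * pi\<^sup>2 * 2 ^ (D div 2) / (2 ^ (N div 2) * e)"
  have eq: "of_real c * (sin (of_real (pi / 2) * root_y y) ^ 2 / denominator (curve_point y)) = of_real (c * k) * (centred N y * tan (of_real (pi / 2) * root_y y)) / (centred D y * root_y y)"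
    if y: "sin (of_real (pi / 2) * root_y y) \<noteq> 0 \<and> cos (of_real (pi / 2) * root_y y) \<noteq> 0" for y
  proof -
    have LF: "linear_factors N y = centred N y / 2 ^ (N div 2)" "linear_factors D y = - (root_y y / 2) * centred D y / 2 ^ (D div 2)"
      using par' by (simp_all add: linear_factors_def)
    have "sin (of_real (pi / 2) * root_y y) ^ 2 / denominator (curve_point y) = sin (of_real (pi / 2) * root_y y) ^ 2 * linear_factors N y * (of_real pi)\<^sup>2 / (linear_factors D y * (sine1 y * sine2 y))"
      using cs
    proof
      assume a: "even n\<^sub>1 \<and> n\<^sub>1 \<le> -1 \<and> n\<^sub>2 \<ge> 1 \<and> N = nat n\<^sub>2 \<and> D = nat (1 - n\<^sub>1)"
      then show ?thesis unfolding denominator_curve_point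
        using pair1_neg[of y] pair2_pos[of y] e(3)[of y] y by (intro quotient_of_reflected_product) auto
    next
      assume a: "odd n\<^sub>2 \<and> n\<^sub>2 \<le> -1 \<and> n\<^sub>1 \<ge> 1 \<and> N = nat (n\<^sub>1 - 1) \<and> D = nat (- n\<^sub>2)"
      then show ?thesis unfolding denominator_curve_point mult.commute[of "pair1 y"] mult.commute[of "sine1 y"]
        using pair2_neg[of y] pair1_pos[of y] e(3)[of y] y by (intro quotient_of_reflected_product) auto
    qed
    also have "\<dots> = of_real k * (centred N y * (sin (of_real (pi / 2) * root_y y) / cos (of_real (pi / 2) * root_y y)) / (centred D y * (2 * (root_y y / 2))))"
      unfolding LF e(2) using tangent_quotient[of "sin (of_real (pi / 2) * root_y y)" "cos (of_real (pi / 2) * root_y y)" "centred N y" "2 ^ (N div 2)" "of_real pi" "root_y y / 2" "centred D y" "2 ^ (D div 2)" "of_real e"] y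
      by (simp add: k_def)
    finally show ?thesis by (simp add: tan_def)
  qed
  show ?thesis
  proof (rule that[OF c(1), of "c * k"])
    fix y :: complex assume "Re y \<le> 0"
    from c(2)[OF this] show "((\<lambda>y. of_real (c * k) * (centred N y * tan (of_real (pi / 2) * root_y y)) / (centred D y * root_y y)) \<longlongrightarrow> laplace m\<^sub>1 y) (at y)"
      by (rule Lim_transform_eventually) (rule eventually_mono[OF root_y_regular eq])
  qed
qed

theorem cotangent_formula:
  assumes sum: "n\<^sub>1 + n\<^sub>2 \<le> 0" and par: "even n\<^sub>1 \<longleftrightarrow> even n\<^sub>2"
    and cs: "(odd n\<^sub>1 \<and> n\<^sub>1 \<le> -1 \<and> n\<^sub>2 \<ge> 1 \<and> N = nat n\<^sub>2 \<and> D = nat (1 - n\<^sub>1)) \<or>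
      (even n\<^sub>2 \<and> n\<^sub>2 \<le> -1 \<and> n\<^sub>1 \<ge> 1 \<and> N = nat (n\<^sub>1 - 1) \<and> D = nat (- n\<^sub>2))"
  obtains c :: real where "measure m\<^sub>1 {0} = 0"
    "\<And>y. Re y \<le> 0 \<Longrightarrow> ((\<lambda>y. of_real c * (centred N y * root_y y) / (centred D y * tan (of_real (pi / 2) * root_y y))) \<longlongrightarrow> laplace m\<^sub>1 y) (at y)"
proof -
  obtain c where c: "measure m\<^sub>1 {0} = 0"
    "\<And>y. Re y \<le> 0 \<Longrightarrow> ((\<lambda>y. of_real c * (cos (of_real (pi / 2) * root_y y) ^ 2 / denominator (curve_point y))) \<longlongrightarrow> laplace m\<^sub>1 y) (at y)"
    using mixed_limit_cot[OF sum] cs by blast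
  obtain e :: real where e: "e \<noteq> 0"
    "\<And>y. sine1 y * sine2 y = of_real e * (sin (of_real (pi / 2) * root_y y) * cos (of_real (pi / 2) * root_y y))"
    "\<And>y. sin (of_real (pi / 2) * root_y y) \<noteq> 0 \<Longrightarrow> cos (of_real (pi / 2) * root_y y) \<noteq> 0 \<Longrightarrow> sine1 y \<noteq> 0 \<and> sine2 y \<noteq> 0"
    using sines[OF par] by blast
  have par': "odd N" "even D" using par cs by (auto simp: even_nat_iff)
  define k where "k = - (pi\<^sup>2) * 2 ^ (D div 2) / (2 * 2 ^ (N div 2) * e)"
  have eq: "of_real c * (cos (of_real (pi / 2) * root_y y) ^ 2 / denominator (curve_point y)) = of_real (c * k) * (centred N y * root_y y) / (centred D y * tan (of_real (pi / 2) * root_y y))"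
    if y: "sin (of_real (pi / 2) * root_y y) \<noteq> 0 \<and> cos (of_real (pi / 2) * root_y y) \<noteq> 0" for y
  proof -
    have LF: "linear_factors N y = - (root_y y / 2) * centred N y / 2 ^ (N div 2)" "linear_factors D y = centred D y / 2 ^ (D div 2)"
      using par' by (simp_all add: linear_factors_def)
    have "cos (of_real (pi / 2) * root_y y) ^ 2 / denominator (curve_point y) = cos (of_real (pi / 2) * root_y y) ^ 2 * linear_factors N y * (of_real pi)\<^sup>2 / (linear_factors D y * (sine1 y * sine2 y))"
      using cs
    proof
      assume a: "odd n\<^sub>1 \<and> n\<^sub>1 \<le> -1 \<and> n\<^sub>2 \<ge> 1 \<and> N = nat n\<^sub>2 \<and> D = nat (1 - n\<^sub>1)"
      then show ?thesis unfolding denominator_curve_point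
        using pair1_neg[of y] pair2_pos[of y] e(3)[of y] y by (intro quotient_of_reflected_product) auto
    next
      assume a: "even n\<^sub>2 \<and> n\<^sub>2 \<le> -1 \<and> n\<^sub>1 \<ge> 1 \<and> N = nat (n\<^sub>1 - 1) \<and> D = nat (- n\<^sub>2)"
      then show ?thesis unfolding denominator_curve_point mult.commute[of "pair1 y"] mult.commute[of "sine1 y"]
        using pair2_neg[of y] pair1_pos[of y] e(3)[of y] y by (intro quotient_of_reflected_product) auto
    qed
    also have "\<dots> = of_real k * (centred N y * (2 * (root_y y / 2)) / (centred D y * (sin (of_real (pi / 2) * root_y y) / cos (of_real (pi / 2) * root_y y))))"
      unfolding LF e(2) using cotangent_quotient[of "sin (of_real (pi / 2) * root_y y)" "cos (of_real (pi / 2) * root_y y)" "root_y y / 2" "centred N y" "2 ^ (N div 2)" "of_real pi" "centred D y" "2 ^ (D div 2)" "of_real e"] y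
      by (simp add: k_def)
    finally show ?thesis by (simp add: tan_def)
  qed
  show ?thesis
  proof (rule that[OF c(1), of "c * k"])
    fix y :: complex assume "Re y \<le> 0"
    from c(2)[OF this] show "((\<lambda>y. of_real (c * k) * (centred N y * root_y y) / (centred D y * tan (of_real (pi / 2) * root_y y))) \<longlongrightarrow> laplace m\<^sub>1 y) (at y)"
      by (rule Lim_transform_eventually) (rule eventually_mono[OF root_y_regular eq])
  qed
qed

end

section \<open>Stieltjes integrals along a path\<close>

definition grid :: "nat \<Rightarrow> nat \<Rightarrow> real" where "grid n k = 2 * real k / real (Suc n)"

text \<open>The index \<open>k\<close> with \<open>t \<in> (grid n k, grid n (k + 1)]\<close>.\<close>

definition cell :: "nat \<Rightarrow> real \<Rightarrow> nat" where "cell n t = nat \<lceil>t * real (Suc n) / 2\<rceil> - 1"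

lemma grid_mono: "j \<le> k \<Longrightarrow> grid n j \<le> grid n k"
  by (simp add: grid_def divide_right_mono)

lemma grid_nonneg: "0 \<le> grid n k"
  by (simp add: grid_def)

lemma grid_0: "grid n 0 = 0"
  by (simp add: grid_def)

lemma grid_end: "grid n (Suc n) = 2"
  by (simp add: grid_def del: of_nat_Suc)

lemma grid_Suc: "grid n (Suc k) = grid n k + 2 / real (Suc n)"
  by (simp add: grid_def flip: add_divide_distrib)

lemma cell:
  assumes "0 < t" "t \<le> 2"
  shows "cell n t < Suc n" "grid n (cell n t) < t" "t \<le> grid n (Suc (cell n t))"
proof -
  define m where "m = \<lceil>t * real (Suc n) / 2\<rceil>"
  have 1: "m \<ge> 1" using assms by (simp add: m_def)
  have "t * real (Suc n) / 2 \<le> real (Suc n)" using assms mult_right_mono[of t 2 "real (Suc n)"] by simp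
  then have 2: "m \<le> int (Suc n)" by (simp add: m_def ceiling_le_iff)
  have c: "int (cell n t) = m - 1" using 1 unfolding cell_def m_def[symmetric] by linarith
  then show "cell n t < Suc n" using 2 by linarith
  have 3: "real_of_int m - 1 < t * real (Suc n) / 2" "t * real (Suc n) / 2 \<le> real_of_int m" by (simp_all add: m_def, linarith)
  have "real (cell n t) = real_of_int m - 1" using c by (metis of_int_1 of_int_diff of_int_of_nat_eq)
  then have "real (cell n t) < t * real (Suc n) / 2" "t * real (Suc n) / 2 \<le> real (Suc (cell n t))"
    using 3 by simp_all
  then show "grid n (cell n t) < t" "t \<le> grid n (Suc (cell n t))"
    by (simp_all add: grid_def field_simps)
qed

lemma cell_unique:
  assumes "0 < t" "t \<le> 2" "t \<in> {grid n k<..grid n (Suc k)}"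
  shows "k = cell n t"
proof (rule ccontr)
  assume "k \<noteq> cell n t"
  then consider "Suc k \<le> cell n t" | "Suc (cell n t) \<le> k" by linarith
  then show False using cell[OF assms(1,2), of n] grid_mono[of "Suc k" "cell n t" n] grid_mono[of "Suc (cell n t)" k n] assms(3)
    by cases auto
qed

lemma grid_cell_tendsto:
  assumes "0 < t" "t \<le> 2"
  shows "(\<lambda>n. grid n (Suc (cell n t))) \<longlonglongrightarrow> t" "(\<lambda>n. grid n (cell n t)) \<longlonglongrightarrow> t"
proof -
  have d: "(\<lambda>n. 2 / real (Suc n)) \<longlonglongrightarrow> 0" by real_asymp
  have b: "t \<le> grid n (Suc (cell n t))" "grid n (Suc (cell n t)) \<le> t + 2 / real (Suc n)"
    "t - 2 / real (Suc n) \<le> grid n (cell n t)" "grid n (cell n t) \<le> t" for n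
    using cell[OF assms, of n] grid_Suc[of n "cell n t"] by linarith+
  have up: "(\<lambda>n. t + 2 / real (Suc n)) \<longlonglongrightarrow> t" using tendsto_add[OF tendsto_const d, of t] by simp
  have lo: "(\<lambda>n. t - 2 / real (Suc n)) \<longlonglongrightarrow> t" using tendsto_diff[OF tendsto_const d, of t] by simp
  show "(\<lambda>n. grid n (Suc (cell n t))) \<longlonglongrightarrow> t"
    by (rule tendsto_sandwich[OF _ _ tendsto_const up]; rule always_eventually; intro allI b)
  show "(\<lambda>n. grid n (cell n t)) \<longlonglongrightarrow> t"
    by (rule tendsto_sandwich[OF _ _ lo tendsto_const]; rule always_eventually; intro allI b)
qed

lemma continuous_on_grid_tendsto:
  fixes X :: "real \<Rightarrow> 'b::topological_space"
  assumes "continuous_on {0..} X" "0 < t" "t \<le> 2"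
  shows "(\<lambda>n. X (grid n (Suc (cell n t)))) \<longlonglongrightarrow> X t" "(\<lambda>n. X (grid n (cell n t))) \<longlonglongrightarrow> X t"
  using grid_cell_tendsto[OF assms(2,3)] assms
  by (auto intro!: continuous_on_tendsto_compose[of "{0..}" X] simp: grid_nonneg)

text \<open>The measure \<open>dl\<close> restricted to the time interval over which the lateral measures are accumulated.\<close>

definition clock :: "(real \<Rightarrow> real) \<Rightarrow> real measure" where
  "clock l = density (stieltjes l) (indicator {0..2})"

definition regular_path :: "(real \<Rightarrow> real) \<Rightarrow> bool" where
  "regular_path l \<longleftrightarrow> continuous_on {0..} l \<and> mono_on {0..} l \<and> l 0 = 0"

lemma sets_stieltjes [simp, measurable_cong]: "sets (stieltjes l) = sets borel"
  by (simp add: stieltjes_def)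

lemma sets_clock [simp, measurable_cong]: "sets (clock l) = sets borel"
  by (simp add: clock_def)

lemma space_clock [simp]: "space (clock l) = UNIV"
  by (simp add: clock_def stieltjes_def)

lemma regular_path_mono: "regular_path l \<Longrightarrow> 0 \<le> a \<Longrightarrow> a \<le> b \<Longrightarrow> l a \<le> l b"
  by (auto simp: regular_path_def mono_on_def)

lemma regular_path_extended:
  assumes "regular_path l"
  shows "continuous_on UNIV (\<lambda>t. l (max 0 t))" "x \<le> y \<Longrightarrow> l (max 0 x) \<le> l (max 0 y)"
proof -
  have c: "continuous_on {0..} l" using assms by (simp add: regular_path_def)
  show "continuous_on UNIV (\<lambda>t. l (max 0 t))"
    by (rule continuous_on_compose2[OF c]) (auto intro!: continuous_intros)
  show "x \<le> y \<Longrightarrow> l (max 0 x) \<le> l (max 0 y)"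
    by (rule regular_path_mono[OF assms]) auto
qed

lemma emeasure_stieltjes_Ioc:
  assumes "regular_path l" "0 \<le> a" "a \<le> b"
  shows "emeasure (stieltjes l) {a<..b} = l b - l a"
  unfolding stieltjes_def
  by (subst emeasure_interval_measure_Ioc)
     (use assms regular_path_extended[OF assms(1)] in \<open>auto simp: continuous_on_eq_continuous_within intro: continuous_within_subset\<close>)

lemma emeasure_stieltjes_Icc:
  assumes "regular_path l" "0 \<le> a" "a \<le> b"
  shows "emeasure (stieltjes l) {a..b} = l b - l a"
  unfolding stieltjes_def
  by (subst emeasure_interval_measure_Icc) (use assms regular_path_extended[OF assms(1)] in auto)

lemma emeasure_clock:
  assumes "A \<in> sets borel"
  shows "emeasure (clock l) A = emeasure (stieltjes l) (A \<inter> {0..2})"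
proof -
  have "emeasure (clock l) A = (\<integral>\<^sup>+t. indicator (A \<inter> {0..2}) t \<partial>stieltjes l)"
  proof -
    have "emeasure (clock l) A = (\<integral>\<^sup>+t\<in>A. indicator {0..2} t \<partial>stieltjes l)"
      unfolding clock_def using assms by (intro emeasure_density) auto
    also have "\<dots> = (\<integral>\<^sup>+t. indicator (A \<inter> {0..2}) t \<partial>stieltjes l)"
      by (intro nn_integral_cong) (auto split: split_indicator)
    finally show ?thesis .
  qed
  also have "\<dots> = emeasure (stieltjes l) (A \<inter> {0..2})" using assms by (intro nn_integral_indicator) auto
  finally show ?thesis .
qed

lemma emeasure_clock_UNIV: "regular_path l \<Longrightarrow> emeasure (clock l) UNIV = l 2"
  by (simp add: emeasure_clock emeasure_stieltjes_Icc) (simp add: regular_path_def)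

lemma finite_measure_clock: "regular_path l \<Longrightarrow> finite_measure (clock l)"
  by (rule finite_measureI) (simp add: emeasure_clock_UNIV)

lemma measure_clock_Ioc:
  assumes "regular_path l" "0 \<le> a" "a \<le> b" "b \<le> 2"
  shows "measure (clock l) {a<..b} = l b - l a"
proof -
  have "{a<..b} \<inter> {0..2} = {a<..b}" using assms by auto
  then have "emeasure (clock l) {a<..b} = ennreal (l b - l a)"
    using emeasure_clock[of "{a<..b}" l] emeasure_stieltjes_Ioc[OF assms(1-3)] by auto
  then show ?thesis
    using regular_path_mono[OF assms(1-3)] unfolding measure_def by simp
qed

lemma AE_clock:
  assumes "regular_path l"
  shows "AE t in clock l. 0 < t \<and> t \<le> 2"
proof (rule AE_I)
  show "{t \<in> space (clock l). \<not> (0 < t \<and> t \<le> 2)} \<subseteq> {..0} \<union> {2<..}" by auto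
  have *: "({..0} \<union> {2<..}) \<inter> {0..2} = {0::real..0}" by auto
  have "({..0} \<union> {2<..} :: real set) \<in> sets borel" by simp
  from emeasure_clock[OF this, of l] show "emeasure (clock l) ({..0} \<union> {2<..}) = 0"
    unfolding * using emeasure_stieltjes_Icc[OF assms, of 0 0] by simp
qed simp

lemma AE_clock_of_stieltjes:
  assumes "regular_path l" "AE t in stieltjes l. P t"
  shows "AE t in clock l. P t"
  using assms(2) unfolding clock_def by (subst AE_density) auto

lemma step_sum_cell:
  fixes c :: "nat \<Rightarrow> complex"
  assumes "0 < t" "t \<le> 2"
  shows "(\<Sum>k<Suc n. indicat_real {grid n k<..grid n (Suc k)} t *\<^sub>R c k) = c (cell n t)"
proof -
  have "(\<Sum>k<Suc n. indicat_real {grid n k<..grid n (Suc k)} t *\<^sub>R c k) = (\<Sum>k<Suc n. if k = cell n t then c k else 0)"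
  proof (rule sum.cong)
    fix k
    have "t \<in> {grid n k<..grid n (Suc k)} \<longleftrightarrow> k = cell n t"
      using cell_unique[OF assms, of n k] cell(2,3)[OF assms, of n] by auto
    then show "indicat_real {grid n k<..grid n (Suc k)} t *\<^sub>R c k = (if k = cell n t then c k else 0)"
      by (simp only: indicator_def) simp
  qed simp
  then show ?thesis using cell(1)[OF assms, of n] by simp
qed

text \<open>The coefficients may depend on both endpoints of a cell, as is needed for exponential increments.\<close>

lemma riemann_sums_tendsto:
  fixes c :: "nat \<Rightarrow> nat \<Rightarrow> complex"
  assumes l: "regular_path l"
    and bd: "\<And>n k. k < Suc n \<Longrightarrow> norm (c n k) \<le> C"
    and g: "g \<in> borel_measurable borel"
    and lim: "\<And>t. 0 < t \<Longrightarrow> t \<le> 2 \<Longrightarrow> (\<lambda>n. c n (cell n t)) \<longlonglongrightarrow> g t"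
  shows "(\<lambda>n. \<Sum>k<Suc n. c n k * of_real (l (grid n (Suc k)) - l (grid n k))) \<longlonglongrightarrow> (\<integral>t. g t \<partial>clock l)"
proof -
  interpret finite_measure "clock l" by (rule finite_measure_clock[OF l])
  define f where "f n t = (\<Sum>k<Suc n. indicat_real {grid n k<..grid n (Suc k)} t *\<^sub>R c n k)" for n t
  have fc: "f n t = c n (cell n t)" if "0 < t" "t \<le> 2" for n t
    unfolding f_def by (rule step_sum_cell[OF that])
  have "(\<lambda>n. \<integral>t. f n t \<partial>clock l) \<longlonglongrightarrow> (\<integral>t. g t \<partial>clock l)"
  proof (rule integral_dominated_convergence[where w="\<lambda>_. C"])
    show "f n \<in> borel_measurable (clock l)" for n unfolding f_def by measurable
    show "AE t in clock l. (\<lambda>n. f n t) \<longlonglongrightarrow> g t"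
      using AE_clock[OF l]
      by eventually_elim (use lim in \<open>simp add: fc\<close>)
    show "AE t in clock l. norm (f n t) \<le> C" for n
      using AE_clock[OF l]
      by eventually_elim (use bd cell(1) in \<open>simp add: fc\<close>)
  qed (use g in auto)
  moreover have "(\<integral>t. f n t \<partial>clock l) = (\<Sum>k<Suc n. c n k * of_real (l (grid n (Suc k)) - l (grid n k)))" for n
  proof -
    have "(\<integral>t. f n t \<partial>clock l) = (\<Sum>k<Suc n. \<integral>t. indicat_real {grid n k<..grid n (Suc k)} t *\<^sub>R c n k \<partial>clock l)"
      unfolding f_def
    proof (rule Bochner_Integration.integral_sum)
      show "integrable (clock l) (\<lambda>t. indicat_real {grid n k<..grid n (Suc k)} t *\<^sub>R c n k)" for k
        by (rule integrable_const_bound[where B="norm (c n k)"]) (auto split: split_indicator)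
    qed
    also have "\<dots> = (\<Sum>k<Suc n. c n k * of_real (l (grid n (Suc k)) - l (grid n k)))"
    proof (rule sum.cong)
      fix k assume k: "k \<in> {..<Suc n}"
      have "measure (clock l) {grid n k<..grid n (Suc k)} = l (grid n (Suc k)) - l (grid n k)"
        using k grid_mono[of "Suc k" "Suc n" n] grid_mono[of k "Suc k" n] grid_end[of n]
        by (intro measure_clock_Ioc l grid_nonneg) auto
      then show "(\<integral>t. indicat_real {grid n k<..grid n (Suc k)} t *\<^sub>R c n k \<partial>clock l) = c n k * of_real (l (grid n (Suc k)) - l (grid n k))"
        by (simp add: scaleR_conv_of_real mult.commute)
    qed simp
    finally show ?thesis .
  qed
  ultimately show ?thesis by simp
qed

lemma sum_path_increments:
  "(\<Sum>k<Suc n. l (grid n (Suc k)) - l (grid n k)) = l 2 - l 0" for l :: "real \<Rightarrow> real"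
  using sum_lessThan_telescope[of "\<lambda>k. l (grid n k)" "Suc n"] by (simp only: grid_end grid_0)

section \<open>Mixtures and occupation measures\<close>

locale finite_kernel = prob_space M for M :: "'a measure" +
  fixes K :: "'a \<Rightarrow> real measure"
  assumes sets_K [simp]: "\<And>\<omega>. sets (K \<omega>) = sets borel"
    and finite_K: "\<And>\<omega>. finite_measure (K \<omega>)"
    and measurable_K [measurable]: "\<And>A. A \<in> sets borel \<Longrightarrow> (\<lambda>\<omega>. emeasure (K \<omega>) A) \<in> borel_measurable M"
    and mass_K: "(\<integral>\<^sup>+\<omega>. emeasure (K \<omega>) UNIV \<partial>M) < \<infinity>"
begin

lemma measurable_K_cong [measurable_cong]: "sets (K \<omega>) = sets borel" by simp

lemma space_K [simp]: "space (K \<omega>) = UNIV"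
  using sets_eq_imp_space_eq[OF sets_K[of \<omega>]] by simp

definition mixture :: "real measure" where
  "mixture = measure_of UNIV (sets borel) (\<lambda>A. \<integral>\<^sup>+\<omega>. emeasure (K \<omega>) A \<partial>M)"

lemma sets_mixture [simp, measurable_cong]: "sets mixture = sets borel"
  unfolding mixture_def using sets.sigma_sets_eq[of "borel :: real measure"] by simp

lemma space_mixture [simp]: "space mixture = UNIV"
  unfolding mixture_def by simp

lemma emeasure_mixture:
  assumes "A \<in> sets borel"
  shows "emeasure mixture A = (\<integral>\<^sup>+\<omega>. emeasure (K \<omega>) A \<partial>M)"
proof (rule emeasure_measure_of[OF mixture_def])
  show "positive (sets mixture) (\<lambda>A. \<integral>\<^sup>+\<omega>. emeasure (K \<omega>) A \<partial>M)" by (simp add: positive_def)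
  show "countably_additive (sets mixture) (\<lambda>A. \<integral>\<^sup>+\<omega>. emeasure (K \<omega>) A \<partial>M)"
  proof (rule countably_additiveI)
    fix A :: "nat \<Rightarrow> real set" assume A: "range A \<subseteq> sets mixture" "disjoint_family A" "\<Union> (range A) \<in> sets mixture"
    then have Ab: "A i \<in> sets borel" for i by auto
    have "(\<Sum>i. \<integral>\<^sup>+\<omega>. emeasure (K \<omega>) (A i) \<partial>M) = (\<integral>\<^sup>+\<omega>. (\<Sum>i. emeasure (K \<omega>) (A i)) \<partial>M)"
      by (rule nn_integral_suminf[symmetric]) (use Ab in measurable)
    also have "\<dots> = (\<integral>\<^sup>+\<omega>. emeasure (K \<omega>) (\<Union> (range A)) \<partial>M)"
      by (intro nn_integral_cong suminf_emeasure) (use A in auto)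
    finally show "(\<Sum>i. \<integral>\<^sup>+\<omega>. emeasure (K \<omega>) (A i) \<partial>M) = (\<integral>\<^sup>+\<omega>. emeasure (K \<omega>) (\<Union> (range A)) \<partial>M)" .
  qed
qed (use assms in auto)

lemma finite_mixture: "finite_measure mixture"
  by (rule finite_measureI) (use mass_K in \<open>simp add: emeasure_mixture less_top[symmetric]\<close>)

text \<open>Measurability and the formula are proved together because each step of the induction over simple
  functions uses both.\<close>

lemma nn_integral_mixture:
  fixes f :: "real \<Rightarrow> ennreal"
  assumes "f \<in> borel_measurable borel"
  shows "(\<lambda>\<omega>. \<integral>\<^sup>+x. f x \<partial>K \<omega>) \<in> borel_measurable M \<and> (\<integral>\<^sup>+x. f x \<partial>mixture) = (\<integral>\<^sup>+\<omega>. \<integral>\<^sup>+x. f x \<partial>K \<omega> \<partial>M)"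
  using assms
proof (induction rule: borel_measurable_induct)
  case (cong f g)
  then have "f = g" by auto
  then show ?case using cong by simp
next
  case (set A)
  then show ?case by (simp add: emeasure_mixture)
next
  case (mult u c)
  then have "(\<lambda>\<omega>. \<integral>\<^sup>+x. u x \<partial>K \<omega>) \<in> borel_measurable M" by blast
  then have "(\<lambda>\<omega>. c * (\<integral>\<^sup>+x. u x \<partial>K \<omega>)) \<in> borel_measurable M" by measurable
  then show ?case using mult by (simp add: nn_integral_cmult)
next
  case (add u v)
  then have "(\<lambda>\<omega>. \<integral>\<^sup>+x. u x \<partial>K \<omega>) \<in> borel_measurable M" "(\<lambda>\<omega>. \<integral>\<^sup>+x. v x \<partial>K \<omega>) \<in> borel_measurable M" by blast+
  then have "(\<lambda>\<omega>. (\<integral>\<^sup>+x. v x \<partial>K \<omega>) + (\<integral>\<^sup>+x. u x \<partial>K \<omega>)) \<in> borel_measurable M" by measurable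
  then show ?case using add by (simp add: nn_integral_add)
next
  case (seq U)
  have m: "U i \<in> borel_measurable (K \<omega>)" "U i \<in> borel_measurable mixture" for i \<omega> using seq by simp_all
  have S: "(\<integral>\<^sup>+x. Sup (range U) x \<partial>K \<omega>) = (SUP i. \<integral>\<^sup>+x. U i x \<partial>K \<omega>)" for \<omega>
    using nn_integral_monotone_convergence_SUP[OF seq(3) m(1)] by (simp add: SUP_apply image_comp)
  have inc: "incseq (\<lambda>i \<omega>. \<integral>\<^sup>+x. U i x \<partial>K \<omega>)"
    using seq(3) by (auto simp: incseq_def le_fun_def intro!: nn_integral_mono)
  have "(\<integral>\<^sup>+x. Sup (range U) x \<partial>mixture) = (SUP i. \<integral>\<^sup>+x. U i x \<partial>mixture)"
    using nn_integral_monotone_convergence_SUP[OF seq(3) m(2)] by (simp add: SUP_apply image_comp)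
  also have "\<dots> = (SUP i. \<integral>\<^sup>+\<omega>. \<integral>\<^sup>+x. U i x \<partial>K \<omega> \<partial>M)" using seq by simp
  also have "\<dots> = (\<integral>\<^sup>+\<omega>. (SUP i. \<integral>\<^sup>+x. U i x \<partial>K \<omega>) \<partial>M)"
    using seq by (intro nn_integral_monotone_convergence_SUP[symmetric] inc) auto
  finally have *: "(\<integral>\<^sup>+x. Sup (range U) x \<partial>mixture) = (\<integral>\<^sup>+\<omega>. (SUP i. \<integral>\<^sup>+x. U i x \<partial>K \<omega>) \<partial>M)" .
  have "(\<lambda>\<omega>. SUP i. \<integral>\<^sup>+x. U i x \<partial>K \<omega>) \<in> borel_measurable M"
    by (rule borel_measurable_SUP) (use seq in auto)
  then show ?case unfolding seq(4) S using * by blast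
qed

lemma integral_mixture_nonneg:
  fixes f :: "real \<Rightarrow> real"
  assumes f: "f \<in> borel_measurable borel" and b: "\<And>x. 0 \<le> f x" "\<And>x. f x \<le> B"
  shows "integrable M (\<lambda>\<omega>. \<integral>x. f x \<partial>K \<omega>)" "(\<integral>x. f x \<partial>mixture) = (\<integral>\<omega>. \<integral>x. f x \<partial>K \<omega> \<partial>M)"
proof -
  have B: "B \<ge> 0" using b[of 0] by linarith
  have intK: "integrable (K \<omega>) f" for \<omega>
    using finite_measure.integrable_const_bound[OF finite_K, of f B] f b by (simp add: AE_I2)
  have eqK: "(\<integral>\<^sup>+x. ennreal (f x) \<partial>K \<omega>) = ennreal (\<integral>x. f x \<partial>K \<omega>)" for \<omega>
    using nn_integral_eq_integral[OF intK] b by simp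
  have nn: "(\<lambda>\<omega>. ennreal (\<integral>x. f x \<partial>K \<omega>)) \<in> borel_measurable M"
     "(\<integral>\<^sup>+x. ennreal (f x) \<partial>mixture) = (\<integral>\<^sup>+\<omega>. ennreal (\<integral>x. f x \<partial>K \<omega>) \<partial>M)"
    using nn_integral_mixture[of "\<lambda>x. ennreal (f x)"] f by (simp_all add: eqK)
  have pos: "0 \<le> (\<integral>x. f x \<partial>K \<omega>)" for \<omega> using b by (simp add: integral_nonneg)
  have "(\<lambda>\<omega>. enn2real (ennreal (\<integral>x. f x \<partial>K \<omega>))) \<in> borel_measurable M"
    using nn(1) by measurable
  then have meas: "(\<lambda>\<omega>. \<integral>x. f x \<partial>K \<omega>) \<in> borel_measurable M" using pos by simp
  have intm: "integrable mixture f"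
    using finite_measure.integrable_const_bound[OF finite_mixture, of f B] f b by (simp add: AE_I2)
  have fin: "(\<integral>\<^sup>+\<omega>. ennreal (\<integral>x. f x \<partial>K \<omega>) \<partial>M) = ennreal (\<integral>x. f x \<partial>mixture)"
    using nn(2) nn_integral_eq_integral[OF intm] b by simp
  show int: "integrable M (\<lambda>\<omega>. \<integral>x. f x \<partial>K \<omega>)"
    by (rule integrableI_nonneg) (use meas pos fin in auto)
  show "(\<integral>x. f x \<partial>mixture) = (\<integral>\<omega>. \<integral>x. f x \<partial>K \<omega> \<partial>M)"
    using fin nn_integral_eq_integral[OF int] pos b by (simp add: integral_nonneg)
qed

lemma integral_mixture_real:
  fixes f :: "real \<Rightarrow> real"
  assumes f: "f \<in> borel_measurable borel" and b: "\<And>x. \<bar>f x\<bar> \<le> B"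
  shows "integrable M (\<lambda>\<omega>. \<integral>x. f x \<partial>K \<omega>)" "(\<integral>x. f x \<partial>mixture) = (\<integral>\<omega>. \<integral>x. f x \<partial>K \<omega> \<partial>M)"
proof -
  have B: "B \<ge> 0" using b[of 0] by linarith
  have K: "integrable (K \<omega>) f" "integrable (K \<omega>) (\<lambda>_. B)" for \<omega>
    using finite_measure.integrable_const_bound[OF finite_K, of f B] f b finite_measure.integrable_const[OF finite_K] by (simp_all add: AE_I2)
  have m: "integrable mixture f" "integrable mixture (\<lambda>_. B)"
    using finite_measure.integrable_const_bound[OF finite_mixture, of f B] f b finite_measure.integrable_const[OF finite_mixture] by (simp_all add: AE_I2)
  have "0 \<le> f x + B" "f x + B \<le> 2 * B" for x using b[of x] by linarith+
  note 1 = integral_mixture_nonneg[of "\<lambda>x. f x + B", OF _ this] integral_mixture_nonneg[of "\<lambda>_. B" B]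
  have e: "(\<integral>x. f x + B \<partial>K \<omega>) - (\<integral>x. B \<partial>K \<omega>) = (\<integral>x. f x \<partial>K \<omega>)" for \<omega>
    using K by (subst Bochner_Integration.integral_add) auto
  have i: "integrable M (\<lambda>\<omega>. \<integral>x. f x + B \<partial>K \<omega>)" "integrable M (\<lambda>\<omega>. \<integral>x. B \<partial>K \<omega>)"
    using 1(1,3) f B by auto
  show "integrable M (\<lambda>\<omega>. \<integral>x. f x \<partial>K \<omega>)"
    using Bochner_Integration.integrable_diff[OF i] unfolding e .
  have "(\<integral>x. f x \<partial>mixture) = (\<integral>x. f x + B \<partial>mixture) - (\<integral>x. B \<partial>mixture)"
    using m by (subst Bochner_Integration.integral_add) auto
  also have "\<dots> = (\<integral>\<omega>. \<integral>x. f x + B \<partial>K \<omega> \<partial>M) - (\<integral>\<omega>. \<integral>x. B \<partial>K \<omega> \<partial>M)"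
    using 1(2,4) f B by auto
  also have "\<dots> = (\<integral>\<omega>. \<integral>x. f x \<partial>K \<omega> \<partial>M)"
    using Bochner_Integration.integral_diff[OF i] unfolding e by simp
  finally show "(\<integral>x. f x \<partial>mixture) = (\<integral>\<omega>. \<integral>x. f x \<partial>K \<omega> \<partial>M)" .
qed

lemma integral_mixture:
  fixes f :: "real \<Rightarrow> complex"
  assumes f: "f \<in> borel_measurable borel" and b: "\<And>x. norm (f x) \<le> B"
  shows "integrable M (\<lambda>\<omega>. \<integral>x. f x \<partial>K \<omega>)" "(\<integral>x. f x \<partial>mixture) = (\<integral>\<omega>. \<integral>x. f x \<partial>K \<omega> \<partial>M)"
proof -
  have K: "integrable (K \<omega>) f" for \<omega>
    using finite_measure.integrable_const_bound[OF finite_K, of f B] f b by (simp add: AE_I2)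
  have m: "integrable mixture f"
    using finite_measure.integrable_const_bound[OF finite_mixture, of f B] f b by (simp add: AE_I2)
  have ReIm: "\<bar>Re (f x)\<bar> \<le> B" "\<bar>Im (f x)\<bar> \<le> B" for x
    using b[of x] abs_Re_le_cmod[of "f x"] abs_Im_le_cmod[of "f x"] by linarith+
  have fR: "(\<lambda>x. Re (f x)) \<in> borel_measurable borel" and fI: "(\<lambda>x. Im (f x)) \<in> borel_measurable borel"
    using f by measurable
  note R = integral_mixture_real[of "\<lambda>x. Re (f x)", OF _ ReIm(1)]
  note I = integral_mixture_real[of "\<lambda>x. Im (f x)", OF _ ReIm(2)]
  have e: "(\<integral>x. f x \<partial>K \<omega>) = of_real (\<integral>x. Re (f x) \<partial>K \<omega>) + \<i> * of_real (\<integral>x. Im (f x) \<partial>K \<omega>)" for \<omega>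
    unfolding integral_Re[OF K] integral_Im[OF K] by (rule complex_eq)
  have i: "integrable M (\<lambda>\<omega>. \<integral>x. Re (f x) \<partial>K \<omega>)" "integrable M (\<lambda>\<omega>. \<integral>x. Im (f x) \<partial>K \<omega>)"
    by (rule R(1)[OF fR], rule I(1)[OF fI])
  show "integrable M (\<lambda>\<omega>. \<integral>x. f x \<partial>K \<omega>)"
    unfolding e by (intro Bochner_Integration.integrable_add integrable_mult_right integrable_of_real i)
  have "(\<integral>\<omega>. \<integral>x. f x \<partial>K \<omega> \<partial>M) = of_real (\<integral>\<omega>. \<integral>x. Re (f x) \<partial>K \<omega> \<partial>M) + \<i> * of_real (\<integral>\<omega>. \<integral>x. Im (f x) \<partial>K \<omega> \<partial>M)"
    unfolding e
    by (subst Bochner_Integration.integral_add)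
       (simp_all only: integral_mult_right_zero integral_complex_of_real integrable_mult_right integrable_of_real i)
  also have "\<dots> = of_real (\<integral>x. Re (f x) \<partial>mixture) + \<i> * of_real (\<integral>x. Im (f x) \<partial>mixture)"
    unfolding R(2)[OF fR] I(2)[OF fI] ..
  also have "\<dots> = (\<integral>x. f x \<partial>mixture)"
    unfolding integral_Re[OF m] integral_Im[OF m] by (rule complex_eq[symmetric])
  finally show "(\<integral>x. f x \<partial>mixture) = (\<integral>\<omega>. \<integral>x. f x \<partial>K \<omega> \<partial>M)" ..
qed

end

text \<open>Continuous approximations from above of the indicator of \<open>(-\<infinity>, a]\<close>.\<close>

definition ramp :: "real \<Rightarrow> nat \<Rightarrow> real \<Rightarrow> real" where
  "ramp a m v = max 0 (min 1 (1 - real m * (v - a)))"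

lemma ramp_tendsto: "(\<lambda>m. ramp a m v) \<longlonglongrightarrow> indicator {..a} v"
proof (cases "v \<le> a")
  case True
  have "1 - real m * (v - a) \<ge> 1" for m
    using True by (simp add: mult_nonneg_nonpos)
  then have "ramp a m v = 1" for m by (simp add: ramp_def)
  then show ?thesis using True by simp
next
  case False
  then obtain N :: nat where N: "1 < real N * (v - a)" using reals_Archimedean3[of "v - a"] by auto
  have "ramp a m v = 0" if "m \<ge> N" for m
  proof -
    have "real N * (v - a) \<le> real m * (v - a)" using that False by (intro mult_right_mono) auto
    then show ?thesis using N by (simp add: ramp_def)
  qed
  then show ?thesis using False by (intro tendsto_eventually) (auto simp: eventually_sequentially)
qed

text \<open>A continuous process \<open>X\<close> observed by the clock of a continuous increasing process \<open>l\<close>. Path properties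
  are required for every outcome, so that no exceptional set has to be carried along.\<close>

locale boundary_process = prob_space M for M :: "'a measure" +
  fixes X l :: "real \<Rightarrow> 'a \<Rightarrow> real"
  assumes X_measurable [measurable]: "\<And>t. 0 \<le> t \<Longrightarrow> X t \<in> borel_measurable M"
    and l_measurable [measurable]: "\<And>t. 0 \<le> t \<Longrightarrow> l t \<in> borel_measurable M"
    and X_continuous: "\<And>\<omega>. continuous_on {0..} (\<lambda>t. X t \<omega>)"
    and l_regular: "\<And>\<omega>. regular_path (\<lambda>t. l t \<omega>)"
    and l_integrable: "integrable M (l 2)"
begin

lemma path_measurable [measurable]: "(\<lambda>t. X (max 0 t) \<omega>) \<in> borel_measurable borel"
proof -
  have "continuous_on UNIV (\<lambda>t. X (max 0 t) \<omega>)"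
    by (rule continuous_on_compose2[OF X_continuous[of \<omega>]]) (auto intro!: continuous_intros)
  then show ?thesis by (rule borel_measurable_continuous_onI)
qed

definition K :: "'a \<Rightarrow> real measure" where
  "K \<omega> = distr (clock (\<lambda>t. l t \<omega>)) borel (\<lambda>t. X (max 0 t) \<omega>)"

lemma finite_K: "finite_measure (K \<omega>)"
  unfolding K_def by (intro finite_measure.finite_measure_distr finite_measure_clock l_regular) measurable

lemma emeasure_K_UNIV: "emeasure (K \<omega>) UNIV = l 2 \<omega>"
  unfolding K_def by (subst emeasure_distr) (auto simp: emeasure_clock_UNIV[OF l_regular])

lemma integral_K:
  fixes f :: "real \<Rightarrow> complex"
  assumes [measurable]: "f \<in> borel_measurable borel"
  shows "(\<integral>v. f v \<partial>K \<omega>) = (\<integral>t. f (X (max 0 t) \<omega>) \<partial>clock (\<lambda>t. l t \<omega>))"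
  unfolding K_def by (rule integral_distr) measurable

text \<open>The path integral is a limit of Riemann sums, each of which involves finitely many times.\<close>

lemma measurable_integral_K:
  fixes f :: "real \<Rightarrow> complex"
  assumes f: "continuous_on UNIV f" "\<And>v. norm (f v) \<le> B"
  shows "(\<lambda>\<omega>. \<integral>v. f v \<partial>K \<omega>) \<in> borel_measurable M"
proof (rule borel_measurable_LIMSEQ_metric)
  have [measurable]: "f \<in> borel_measurable borel" using f(1) by (rule borel_measurable_continuous_onI)
  have fX [measurable]: "(\<lambda>\<omega>. f (X (grid n k) \<omega>)) \<in> borel_measurable M" for n k
    by (rule measurable_compose[OF X_measurable]) (auto simp: grid_nonneg)
  have [measurable]: "l (grid n k) \<in> borel_measurable M" for n k by (intro l_measurable grid_nonneg)
  show "(\<lambda>\<omega>. \<Sum>k<Suc n. f (X (grid n (Suc k)) \<omega>) * of_real (l (grid n (Suc k)) \<omega> - l (grid n k) \<omega>)) \<in> borel_measurable M" for n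
    by measurable
  fix \<omega>
  show "(\<lambda>n. \<Sum>k<Suc n. f (X (grid n (Suc k)) \<omega>) * of_real (l (grid n (Suc k)) \<omega> - l (grid n k) \<omega>)) \<longlonglongrightarrow> (\<integral>v. f v \<partial>K \<omega>)"
    unfolding integral_K[OF \<open>f \<in> borel_measurable borel\<close>]
  proof (rule riemann_sums_tendsto[OF l_regular])
    show "(\<lambda>t. f (X (max 0 t) \<omega>)) \<in> borel_measurable borel" by measurable
    fix t :: real assume t: "0 < t" "t \<le> 2"
    have "(\<lambda>n. X (grid n (Suc (cell n t))) \<omega>) \<longlonglongrightarrow> X t \<omega>"
      by (rule continuous_on_grid_tendsto(1)[OF X_continuous[of \<omega>] t])
    then show "(\<lambda>n. f (X (grid n (Suc (cell n t))) \<omega>)) \<longlonglongrightarrow> f (X (max 0 t) \<omega>)"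
      using t by (intro continuous_on_tendsto_compose[OF f(1)]) auto
  qed (rule f(2))
qed

lemma measurable_K_atMost: "(\<lambda>\<omega>. emeasure (K \<omega>) {..a}) \<in> borel_measurable M"
proof -
  have "(\<lambda>\<omega>. complex_of_real (measure (K \<omega>) {..a})) \<in> borel_measurable M"
  proof (rule borel_measurable_LIMSEQ_metric)
    have c: "continuous_on UNIV (ramp a m)" for m unfolding ramp_def by (intro continuous_intros)
    then have rm [measurable]: "ramp a m \<in> borel_measurable borel" for m by (rule borel_measurable_continuous_onI)
    have b: "\<bar>ramp a m v\<bar> \<le> 1" for m v by (simp add: ramp_def)
    show "(\<lambda>\<omega>. \<integral>v. complex_of_real (ramp a m v) \<partial>K \<omega>) \<in> borel_measurable M" for m
      by (rule measurable_integral_K[where B=1]) (use b c in \<open>auto intro!: continuous_intros\<close>)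
    fix \<omega>
    interpret K: finite_measure "K \<omega>" by (rule finite_K)
    have [measurable_cong]: "sets (K \<omega>) = sets borel" by (simp add: K_def)
    have "(\<lambda>m. \<integral>v. complex_of_real (ramp a m v) \<partial>K \<omega>) \<longlonglongrightarrow> (\<integral>v. complex_of_real (indicator {..a} v) \<partial>K \<omega>)"
    proof (rule integral_dominated_convergence[where w="\<lambda>_. 1"])
      show "AE v in K \<omega>. (\<lambda>m. complex_of_real (ramp a m v)) \<longlonglongrightarrow> complex_of_real (indicator {..a} v)"
        by (intro AE_I2 tendsto_of_real ramp_tendsto)
      show "AE v in K \<omega>. norm (complex_of_real (ramp a m v)) \<le> 1" for m using b by simp
      show "(\<lambda>v. complex_of_real (indicator {..a} v)) \<in> borel_measurable (K \<omega>)"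
        "(\<lambda>v. complex_of_real (ramp a m v)) \<in> borel_measurable (K \<omega>)" for m by measurable
    qed simp
    also have "(\<integral>v. complex_of_real (indicator {..a} v) \<partial>K \<omega>) = complex_of_real (measure (K \<omega>) {..a})"
      by (subst integral_complex_of_real) simp
    finally show "(\<lambda>m. \<integral>v. complex_of_real (ramp a m v) \<partial>K \<omega>) \<longlonglongrightarrow> complex_of_real (measure (K \<omega>) {..a})" .
  qed
  then have "(\<lambda>\<omega>. ennreal (Re (complex_of_real (measure (K \<omega>) {..a})))) \<in> borel_measurable M" by measurable
  then show ?thesis using finite_measure.emeasure_eq_measure[OF finite_K] by simp
qed

text \<open>Half-lines are reached from continuous functions by the ramps, and general Borel sets from half-lines
  by a Dynkin argument.\<close>

lemma measurable_K:
  assumes "A \<in> sets borel"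
  shows "(\<lambda>\<omega>. emeasure (K \<omega>) A) \<in> borel_measurable M"
proof -
  have sK: "sets (K \<omega>) = sets borel" for \<omega> by (simp add: K_def)
  have spK: "space (K \<omega>) = UNIV" for \<omega> by (simp add: K_def)
  have U: "(\<lambda>\<omega>. emeasure (K \<omega>) UNIV) \<in> borel_measurable M"
    unfolding emeasure_K_UNIV by measurable
  have b: "sets borel = sigma_sets UNIV (range (atMost :: real \<Rightarrow> _))"
    by (simp add: borel_eq_atMost)
  have "Int_stable (range (atMost :: real \<Rightarrow> _))"
    by (auto simp: Int_stable_def)
  moreover have "range (atMost :: real \<Rightarrow> _) \<subseteq> Pow UNIV" by simp
  moreover have "A \<in> sigma_sets UNIV (range (atMost :: real \<Rightarrow> _))" using assms b by simp
  ultimately show ?thesis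
  proof (induction rule: sigma_sets_induct_disjoint)
    case (basic A) then show ?case using measurable_K_atMost by auto
  next
    case empty show ?case by simp
  next
    case (compl A)
    then have "A \<in> sets borel" using b by simp
    then have "emeasure (K \<omega>) (UNIV - A) = emeasure (K \<omega>) UNIV - emeasure (K \<omega>) A" for \<omega>
      using emeasure_compl[of A "K \<omega>"] finite_measure.emeasure_finite[OF finite_K] by (simp add: sK spK)
    then show ?case using U compl by simp
  next
    case (union A)
    then have "range A \<subseteq> sets borel" using b by simp
    then have "emeasure (K \<omega>) (\<Union> (range A)) = (\<Sum>i. emeasure (K \<omega>) (A i))" for \<omega>
      using suminf_emeasure[of A "K \<omega>"] union by (simp add: sK)
    then show ?case using union by simp
  qed
qed

sublocale finite_kernel M K
proof (rule finite_kernel.intro[OF prob_space_axioms finite_kernel_axioms.intro])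
  have "0 \<le> l 2 \<omega>" for \<omega>
    using regular_path_mono[OF l_regular, of 0 2 \<omega>] l_regular[of \<omega>] by (simp add: regular_path_def)
  then have "(\<integral>\<^sup>+\<omega>. emeasure (K \<omega>) UNIV \<partial>M) = (\<integral>\<^sup>+\<omega>. ennreal (norm (l 2 \<omega>)) \<partial>M)"
    unfolding emeasure_K_UNIV by simp
  then show "(\<integral>\<^sup>+\<omega>. emeasure (K \<omega>) UNIV \<partial>M) < \<infinity>"
    using l_integrable unfolding integrable_iff_bounded by simp
  show "sets (K \<omega>) = sets borel" for \<omega> by (simp add: K_def)
qed (rule finite_K, rule measurable_K)

lemma half_line_mixture:
  assumes "\<And>t \<omega>. 0 \<le> t \<Longrightarrow> 0 \<le> X t \<omega>"
  shows "half_line_measure mixture"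
proof -
  have "emeasure (K \<omega>) {..<0} = 0" for \<omega>
  proof -
    have "(\<lambda>t. X (max 0 t) \<omega>) -` {..<0} = {}" using leD[OF assms[of "max 0 _" \<omega>]] by auto
    then show ?thesis unfolding K_def by (subst emeasure_distr) auto
  qed
  then have "emeasure mixture {..<0} = 0" by (simp add: emeasure_mixture)
  then have "AE v in mixture. 0 \<le> v" by (intro AE_I[of _ _ "{..<0}"]) auto
  then show ?thesis by (simp add: half_line_measure_def finite_mixture)
qed

lemma laplace_mixture:
  assumes nonneg: "\<And>t \<omega>. 0 \<le> t \<Longrightarrow> 0 \<le> X t \<omega>" and y: "Re y \<le> 0"
  shows "integrable M (\<lambda>\<omega>. \<integral>t. exp (y * of_real (X (max 0 t) \<omega>)) \<partial>clock (\<lambda>t. l t \<omega>))"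
    "laplace mixture y = (\<integral>\<omega>. \<integral>t. exp (y * of_real (X (max 0 t) \<omega>)) \<partial>clock (\<lambda>t. l t \<omega>) \<partial>M)"
proof -
  define f where "f v = exp (y * of_real (max 0 v))" for v :: real
  have f: "f \<in> borel_measurable borel" "norm (f v) \<le> 1" for v
    using norm_exp_mult_le_one[OF y, of "max 0 v"] by (simp_all add: f_def[abs_def])
  have 1: "(\<integral>v. f v \<partial>K \<omega>) = (\<integral>t. exp (y * of_real (X (max 0 t) \<omega>)) \<partial>clock (\<lambda>t. l t \<omega>))" for \<omega>
    using nonneg by (simp add: integral_K[OF f(1)]) (simp add: f_def max_absorb2)
  have "laplace mixture y = (\<integral>v. f v \<partial>mixture)"
    unfolding laplace_def
    by (rule integral_cong_AE) (use half_line_mixture[OF nonneg] f in \<open>auto simp: half_line_measure_def f_def elim!: eventually_mono\<close>)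
  then show "integrable M (\<lambda>\<omega>. \<integral>t. exp (y * of_real (X (max 0 t) \<omega>)) \<partial>clock (\<lambda>t. l t \<omega>))"
    "laplace mixture y = (\<integral>\<omega>. \<integral>t. exp (y * of_real (X (max 0 t) \<omega>)) \<partial>clock (\<lambda>t. l t \<omega>) \<partial>M)"
    using integral_mixture[OF f] unfolding 1 by simp_all
qed

text \<open>The occupation measure of versions with good paths agrees with that of the original processes, and
  in particular the set function on the left is a measure.\<close>

lemma restrict_mixture:
  fixes X' l' :: "real \<Rightarrow> 'a \<Rightarrow> real"
  assumes ae: "AE \<omega> in M. \<forall>t\<ge>0. X' t \<omega> = X t \<omega> \<and> l' t \<omega> = l t \<omega>"
  shows "measure_of {0<..} (sets (restrict_space borel {0<..}))
       (\<lambda>A. \<integral>\<^sup>+\<omega>. (\<integral>\<^sup>+t\<in>{0..2}. indicator A (X' t \<omega>) \<partial>stieltjes (\<lambda>t. l' t \<omega>)) \<partial>M) = restrict_space mixture {0<..}"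
proof -
  have 1: "(\<integral>\<^sup>+\<omega>. (\<integral>\<^sup>+t\<in>{0..2}. indicator A (X' t \<omega>) \<partial>stieltjes (\<lambda>t. l' t \<omega>)) \<partial>M) = emeasure mixture A"
    if A: "A \<in> sets borel" for A
  proof -
    have "(\<integral>\<^sup>+t\<in>{0..2}. indicator A (X' t \<omega>) \<partial>stieltjes (\<lambda>t. l' t \<omega>)) = emeasure (K \<omega>) A"
      if w: "\<forall>t\<ge>0. X' t \<omega> = X t \<omega> \<and> l' t \<omega> = l t \<omega>" for \<omega>
    proof -
      have s: "stieltjes (\<lambda>t. l' t \<omega>) = stieltjes (\<lambda>t. l t \<omega>)"
        unfolding stieltjes_def using w by (intro arg_cong[of _ _ interval_measure]) auto
      have "emeasure (K \<omega>) A = (\<integral>\<^sup>+t. indicator A (X (max 0 t) \<omega>) \<partial>clock (\<lambda>t. l t \<omega>))"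
      proof -
        have "emeasure (K \<omega>) A = (\<integral>\<^sup>+v. indicator A v \<partial>K \<omega>)" using A by simp
        also have "\<dots> = (\<integral>\<^sup>+t. indicator A (X (max 0 t) \<omega>) \<partial>clock (\<lambda>t. l t \<omega>))"
          unfolding K_def using A by (intro nn_integral_distr path_measurable) simp_all
        finally show ?thesis .
      qed
      also have "\<dots> = (\<integral>\<^sup>+t. indicator {0..2} t * indicator A (X (max 0 t) \<omega>) \<partial>stieltjes (\<lambda>t. l t \<omega>))"
        unfolding clock_def using A by (intro nn_integral_density) auto
      also have "\<dots> = (\<integral>\<^sup>+t\<in>{0..2}. indicator A (X' t \<omega>) \<partial>stieltjes (\<lambda>t. l' t \<omega>))"
        unfolding s using w by (intro nn_integral_cong) (auto split: split_indicator simp: max_absorb2)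
      finally show ?thesis ..
    qed
    then have "(\<integral>\<^sup>+\<omega>. (\<integral>\<^sup>+t\<in>{0..2}. indicator A (X' t \<omega>) \<partial>stieltjes (\<lambda>t. l' t \<omega>)) \<partial>M) = (\<integral>\<^sup>+\<omega>. emeasure (K \<omega>) A \<partial>M)"
      using ae by (intro nn_integral_cong_AE) (auto elim!: eventually_mono)
    then show ?thesis by (simp add: emeasure_mixture A)
  qed
  have sub: "sets (restrict_space borel {0<..}) \<subseteq> sets (borel :: real measure)"
    by (auto simp: sets_restrict_space)
  have sig: "sigma_sets {0<..} (sets (restrict_space borel {0<..})) = sets (restrict_space borel {0::real<..})"
    using sets.sigma_sets_eq[of "restrict_space borel {0::real<..}"] by (simp add: space_restrict_space)
  have "restrict_space mixture {0<..} = measure_of {0<..} (sets (restrict_space borel {0<..})) (emeasure mixture)"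
    by (simp add: restrict_space_def[of mixture] sets_restrict_space)
  also have "\<dots> = measure_of {0<..} (sets (restrict_space borel {0<..}))
       (\<lambda>A. \<integral>\<^sup>+\<omega>. (\<integral>\<^sup>+t\<in>{0..2}. indicator A (X' t \<omega>) \<partial>stieltjes (\<lambda>t. l' t \<omega>)) \<partial>M)"
  proof (rule measure_of_eq)
    show "sets (restrict_space borel {0<..}) \<subseteq> Pow {0::real<..}" by (auto simp: sets_restrict_space)
    fix A assume "A \<in> sigma_sets {0<..} (sets (restrict_space borel {0::real<..}))"
    then have "A \<in> sets borel" using sub unfolding sig by blast
    then show "emeasure mixture A = (\<integral>\<^sup>+\<omega>. (\<integral>\<^sup>+t\<in>{0..2}. indicator A (X' t \<omega>) \<partial>stieltjes (\<lambda>t. l' t \<omega>)) \<partial>M)"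
      by (rule 1[symmetric])
  qed
  finally show ?thesis ..
qed

end

section \<open>Gaussian increments and stationarity\<close>

context prob_space
begin

lemma integral_iexp_centered_normal:
  assumes X: "random_variable borel X" and d: "distr M borel X = centered_normal v" and v: "0 \<le> v"
  shows "(\<integral>\<omega>. exp (\<i> * of_real (X \<omega>)) \<partial>M) = of_real (exp (- v / 2))"
proof -
  have "(\<integral>\<omega>. exp (\<i> * of_real (X \<omega>)) \<partial>M) = (\<integral>x. exp (\<i> * of_real x) \<partial>distr M borel X)"
    using X by (subst integral_distr) auto
  also have "\<dots> = of_real (exp (- v / 2))"
  proof (cases "v = 0")
    case True
    then show ?thesis unfolding d by (simp add: centered_normal_def integral_return)
  next
    case False
    define \<sigma> where "\<sigma> = sqrt v"
    have s: "\<sigma> > 0" "\<sigma>\<^sup>2 = v" using False v by (auto simp: \<sigma>_def)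
    interpret N: prob_space std_normal_distribution by (rule prob_space_normal_density) simp
    have "distributed std_normal_distribution lborel (\<lambda>x. x) std_normal_density"
      unfolding distributed_def by (auto simp: distr_id2)
    from N.normal_density_affine[OF this, of \<sigma> 0]
    have "distributed std_normal_distribution lborel (\<lambda>x. \<sigma> * x) (normal_density 0 \<sigma>)"
      using s by simp
    then have e: "distr std_normal_distribution lborel (\<lambda>x. \<sigma> * x) = density lborel (normal_density 0 \<sigma>)"
      by (simp add: distributed_def)
    have "(\<integral>x. exp (\<i> * of_real x) \<partial>distr M borel X) = (\<integral>x. exp (\<i> * of_real x) \<partial>distr std_normal_distribution lborel (\<lambda>x. \<sigma> * x))"
      unfolding d e using False by (simp add: centered_normal_def \<sigma>_def)
    also have "\<dots> = char std_normal_distribution \<sigma>"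
      unfolding char_def by (subst integral_distr) auto
    finally show ?thesis using s by (simp add: char_std_normal_distribution)
  qed
  finally show ?thesis .
qed

lemma integrable_centered_normal:
  assumes X: "random_variable borel X" and d: "distr M borel X = centered_normal v" and v: "0 \<le> v"
  shows "integrable M X"
proof -
  have "integrable (centered_normal v) (\<lambda>x. x)"
  proof (cases "v = 0")
    case True
    interpret R: prob_space "return borel (0::real)" by (rule prob_space_return) simp
    have "integrable (return borel (0::real)) (\<lambda>x. x)"
      by (rule R.integrable_const_bound[where B=0]) (auto simp: AE_return)
    then show ?thesis using True by (simp add: centered_normal_def)
  next
    case False
    then have "0 < sqrt v" using v by simp
    then have "integrable lborel (\<lambda>x. normal_density 0 (sqrt v) x * (x - 0) ^ 1)" by (rule integrable_normal_moment)
    then show ?thesis using False by (simp add: centered_normal_def integrable_density)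
  qed
  then have "integrable (distr M borel X) (\<lambda>x. x)" unfolding d .
  then show ?thesis using X integrable_distr_eq[OF X, of "\<lambda>x. x"] by simp
qed

lemma AE_zero_centered_normal:
  assumes X: "random_variable borel X" and d: "distr M borel X = centered_normal 0"
  shows "AE \<omega> in M. X \<omega> = 0"
proof -
  have c: "centered_normal 0 = return borel 0" by (simp add: centered_normal_def)
  have "AE x in distr M borel X. x = 0" unfolding d c by (subst AE_return) auto
  then show ?thesis using X by (subst (asm) AE_distr_iff) auto
qed

text \<open>Truncation at level \<open>n\<close> preserves the lower bound, and truncated
  variables with the same law have equal means; let \<open>n \<rightarrow> \<infinity>\<close> by Fatou's lemma.\<close>

lemma nn_integral_stationary_difference:
  assumes X: "random_variable borel X" and Y: "random_variable borel Y" and d: "distr M borel X = distr M borel Y"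
    and pos: "AE \<omega> in M. (0::real) \<le> X \<omega>" "AE \<omega> in M. 0 \<le> Y \<omega>"
    and \<xi>: "integrable M \<xi>" "\<And>\<omega>. 0 \<le> \<xi> \<omega>" and low: "AE \<omega> in M. 0 \<le> Y \<omega> - X \<omega> + \<xi> \<omega>"
  shows "(\<integral>\<^sup>+\<omega>. ennreal (Y \<omega> - X \<omega> + \<xi> \<omega>) \<partial>M) \<le> ennreal (\<integral>\<omega>. \<xi> \<omega> \<partial>M)"
proof -
  define H where "H n \<omega> = min (Y \<omega>) (real n) - min (X \<omega>) (real n) + \<xi> \<omega>" for n \<omega>
  have [measurable]: "\<xi> \<in> borel_measurable M" using \<xi> by simp
  note X[measurable] Y[measurable]
  have trunc: "integrable M (\<lambda>\<omega>. min (Z \<omega>) (real n))"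
    if [measurable]: "random_variable borel Z" and Z: "AE \<omega> in M. 0 \<le> Z \<omega>" for Z :: "'a \<Rightarrow> real" and n
    by (rule integrable_const_bound[where B="real n"]) (use Z in \<open>auto elim!: eventually_mono\<close>)
  note iX = trunc[OF X pos(1)] and iY = trunc[OF Y pos(2)]
  have "(\<integral>x. min x (real n) \<partial>distr M borel X) = (\<integral>x. min x (real n) \<partial>distr M borel Y)" for n unfolding d ..
  then have E: "(\<integral>\<omega>. min (X \<omega>) (real n) \<partial>M) = (\<integral>\<omega>. min (Y \<omega>) (real n) \<partial>M)" for n
    by (subst (asm) (1 2) integral_distr) auto
  have iH: "integrable M (H n)" for n unfolding H_def using iX iY \<xi> by auto
  have H: "(\<integral>\<omega>. H n \<omega> \<partial>M) = (\<integral>\<omega>. \<xi> \<omega> \<partial>M)" for n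
    unfolding H_def using iX iY \<xi>(1) E by simp
  have Hpos: "AE \<omega> in M. 0 \<le> H n \<omega>" for n
    using low
  proof eventually_elim
    fix \<omega> assume "0 \<le> Y \<omega> - X \<omega> + \<xi> \<omega>"
    then show "0 \<le> H n \<omega>" using \<xi>(2)[of \<omega>] by (auto simp: H_def min_def)
  qed
  have "(\<integral>\<^sup>+\<omega>. ennreal (Y \<omega> - X \<omega> + \<xi> \<omega>) \<partial>M) = (\<integral>\<^sup>+\<omega>. liminf (\<lambda>n. ennreal (H n \<omega>)) \<partial>M)"
  proof (intro nn_integral_cong)
    fix \<omega>
    obtain N :: nat where N: "max (X \<omega>) (Y \<omega>) \<le> real N" using real_arch_simple by blast
    have "H n \<omega> = Y \<omega> - X \<omega> + \<xi> \<omega>" if "n \<ge> N" for n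
    proof -
      have "real N \<le> real n" using that by simp
      then show ?thesis using N by (simp add: H_def)
    qed
    then have "(\<lambda>n. ennreal (H n \<omega>)) \<longlonglongrightarrow> ennreal (Y \<omega> - X \<omega> + \<xi> \<omega>)"
      by (intro tendsto_eventually eventually_sequentiallyI[of N]) simp
    then show "ennreal (Y \<omega> - X \<omega> + \<xi> \<omega>) = liminf (\<lambda>n. ennreal (H n \<omega>))"
      by (intro lim_imp_Liminf[symmetric]) auto
  qed
  also have "\<dots> \<le> liminf (\<lambda>n. \<integral>\<^sup>+\<omega>. ennreal (H n \<omega>) \<partial>M)"
    by (rule nn_integral_liminf) (auto simp: H_def)
  also have "(\<lambda>n. \<integral>\<^sup>+\<omega>. ennreal (H n \<omega>) \<partial>M) = (\<lambda>n. ennreal (\<integral>\<omega>. \<xi> \<omega> \<partial>M))"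
    using nn_integral_eq_integral[OF iH Hpos] H by simp
  finally show ?thesis by (simp add: Liminf_const)
qed

lemma expectation_product_indep_set:
  fixes U V :: "'a \<Rightarrow> complex"
  assumes ind: "indep_set (sets A) (sets (vimage_algebra (space M) D borel))"
    and sub: "subalgebra M A"
    and U: "U \<in> borel_measurable A" "integrable M U"
    and V: "\<phi> \<in> borel_measurable borel" "V = (\<lambda>\<omega>. \<phi> (D \<omega>))" "integrable M V"
  shows "(\<integral>\<omega>. U \<omega> * V \<omega> \<partial>M) = (\<integral>\<omega>. U \<omega> \<partial>M) * (\<integral>\<omega>. V \<omega> \<partial>M)"
proof (rule indep_var_lebesgue_integral)
  have spA: "space A = space M" using sub by (simp add: subalgebra_def)
  have "sigma_sets (space M) {U -` S \<inter> space M | S. S \<in> sets borel} \<subseteq> sets A"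
    using sets.sigma_sets_subset[of "{U -` S \<inter> space M | S. S \<in> sets borel}" A] measurable_sets[OF U(1)]
    by (auto simp: spA)
  moreover have "sigma_sets (space M) {V -` S \<inter> space M | S. S \<in> sets borel} \<subseteq> sets (vimage_algebra (space M) D borel)"
  proof -
    have "V \<in> borel_measurable (vimage_algebra (space M) D borel)"
      unfolding V(2) by (rule measurable_compose[OF measurable_vimage_algebra1 V(1)]) simp
    then show ?thesis
      using sets.sigma_sets_subset[of "{V -` S \<inter> space M | S. S \<in> sets borel}" "vimage_algebra (space M) D borel"]
        measurable_sets[of V "vimage_algebra (space M) D borel" borel] by auto
  qed
  ultimately have "indep_set (sigma_sets (space M) {U -` S \<inter> space M | S. S \<in> sets borel})
      (sigma_sets (space M) {V -` S \<inter> space M | S. S \<in> sets borel})"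
    using ind unfolding indep_set_def by (rule_tac indep_sets_mono_sets) (auto split: bool.splits)
  then show "indep_var borel U borel V"
    unfolding indep_var_eq using U V by auto
qed (use U V in auto)

end

text \<open>A direction that both reflection vectors push upwards: this is where the condition on the reflection
  matrix enters the integrability of the local times.\<close>

lemma reflection_direction:
  fixes r\<^sub>1 r\<^sub>2 :: real
  assumes "1 - r\<^sub>1 * r\<^sub>2 > 0 \<or> (r\<^sub>1 > 0 \<and> r\<^sub>2 > 0)"
  obtains p q where "p > 0" "q > 0" "p + r\<^sub>1 * q > 0" "r\<^sub>2 * p + q > 0"
proof -
  consider "r\<^sub>1 \<ge> 0" "r\<^sub>2 \<ge> 0" | "r\<^sub>1 \<ge> 0" "r\<^sub>2 < 0" | "r\<^sub>1 < 0" "r\<^sub>2 \<ge> 0" | "r\<^sub>1 < 0" "r\<^sub>2 < 0" "r\<^sub>1 * r\<^sub>2 < 1"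
    using assms by linarith
  then show ?thesis
  proof cases
    case 1 then show ?thesis using that[of 1 1] by simp
  next
    case 2
    then have "0 < 1 + r\<^sub>1 * (1 - r\<^sub>2)" by (intro add_pos_nonneg mult_nonneg_nonneg) auto
    with 2 show ?thesis using that[of 1 "1 - r\<^sub>2"] by simp
  next
    case 3
    then have "0 < r\<^sub>2 * (1 - r\<^sub>1) + 1" by (intro add_nonneg_pos mult_nonneg_nonneg) auto
    with 3 show ?thesis using that[of "1 - r\<^sub>1" 1] by simp
  next
    case 4
    define q where "q = (- r\<^sub>2 + 1 / (- r\<^sub>1)) / 2"
    have a: "- r\<^sub>2 < 1 / (- r\<^sub>1)" using 4 by (simp add: field_simps)
    then have q: "- r\<^sub>2 < q" "q < 1 / (- r\<^sub>1)" by (simp_all add: q_def)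
    then have "q * (- r\<^sub>1) < 1" using 4 by (simp add: field_simps)
    then show ?thesis using that[of 1 q] q 4 by (simp add: mult.commute)
  qed
qed

section \<open>The stationary reflected process\<close>

lemma borel_measurable_component [measurable (raw)]:
  fixes f :: "'b \<Rightarrow> real ^ 'n"
  assumes "f \<in> borel_measurable M"
  shows "(\<lambda>x. f x $ i) \<in> borel_measurable M"
  by (rule measurable_compose[OF assms borel_measurable_continuous_onI]) (intro continuous_intros)

locale stationary_reflected_BM =
  fixes r\<^sub>1 r\<^sub>2 \<mu>\<^sub>1 \<mu>\<^sub>2 :: real
    and M :: "'a measure" and F :: "real \<Rightarrow> 'a measure"
    and W G L :: "real \<Rightarrow> 'a \<Rightarrow> real ^ 2" and \<pi> :: "(real ^ 2) measure"
  assumes RBM: "degenerate_reflected_BM r\<^sub>1 r\<^sub>2 \<mu>\<^sub>1 \<mu>\<^sub>2 M F W G L"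
    and inv: "invariant_law \<pi> M G"
    and refl: "1 - r\<^sub>1 * r\<^sub>2 > 0 \<or> (r\<^sub>1 > 0 \<and> r\<^sub>2 > 0)"

sublocale stationary_reflected_BM \<subseteq> prob_space M
  using RBM by (simp add: degenerate_reflected_BM_def)

context stationary_reflected_BM
begin

lemma subalgebra_F: "subalgebra M (F t)"
  and G_adapted: "0 \<le> t \<Longrightarrow> G t \<in> borel_measurable (F t)"
  and L_adapted: "0 \<le> t \<Longrightarrow> L t \<in> borel_measurable (F t)"
  and BM: "brownian_motion M F (vector [vector [1, -1], vector [-1, 1]]) W"
  using RBM by (auto simp: degenerate_reflected_BM_def)

lemma W_adapted: "0 \<le> t \<Longrightarrow> W t \<in> borel_measurable (F t)"
  using BM by (auto simp: brownian_motion_def)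

lemma G_measurable [measurable]: "0 \<le> t \<Longrightarrow> G t \<in> borel_measurable M"
  by (rule measurable_from_subalg[OF subalgebra_F G_adapted])

lemma L_measurable [measurable]: "0 \<le> t \<Longrightarrow> L t \<in> borel_measurable M"
  by (rule measurable_from_subalg[OF subalgebra_F L_adapted])

lemma W_measurable [measurable]: "0 \<le> t \<Longrightarrow> W t \<in> borel_measurable M"
  by (rule measurable_from_subalg[OF subalgebra_F W_adapted])

definition good_path :: "'a \<Rightarrow> bool" where
  "good_path \<omega> \<longleftrightarrow> continuous_on {0..} (\<lambda>t. G t \<omega>) \<and> continuous_on {0..} (\<lambda>t. L t \<omega>) \<and>
        (\<forall>t\<ge>0. \<forall>i. 0 \<le> G t \<omega> $ i) \<and>
        (\<forall>t\<ge>0.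
           G t \<omega> $ 1 = G 0 \<omega> $ 1 - \<mu>\<^sub>1 * t + W t \<omega> $ 1 + L t \<omega> $ 1 + r\<^sub>2 * L t \<omega> $ 2 \<and>
           G t \<omega> $ 2 = G 0 \<omega> $ 2 - \<mu>\<^sub>2 * t + W t \<omega> $ 2 + r\<^sub>1 * L t \<omega> $ 1 + L t \<omega> $ 2) \<and>
        (\<forall>i. L 0 \<omega> $ i = 0 \<and> mono_on {0..} (\<lambda>t. L t \<omega> $ i) \<and>
             (AE t in stieltjes (\<lambda>t. L t \<omega> $ i). G t \<omega> $ i = 0))"

lemma AE_good_path: "AE \<omega> in M. good_path \<omega>"
  using RBM unfolding degenerate_reflected_BM_def good_path_def by (elim conjE)

lemma AE_W0: "AE \<omega> in M. W 0 \<omega> = 0"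
  using BM by (auto simp: brownian_motion_def elim!: eventually_mono)

lemma increment_distr:
  assumes "0 \<le> s" "s \<le> t"
  shows "distr M borel (\<lambda>\<omega>. \<theta> \<bullet> (W t \<omega> - W s \<omega>)) = centered_normal ((t - s) * (\<theta> $ 1 - \<theta> $ 2)\<^sup>2)"
proof -
  have "\<theta> \<bullet> (vector [vector [1, -1], vector [-1, 1]] *v \<theta>) = (\<theta> $ 1 - \<theta> $ 2)\<^sup>2"
    by (simp add: inner_vec_def matrix_vector_mult_def UNIV_2 power2_eq_square algebra_simps)
  moreover have "distr M borel (\<lambda>\<omega>. \<theta> \<bullet> (W t \<omega> - W s \<omega>)) = centered_normal ((t - s) * (\<theta> \<bullet> (vector [vector [1, -1], vector [-1, 1]] *v \<theta>)))"
    using BM assms unfolding brownian_motion_def by blast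
  ultimately show ?thesis by simp
qed

lemma increment_indep:
  assumes "0 \<le> s" "s \<le> t"
  shows "indep_set (sets (F s)) (sets (vimage_algebra (space M) (\<lambda>\<omega>. W t \<omega> - W s \<omega>) borel))"
  using BM assms unfolding brownian_motion_def by blast

text \<open>The covariance matrix annihilates \<open>(1, 1)\<close>.\<close>

lemma AE_increment_opposite:
  assumes "0 \<le> s" "s \<le> t"
  shows "AE \<omega> in M. W t \<omega> $ 2 - W s \<omega> $ 2 = - (W t \<omega> $ 1 - W s \<omega> $ 1)"
proof -
  define \<theta> :: "real ^ 2" where "\<theta> = vector [1, 1]"
  have [measurable]: "W s \<in> borel_measurable M" "W t \<in> borel_measurable M" using assms by auto
  have "AE \<omega> in M. \<theta> \<bullet> (W t \<omega> - W s \<omega>) = 0"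
    using increment_distr[OF assms, of \<theta>] by (intro AE_zero_centered_normal) (auto simp: \<theta>_def)
  then show ?thesis
    by eventually_elim (simp add: \<theta>_def inner_vec_def UNIV_2)
qed

lemma G_distr: "0 \<le> s \<Longrightarrow> 0 \<le> t \<Longrightarrow> distr M borel (G s) = distr M borel (G t)"
  using inv by (simp add: invariant_law_def)

text \<open>With \<open>V = p G\<^sub>1 + q G\<^sub>2\<close> the positive combination of local times is \<open>V(2) - V(0)\<close> plus an integrable
  variable, and stationarity of \<open>V\<close> bounds its expectation.\<close>

lemma L_integrable: "integrable M (\<lambda>\<omega>. L 2 \<omega> $ i)"
proof -
  obtain p q where pq: "p > 0" "q > 0" "p + r\<^sub>1 * q > 0" "r\<^sub>2 * p + q > 0"
    using reflection_direction[OF refl] by blast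
  define \<theta> :: "real ^ 2" where "\<theta> = vector [p, q]"
  have th: "\<theta> \<bullet> v = p * v $ 1 + q * v $ 2" for v :: "real ^ 2" by (simp add: \<theta>_def inner_vec_def UNIV_2)
  \<comment> \<open>The drift and the noise of \<open>V\<close> over \<open>[0, 2]\<close>.\<close>
  define \<xi> where "\<xi> \<omega> = \<bar>2 * (p * \<mu>\<^sub>1 + q * \<mu>\<^sub>2) - \<theta> \<bullet> (W 2 \<omega> - W 0 \<omega>)\<bar>" for \<omega>
  have [measurable]: "W 0 \<in> borel_measurable M" "W 2 \<in> borel_measurable M" "G 0 \<in> borel_measurable M" "G 2 \<in> borel_measurable M" "L 2 \<in> borel_measurable M" by auto
  have "integrable M (\<lambda>\<omega>. \<theta> \<bullet> (W 2 \<omega> - W 0 \<omega>))"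
    by (rule integrable_centered_normal[OF _ increment_distr]) auto
  then have \<xi>: "integrable M \<xi>" unfolding \<xi>_def by (intro integrable_abs Bochner_Integration.integrable_diff) auto
  define V where "V t \<omega> = \<theta> \<bullet> G t \<omega>" for t \<omega>
  have Vm [measurable]: "V 0 \<in> borel_measurable M" "V 2 \<in> borel_measurable M"
    unfolding V_def[abs_def] by measurable
  have dV: "distr M borel (V 0) = distr M borel (V 2)"
  proof -
    have "distr M borel (V t) = distr (distr M borel (G t)) borel (\<lambda>v. \<theta> \<bullet> v)" if "0 \<le> t" for t
      unfolding V_def using that by (subst distr_distr) (auto simp: o_def)
    then show ?thesis using G_distr[of 0 2] by simp
  qed
  have key: "AE \<omega> in M. 0 \<le> L 2 \<omega> $ 1 \<and> 0 \<le> L 2 \<omega> $ 2 \<and>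
      (p + r\<^sub>1 * q) * L 2 \<omega> $ 1 + (r\<^sub>2 * p + q) * L 2 \<omega> $ 2 \<le> V 2 \<omega> - V 0 \<omega> + \<xi> \<omega> \<and> 0 \<le> V 0 \<omega> \<and> 0 \<le> V 2 \<omega>"
    using AE_good_path AE_W0
  proof eventually_elim
    fix \<omega> assume g: "good_path \<omega>" and W0: "W 0 \<omega> = 0"
    have L0: "L 0 \<omega> $ i = 0" and Lm: "mono_on {0..} (\<lambda>t. L t \<omega> $ i)" for i using g by (auto simp: good_path_def)
    have L2: "0 \<le> L 2 \<omega> $ i" for i using mono_onD[OF Lm, of 0 2 i] L0[of i] by simp
    have G: "0 \<le> G t \<omega> $ i" if "0 \<le> t" for t i using g that by (auto simp: good_path_def)
    have e: "G 2 \<omega> $ 1 = G 0 \<omega> $ 1 - \<mu>\<^sub>1 * 2 + W 2 \<omega> $ 1 + L 2 \<omega> $ 1 + r\<^sub>2 * L 2 \<omega> $ 2"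
      "G 2 \<omega> $ 2 = G 0 \<omega> $ 2 - \<mu>\<^sub>2 * 2 + W 2 \<omega> $ 2 + r\<^sub>1 * L 2 \<omega> $ 1 + L 2 \<omega> $ 2"
      using g unfolding good_path_def by (metis zero_le_numeral)+
    have "V 2 \<omega> - V 0 \<omega> = (p + r\<^sub>1 * q) * L 2 \<omega> $ 1 + (r\<^sub>2 * p + q) * L 2 \<omega> $ 2 - (2 * (p * \<mu>\<^sub>1 + q * \<mu>\<^sub>2) - \<theta> \<bullet> (W 2 \<omega> - W 0 \<omega>))"
      unfolding V_def th e W0 by (simp add: algebra_simps)
    moreover have "0 \<le> V 0 \<omega>" "0 \<le> V 2 \<omega>" unfolding V_def th using G pq by simp_all
    ultimately show "0 \<le> L 2 \<omega> $ 1 \<and> 0 \<le> L 2 \<omega> $ 2 \<and>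
      (p + r\<^sub>1 * q) * L 2 \<omega> $ 1 + (r\<^sub>2 * p + q) * L 2 \<omega> $ 2 \<le> V 2 \<omega> - V 0 \<omega> + \<xi> \<omega> \<and> 0 \<le> V 0 \<omega> \<and> 0 \<le> V 2 \<omega>"
      using L2 by (simp add: \<xi>_def)
  qed
  have fin: "(\<integral>\<^sup>+\<omega>. ennreal (V 2 \<omega> - V 0 \<omega> + \<xi> \<omega>) \<partial>M) \<le> ennreal (\<integral>\<omega>. \<xi> \<omega> \<partial>M)"
  proof (rule nn_integral_stationary_difference[OF Vm dV _ _ \<xi>])
    show "AE \<omega> in M. 0 \<le> V 2 \<omega> - V 0 \<omega> + \<xi> \<omega>"
      using key
    proof eventually_elim
      case (elim \<omega>)
      then have "0 \<le> (p + r\<^sub>1 * q) * L 2 \<omega> $ 1 + (r\<^sub>2 * p + q) * L 2 \<omega> $ 2" using pq by simp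
      then show ?case using elim by linarith
    qed
    show "AE \<omega> in M. 0 \<le> V 0 \<omega>" "AE \<omega> in M. 0 \<le> V 2 \<omega>" using key by (auto elim!: eventually_mono)
  qed (simp add: \<xi>_def)
  have int: "integrable M f" if [measurable]: "f \<in> borel_measurable M" and c: "c > 0" and f: "AE \<omega> in M. 0 \<le> f \<omega> \<and> c * f \<omega> \<le> V 2 \<omega> - V 0 \<omega> + \<xi> \<omega>" for f c
  proof (rule integrableI_bounded)
    have "(\<integral>\<^sup>+\<omega>. ennreal (norm (f \<omega>)) \<partial>M) \<le> (\<integral>\<^sup>+\<omega>. ennreal (1 / c) * ennreal (V 2 \<omega> - V 0 \<omega> + \<xi> \<omega>) \<partial>M)"
      using f
    proof (intro nn_integral_mono_AE, eventually_elim)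
      case (elim \<omega>)
      have "ennreal (1 / c) * ennreal (c * f \<omega>) \<le> ennreal (1 / c) * ennreal (V 2 \<omega> - V 0 \<omega> + \<xi> \<omega>)"
        using elim by (intro mult_left_mono ennreal_leI) auto
      moreover have "ennreal (1 / c) * ennreal (c * f \<omega>) = ennreal (f \<omega>)"
        using c elim by (subst ennreal_mult[symmetric]) auto
      ultimately show ?case using elim by simp
    qed
    also have "\<dots> = ennreal (1 / c) * (\<integral>\<^sup>+\<omega>. ennreal (V 2 \<omega> - V 0 \<omega> + \<xi> \<omega>) \<partial>M)"
      by (rule nn_integral_cmult) (auto simp: V_def \<xi>_def)
    also have "\<dots> \<le> ennreal (1 / c) * ennreal (\<integral>\<omega>. \<xi> \<omega> \<partial>M)"
      using fin by (intro mult_left_mono) auto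
    also have "\<dots> < \<infinity>" by (simp add: ennreal_mult_less_top)
    finally show "(\<integral>\<^sup>+\<omega>. ennreal (norm (f \<omega>)) \<partial>M) < \<infinity>" .
  qed fact
  have bounds: "AE \<omega> in M. (0 \<le> L 2 \<omega> $ 1 \<and> (p + r\<^sub>1 * q) * L 2 \<omega> $ 1 \<le> V 2 \<omega> - V 0 \<omega> + \<xi> \<omega>) \<and>
      (0 \<le> L 2 \<omega> $ 2 \<and> (r\<^sub>2 * p + q) * L 2 \<omega> $ 2 \<le> V 2 \<omega> - V 0 \<omega> + \<xi> \<omega>)"
    using key
  proof eventually_elim
    case (elim \<omega>)
    then have "0 \<le> (p + r\<^sub>1 * q) * L 2 \<omega> $ 1" "0 \<le> (r\<^sub>2 * p + q) * L 2 \<omega> $ 2" using pq by simp_all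
    then show ?case using elim by linarith
  qed
  have "integrable M (\<lambda>\<omega>. L 2 \<omega> $ 1)"
    by (rule int[OF _ pq(3)], measurable) (use bounds in \<open>auto elim!: eventually_mono\<close>)
  moreover have "integrable M (\<lambda>\<omega>. L 2 \<omega> $ 2)"
    by (rule int[OF _ pq(4)], measurable) (use bounds in \<open>auto elim!: eventually_mono\<close>)
  ultimately show ?thesis using exhaust_2[of i] by auto
qed

text \<open>Setting both processes to zero on a null set makes all path properties hold everywhere.\<close>

lemma regularization:
  obtains X l :: "real \<Rightarrow> 'a \<Rightarrow> real ^ 2" where
    "AE \<omega> in M. \<forall>t\<ge>0. G t \<omega> = X t \<omega> \<and> L t \<omega> = l t \<omega>"
    "\<And>t. 0 \<le> t \<Longrightarrow> X t \<in> borel_measurable M" "\<And>t. 0 \<le> t \<Longrightarrow> l t \<in> borel_measurable M"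
    "\<And>\<omega>. continuous_on {0..} (\<lambda>t. X t \<omega>)" "\<And>\<omega> i. regular_path (\<lambda>t. l t \<omega> $ i)"
    "\<And>\<omega> t i. 0 \<le> t \<Longrightarrow> 0 \<le> X t \<omega> $ i" "\<And>\<omega> i. AE t in stieltjes (\<lambda>t. l t \<omega> $ i). X t \<omega> $ i = 0"
proof -
  from AE_good_path obtain N where N: "{\<omega> \<in> space M. \<not> good_path \<omega>} \<subseteq> N" "emeasure M N = 0" "N \<in> sets M" by (rule AE_E)
  define ok where "ok = space M - N"
  have ok: "ok \<in> sets M" "\<And>\<omega>. \<omega> \<in> ok \<Longrightarrow> good_path \<omega>" using N by (auto simp: ok_def)
  have AE_ok: "AE \<omega> in M. \<omega> \<in> ok" using N by (intro AE_I[of _ _ N]) (auto simp: ok_def)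
  define X where "X t \<omega> = (if \<omega> \<in> ok then G t \<omega> else 0)" for t \<omega>
  define l where "l t \<omega> = (if \<omega> \<in> ok then L t \<omega> else 0)" for t \<omega>
  have m: "(\<lambda>\<omega>. if \<omega> \<in> ok then f \<omega> else 0) \<in> borel_measurable M" if "f \<in> borel_measurable M" for f :: "'a \<Rightarrow> real ^ 2"
    using that ok(1) by (intro measurable_If_set) auto
  show ?thesis
  proof (rule that[of X l])
    show "AE \<omega> in M. \<forall>t\<ge>0. G t \<omega> = X t \<omega> \<and> L t \<omega> = l t \<omega>"
      using AE_ok by eventually_elim (simp add: X_def l_def)
    show "X t \<in> borel_measurable M" "l t \<in> borel_measurable M" if "0 \<le> t" for t
      unfolding X_def[abs_def] l_def[abs_def] using that by (auto intro!: m)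
    fix \<omega> i
    show "continuous_on {0..} (\<lambda>t. X t \<omega>)"
      using ok(2)[of \<omega>] by (cases "\<omega> \<in> ok") (auto simp: X_def good_path_def)
    show "regular_path (\<lambda>t. l t \<omega> $ i)"
      using ok(2)[of \<omega>] by (cases "\<omega> \<in> ok") (auto simp: l_def good_path_def regular_path_def mono_on_def intro!: continuous_intros)
    show "0 \<le> X t \<omega> $ i" if "0 \<le> t" for t
      using ok(2)[of \<omega>] that by (cases "\<omega> \<in> ok") (auto simp: X_def good_path_def)
    show "AE t in stieltjes (\<lambda>t. l t \<omega> $ i). X t \<omega> $ i = 0"
    proof (cases "\<omega> \<in> ok")
      case True
      then have 1: "AE t in stieltjes (\<lambda>t. L t \<omega> $ i). G t \<omega> $ i = 0" using ok(2) by (auto simp: good_path_def)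
      have 2: "stieltjes (\<lambda>t. l t \<omega> $ i) = stieltjes (\<lambda>t. L t \<omega> $ i)" "X t \<omega> = G t \<omega>" for t
        using True by (simp_all add: l_def X_def)
      show ?thesis unfolding 2 by (rule 1)
    qed (simp add: X_def)
  qed
qed

text \<open>Here \<open>A\<close> is the part of \<open>Z\<close> driven by the local times. Without it the increment of \<open>Z\<close> over \<open>[a, b]\<close> is
  \<open>\<i> D + q\<close> with \<open>D\<close> Gaussian of variance \<open>2 q\<close> and independent of the past, because the kernel
  vanishes on the curve; so \<open>exp (\<i> D + q)\<close> has mean one, and stationarity compares times \<open>a\<close> and \<open>b\<close>.\<close>

lemma exponential_increment:
  fixes s :: complex and Z A :: "real \<Rightarrow> 'a \<Rightarrow> complex"
  defines "x \<equiv> 2 * s * (s + of_real \<mu>\<^sub>2)" and "y \<equiv> 2 * s * (s - of_real \<mu>\<^sub>1)"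
  assumes s: "Re s = 0" and mu: "\<mu>\<^sub>1 + \<mu>\<^sub>2 = 1" and ab: "0 \<le> a" "a \<le> b"
    and Z: "\<And>t \<omega>. Z t \<omega> = x * of_real (G t \<omega> $ 1) + y * of_real (G t \<omega> $ 2)"
    and A: "\<And>t \<omega>. A t \<omega> = (x + of_real r\<^sub>1 * y) * of_real (L t \<omega> $ 1) + (of_real r\<^sub>2 * x + y) * of_real (L t \<omega> $ 2)"
  shows "AE \<omega> in M. norm (exp (Z b \<omega>)) \<le> 1 \<and> norm (exp (Z b \<omega> - (A b \<omega> - A a \<omega>))) \<le> exp (2 * (Im s)\<^sup>2 * (b - a))"
    and "integrable M (\<lambda>\<omega>. exp (Z b \<omega>) - exp (Z b \<omega> - (A b \<omega> - A a \<omega>)))"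
    and "(\<integral>\<omega>. exp (Z b \<omega>) - exp (Z b \<omega> - (A b \<omega> - A a \<omega>)) \<partial>M) = 0"
proof -
  define \<tau> where "\<tau> = Im s"
  have s: "s = \<i> * of_real \<tau>" using s by (simp add: complex_eq_iff \<tau>_def)
  have mu2: "\<mu>\<^sub>2 = 1 - \<mu>\<^sub>1" using mu by simp
  define \<theta> :: "real ^ 2" where "\<theta> = vector [2 * \<tau>, 0]"
  have th: "\<theta> \<bullet> v = 2 * \<tau> * v $ 1" for v :: "real ^ 2" by (simp add: \<theta>_def inner_vec_def UNIV_2)
  define D where "D \<omega> = \<theta> \<bullet> (W b \<omega> - W a \<omega>)" for \<omega>
  \<comment> \<open>Half the variance of \<open>D\<close>, and also the drift of the exponent, because the kernel vanishes.\<close>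
  define q where "q = 2 * \<tau>\<^sup>2 * (b - a)"
  have b: "0 \<le> b" using ab by simp
  note [measurable] = G_measurable[OF ab(1)] G_measurable[OF b] L_measurable[OF ab(1)] L_measurable[OF b] W_measurable[OF ab(1)] W_measurable[OF b]
  have Re_xy: "Re x = - 2 * \<tau>\<^sup>2" "Re y = - 2 * \<tau>\<^sup>2" by (simp_all add: x_def y_def s power2_eq_square)
  have xy: "x - y = 2 * \<i> * of_real \<tau>" "of_real \<mu>\<^sub>1 * x + of_real \<mu>\<^sub>2 * y = of_real (- 2 * \<tau>\<^sup>2)"
    by (simp_all add: x_def y_def s mu2 algebra_simps power2_eq_square)
  have Zb: "norm (exp (Z t \<omega>)) \<le> 1" if "good_path \<omega>" "0 \<le> t" for t \<omega>
  proof -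
    have "0 \<le> G t \<omega> $ 1" "0 \<le> G t \<omega> $ 2" using that unfolding good_path_def by blast+
    then have 0: "0 \<le> 2 * \<tau>\<^sup>2 * (G t \<omega> $ 1 + G t \<omega> $ 2)" by (intro mult_nonneg_nonneg add_nonneg_nonneg) simp_all
    have "Re (Z t \<omega>) = Re x * G t \<omega> $ 1 + Re y * G t \<omega> $ 2" unfolding Z by simp
    also have "\<dots> = - (2 * \<tau>\<^sup>2 * (G t \<omega> $ 1 + G t \<omega> $ 2))" unfolding Re_xy by (simp add: algebra_simps)
    also have "\<dots> \<le> 0" using 0 by linarith
    finally show ?thesis unfolding norm_exp_eq_Re by simp
  qed
  have key: "AE \<omega> in M. good_path \<omega> \<and> exp (Z b \<omega> - (A b \<omega> - A a \<omega>)) = exp (Z a \<omega>) * (exp (\<i> * of_real (D \<omega>)) * of_real (exp q))"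
    using AE_good_path AE_increment_opposite[OF ab]
  proof eventually_elim
    fix \<omega> assume g: "good_path \<omega>" and W: "W b \<omega> $ 2 - W a \<omega> $ 2 = - (W b \<omega> $ 1 - W a \<omega> $ 1)"
    have e: "G t \<omega> $ 1 = G 0 \<omega> $ 1 - \<mu>\<^sub>1 * t + W t \<omega> $ 1 + L t \<omega> $ 1 + r\<^sub>2 * L t \<omega> $ 2"
      "G t \<omega> $ 2 = G 0 \<omega> $ 2 - \<mu>\<^sub>2 * t + W t \<omega> $ 2 + r\<^sub>1 * L t \<omega> $ 1 + L t \<omega> $ 2" if "0 \<le> t" for t
      using g that unfolding good_path_def by blast+
    define w where "w = W b \<omega> $ 1 - W a \<omega> $ 1"
    have 1: "G b \<omega> $ 1 - G a \<omega> $ 1 = - \<mu>\<^sub>1 * (b - a) + w + (L b \<omega> $ 1 - L a \<omega> $ 1) + r\<^sub>2 * (L b \<omega> $ 2 - L a \<omega> $ 2)"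
      unfolding e(1)[OF b] e(1)[OF ab(1)] w_def by (simp add: algebra_simps)
    have 2: "G b \<omega> $ 2 - G a \<omega> $ 2 = - \<mu>\<^sub>2 * (b - a) - w + r\<^sub>1 * (L b \<omega> $ 1 - L a \<omega> $ 1) + (L b \<omega> $ 2 - L a \<omega> $ 2)"
      unfolding e(2)[OF b] e(2)[OF ab(1)] w_def using W by (simp add: algebra_simps)
    have "Z b \<omega> - Z a \<omega> = x * of_real (G b \<omega> $ 1 - G a \<omega> $ 1) + y * of_real (G b \<omega> $ 2 - G a \<omega> $ 2)"
      by (simp add: Z algebra_simps)
    also have "\<dots> = (A b \<omega> - A a \<omega>) + (x - y) * of_real w - (of_real \<mu>\<^sub>1 * x + of_real \<mu>\<^sub>2 * y) * of_real (b - a)"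
      unfolding 1 2 A by (simp add: algebra_simps)
    also have "\<dots> = (A b \<omega> - A a \<omega>) + \<i> * of_real (D \<omega>) + of_real q"
      unfolding xy by (simp add: D_def th w_def q_def algebra_simps)
    finally have "Z b \<omega> - (A b \<omega> - A a \<omega>) = Z a \<omega> + (\<i> * of_real (D \<omega>) + of_real q)" by (simp add: algebra_simps)
    then show "good_path \<omega> \<and> exp (Z b \<omega> - (A b \<omega> - A a \<omega>)) = exp (Z a \<omega>) * (exp (\<i> * of_real (D \<omega>)) * of_real (exp q))"
      using g by (simp add: exp_add exp_of_real)
  qed
  show bd: "AE \<omega> in M. norm (exp (Z b \<omega>)) \<le> 1 \<and> norm (exp (Z b \<omega> - (A b \<omega> - A a \<omega>))) \<le> exp (2 * (Im s)\<^sup>2 * (b - a))"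
    using key
  proof eventually_elim
    fix \<omega> assume k: "good_path \<omega> \<and> exp (Z b \<omega> - (A b \<omega> - A a \<omega>)) = exp (Z a \<omega>) * (exp (\<i> * of_real (D \<omega>)) * of_real (exp q))"
    then have "norm (exp (Z b \<omega> - (A b \<omega> - A a \<omega>))) = norm (exp (Z a \<omega>)) * exp q"
      by (simp only: norm_mult) simp
    also have "\<dots> \<le> 1 * exp q" using Zb[of \<omega> a] k ab by (intro mult_right_mono) auto
    finally show "norm (exp (Z b \<omega>)) \<le> 1 \<and> norm (exp (Z b \<omega> - (A b \<omega> - A a \<omega>))) \<le> exp (2 * (Im s)\<^sup>2 * (b - a))"
      using Zb[of \<omega> b] k b by (simp add: q_def \<tau>_def)
  qed
  have iZ: "integrable M (\<lambda>\<omega>. exp (Z t \<omega>))" if t: "0 \<le> t" for t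
  proof (rule integrable_const_bound[where B=1])
    have [measurable]: "G t \<in> borel_measurable M" using t by simp
    show "(\<lambda>\<omega>. exp (Z t \<omega>)) \<in> borel_measurable M" unfolding Z by measurable
    show "AE \<omega> in M. norm (exp (Z t \<omega>)) \<le> 1" using AE_good_path by eventually_elim (rule Zb[OF _ t])
  qed
  have EZ: "(\<integral>\<omega>. exp (Z a \<omega>) \<partial>M) = (\<integral>\<omega>. exp (Z b \<omega>) \<partial>M)"
  proof -
    define f where "f v = exp (x * of_real (v $ 1) + y * of_real (v $ 2))" for v :: "real ^ 2"
    have [measurable]: "f \<in> borel_measurable borel" unfolding f_def by measurable
    have "(\<integral>\<omega>. exp (Z t \<omega>) \<partial>M) = (\<integral>v. f v \<partial>distr M borel (G t))" if "0 \<le> t" for t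
      using that by (subst integral_distr) (auto simp: Z f_def)
    then show ?thesis using ab b G_distr[OF ab(1) b] by simp
  qed
  define V where "V \<omega> = exp (\<i> * of_real (D \<omega>)) * of_real (exp q)" for \<omega>
  have Dm [measurable]: "D \<in> borel_measurable M" unfolding D_def[abs_def] by measurable
  have EV: "(\<integral>\<omega>. V \<omega> \<partial>M) = 1"
  proof -
    have "(\<integral>\<omega>. exp (\<i> * of_real (D \<omega>)) \<partial>M) = of_real (exp (- ((b - a) * (\<theta> $ 1 - \<theta> $ 2)\<^sup>2) / 2))"
      using increment_distr[OF ab, of \<theta>] ab by (intro integral_iexp_centered_normal Dm) (simp_all add: D_def[abs_def])
    also have "- ((b - a) * (\<theta> $ 1 - \<theta> $ 2)\<^sup>2) / 2 = - q"
      by (simp add: \<theta>_def q_def power2_eq_square)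
    finally have "(\<integral>\<omega>. V \<omega> \<partial>M) = of_real (exp (- q)) * of_real (exp q)" unfolding V_def by simp
    also have "\<dots> = of_real (exp (- q) * exp q)" by (rule of_real_mult[symmetric])
    also have "exp (- q) * exp q = 1" by (simp add: exp_minus)
    finally show ?thesis by simp
  qed
  have iV: "integrable M V"
    by (rule integrable_const_bound[where B="exp q"]) (auto simp: V_def[abs_def] norm_mult)
  have "(\<integral>\<omega>. exp (Z a \<omega>) * V \<omega> \<partial>M) = (\<integral>\<omega>. exp (Z a \<omega>) \<partial>M) * (\<integral>\<omega>. V \<omega> \<partial>M)"
  proof (rule expectation_product_indep_set[OF increment_indep[OF ab] subalgebra_F _ iZ[OF ab(1)] _ _ iV])
    have [measurable]: "G a \<in> borel_measurable (F a)" by (rule G_adapted[OF ab(1)])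
    show "(\<lambda>\<omega>. exp (Z a \<omega>)) \<in> borel_measurable (F a)" unfolding Z by measurable
    show "(\<lambda>d. exp (\<i> * of_real (\<theta> \<bullet> d)) * of_real (exp q)) \<in> borel_measurable borel" by measurable
    show "V = (\<lambda>\<omega>. exp (\<i> * of_real (\<theta> \<bullet> (W b \<omega> - W a \<omega>))) * of_real (exp q))" by (simp add: V_def[abs_def] D_def)
  qed
  moreover have "(\<integral>\<omega>. exp (Z b \<omega> - (A b \<omega> - A a \<omega>)) \<partial>M) = (\<integral>\<omega>. exp (Z a \<omega>) * V \<omega> \<partial>M)"
    by (rule integral_cong_AE) (use key in \<open>auto simp: Z A V_def elim!: eventually_mono\<close>)
  moreover have i2: "integrable M (\<lambda>\<omega>. exp (Z b \<omega> - (A b \<omega> - A a \<omega>)))"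
  proof (rule integrable_const_bound[where B="exp (2 * (Im s)\<^sup>2 * (b - a))"])
    show "(\<lambda>\<omega>. exp (Z b \<omega> - (A b \<omega> - A a \<omega>))) \<in> borel_measurable M" unfolding Z A by measurable
  qed (use bd in \<open>auto elim!: eventually_mono\<close>)
  ultimately show "(\<integral>\<omega>. exp (Z b \<omega>) - exp (Z b \<omega> - (A b \<omega> - A a \<omega>)) \<partial>M) = 0"
    using EV EZ iZ[OF b] by simp
  show "integrable M (\<lambda>\<omega>. exp (Z b \<omega>) - exp (Z b \<omega> - (A b \<omega> - A a \<omega>)))"
    using iZ[OF b] i2 by simp
qed

end

definition expm1_quotient :: "complex \<Rightarrow> complex" where
  "expm1_quotient z = (if z = 0 then 1 else (1 - exp (- z)) / z)"

lemma expm1_quotient_mult: "expm1_quotient z * z = 1 - exp (- z)"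
  by (simp add: expm1_quotient_def)

lemma isCont_expm1_quotient: "isCont expm1_quotient 0"
proof -
  have "((\<lambda>z. (exp (- z) - 1) / (- z)) \<longlongrightarrow> (1::complex)) (at 0)"
  proof (rule tendsto_compose_at[OF _ lim_exp_minus_1, unfolded o_def])
    show "((\<lambda>z::complex. - z) \<longlongrightarrow> 0) (at 0)" by (auto intro!: tendsto_eq_intros)
  qed (auto simp: eventually_at_filter)
  moreover have "eventually (\<lambda>z. (exp (- z) - 1) / (- z) = expm1_quotient z) (at (0::complex))"
    unfolding eventually_at_filter by (rule always_eventually) (auto simp: expm1_quotient_def field_simps)
  ultimately have "(expm1_quotient \<longlongrightarrow> 1) (at 0)" by (rule Lim_transform_eventually)
  then show ?thesis by (simp add: isCont_def expm1_quotient_def)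
qed

lemma norm_expm1_quotient_le:
  assumes "norm z \<le> 1"
  shows "norm (expm1_quotient z) \<le> exp 1"
proof (cases "z = 0")
  case False
  have "norm (exp (- z) - exp 0) \<le> exp 1 * norm ((- z) - 0)"
  proof (rule field_differentiable_bound[where S="{w. Re w \<le> 1}" and f'=exp])
    show "convex {w. Re w \<le> 1}" using convex_halfspace_Re_le by blast
    show "- z \<in> {w. Re w \<le> 1}" using assms abs_Re_le_cmod[of z] by auto
  qed (auto intro!: derivative_eq_intros)
  then have "norm (1 - exp (- z)) \<le> exp 1 * norm z" by (simp add: norm_minus_commute)
  then show ?thesis using False by (simp add: expm1_quotient_def norm_divide pos_divide_le_eq)
qed (simp add: expm1_quotient_def)

text \<open>For large \<open>z\<close> the quotient may be huge, but its product with \<open>exp w\<close> is a difference of two bounded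
  exponentials divided by \<open>z\<close>.\<close>

lemma norm_exp_mult_expm1_quotient_le:
  assumes "norm (exp w) \<le> 1" "norm (exp (w - z)) \<le> B"
  shows "norm (exp w * expm1_quotient z) \<le> exp 1 + 1 + B"
proof (cases "norm z \<le> 1")
  case True
  have "norm (exp w * expm1_quotient z) \<le> 1 * exp 1"
    unfolding norm_mult using assms norm_expm1_quotient_le[OF True] by (intro mult_mono) auto
  also have "\<dots> \<le> exp 1 + 1 + B" using assms(2) norm_ge_zero[of "exp (w - z)"] by linarith
  finally show ?thesis .
next
  case False
  then have z: "z \<noteq> 0" "1 \<le> norm z" by auto
  have "exp w * expm1_quotient z = (exp w - exp (w - z)) / z"
    using z by (simp add: expm1_quotient_def exp_diff exp_minus field_simps)
  then have "norm (exp w * expm1_quotient z) = norm (exp w - exp (w - z)) / norm z" by (simp add: norm_divide)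
  also have "\<dots> \<le> norm (exp w - exp (w - z)) / 1" using z by (intro divide_left_mono) auto
  also have "\<dots> \<le> 1 + B" using norm_triangle_ineq4[of "exp w" "exp (w - z)"] assms by (simp del: norm_exp_eq_Re)
  also have "\<dots> \<le> exp 1 + 1 + B" by simp
  finally show ?thesis .
qed

context stationary_reflected_BM
begin

text \<open>Summing the mean-zero increments of \<open>exponential_increment\<close> over a grid gives Riemann sums against the
  local times, dominated by a multiple of their values at time \<open>2\<close>. In the limit \<open>x G\<^sub>1 + y G\<^sub>2\<close> may be
  replaced by \<open>y G\<^sub>2\<close> on the support of \<open>dL\<^sub>1\<close> and by \<open>x G\<^sub>1\<close> on that of \<open>dL\<^sub>2\<close>.\<close>

theorem stationary_curve_equation:
  assumes mu: "\<mu>\<^sub>1 + \<mu>\<^sub>2 = 1"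
  obtains m\<^sub>1 m\<^sub>2 where "half_line_measure m\<^sub>1" "half_line_measure m\<^sub>2"
    "lateral_measure_1 M G L = restrict_space m\<^sub>1 {0<..}"
    "\<And>s x y. Re s = 0 \<Longrightarrow> x = 2 * s * (s + of_real \<mu>\<^sub>2) \<Longrightarrow> y = 2 * s * (s - of_real \<mu>\<^sub>1) \<Longrightarrow>
      (x + of_real r\<^sub>1 * y) * laplace m\<^sub>1 y + (of_real r\<^sub>2 * x + y) * laplace m\<^sub>2 x = 0"
proof -
  obtain X l :: "real \<Rightarrow> 'a \<Rightarrow> real ^ 2" where
    eq: "AE \<omega> in M. \<forall>t\<ge>0. G t \<omega> = X t \<omega> \<and> L t \<omega> = l t \<omega>"
    and Xm: "\<And>t. 0 \<le> t \<Longrightarrow> X t \<in> borel_measurable M" and lm: "\<And>t. 0 \<le> t \<Longrightarrow> l t \<in> borel_measurable M"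
    and Xc: "\<And>\<omega>. continuous_on {0..} (\<lambda>t. X t \<omega>)" and lr: "\<And>\<omega> i. regular_path (\<lambda>t. l t \<omega> $ i)"
    and Xpos: "\<And>\<omega> t i. 0 \<le> t \<Longrightarrow> 0 \<le> X t \<omega> $ i"
    and supp: "\<And>\<omega> i. AE t in stieltjes (\<lambda>t. l t \<omega> $ i). X t \<omega> $ i = 0"
    by (rule regularization, rule that, assumption+)
  have Xci: "continuous_on {0..} (\<lambda>t. X t \<omega> $ i)" for \<omega> i by (intro continuous_intros Xc)
  have li: "integrable M (\<lambda>\<omega>. l 2 \<omega> $ i)" for i
  proof (rule integrable_cong_AE_imp[OF L_integrable[of i]])
    show "(\<lambda>\<omega>. l 2 \<omega> $ i) \<in> borel_measurable M" using lm[of 2] by measurable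
    show "AE \<omega> in M. L 2 \<omega> $ i = l 2 \<omega> $ i" using eq by (auto elim!: eventually_mono)
  qed
  have BP: "boundary_process M (\<lambda>t \<omega>. X t \<omega> $ i) (\<lambda>t \<omega>. l t \<omega> $ j)" for i j
    by (intro boundary_process.intro boundary_process_axioms.intro prob_space_axioms borel_measurable_component Xm lm Xci lr li)
  interpret P: boundary_process M "\<lambda>t \<omega>. X t \<omega> $ 2" "\<lambda>t \<omega>. l t \<omega> $ 1" by (rule BP)
  interpret Q: boundary_process M "\<lambda>t \<omega>. X t \<omega> $ 1" "\<lambda>t \<omega>. l t \<omega> $ 2" by (rule BP)
  have l2pos: "0 \<le> l 2 \<omega> $ i" for \<omega> i
    using regular_path_mono[OF lr, of 0 2 \<omega> i] lr[of \<omega> i] by (simp add: regular_path_def)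
  show ?thesis
  proof (rule that)
    show "half_line_measure P.mixture" by (rule P.half_line_mixture) (rule Xpos)
    show "half_line_measure Q.mixture" by (rule Q.half_line_mixture) (rule Xpos)
    show "lateral_measure_1 M G L = restrict_space P.mixture {0<..}"
      unfolding lateral_measure_1_def by (rule P.restrict_mixture) (use eq in \<open>auto elim!: eventually_mono\<close>)
    fix s x y :: complex
    assume s: "Re s = 0" and x: "x = 2 * s * (s + of_real \<mu>\<^sub>2)" and y: "y = 2 * s * (s - of_real \<mu>\<^sub>1)"
    have Re_xy: "Re x \<le> 0" "Re y \<le> 0" using s by (simp_all add: x y)
    define c1 where "c1 = x + of_real r\<^sub>1 * y"
    define c2 where "c2 = of_real r\<^sub>2 * x + y"
    define Z where "Z t \<omega> = x * of_real (X t \<omega> $ 1) + y * of_real (X t \<omega> $ 2)" for t \<omega>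
    define A where "A t \<omega> = c1 * of_real (l t \<omega> $ 1) + c2 * of_real (l t \<omega> $ 2)" for t \<omega>
    define B where "B = exp (2 * (Im s)\<^sup>2 * 2)"
    \<comment> \<open>Bounds the coefficients of the Riemann sums, whatever the size of the increments of \<open>A\<close>.\<close>
    define C where "C = exp 1 + 1 + B"
    define c where "c \<omega> n k = exp (Z (grid n (Suc k)) \<omega>) * expm1_quotient (A (grid n (Suc k)) \<omega> - A (grid n k) \<omega>)" for \<omega> n k
    define S where "S n \<omega> = (\<Sum>k<Suc n. exp (Z (grid n (Suc k)) \<omega>) - exp (Z (grid n (Suc k)) \<omega> - (A (grid n (Suc k)) \<omega> - A (grid n k) \<omega>)))" for n \<omega>
    have step: "(AE \<omega> in M. norm (exp (Z b \<omega>)) \<le> 1 \<and> norm (exp (Z b \<omega> - (A b \<omega> - A a \<omega>))) \<le> exp (2 * (Im s)\<^sup>2 * (b - a)))"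
      "integrable M (\<lambda>\<omega>. exp (Z b \<omega>) - exp (Z b \<omega> - (A b \<omega> - A a \<omega>)))"
      "(\<integral>\<omega>. exp (Z b \<omega>) - exp (Z b \<omega> - (A b \<omega> - A a \<omega>)) \<partial>M) = 0" if ab: "0 \<le> a" "a \<le> b" for a b
    proof -
      have b: "0 \<le> b" using ab by simp
      define Z' where "Z' t \<omega> = x * of_real (G t \<omega> $ 1) + y * of_real (G t \<omega> $ 2)" for t \<omega>
      define A' where "A' t \<omega> = c1 * of_real (L t \<omega> $ 1) + c2 * of_real (L t \<omega> $ 2)" for t \<omega>
      note inc = exponential_increment[OF s mu ab, of Z' A', folded x y, OF Z'_def A'_def[unfolded c1_def c2_def]]
      have e: "AE \<omega> in M. Z' b \<omega> = Z b \<omega> \<and> A' b \<omega> = A b \<omega> \<and> A' a \<omega> = A a \<omega>"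
        using eq by eventually_elim (use ab b in \<open>simp add: Z'_def Z_def A'_def A_def\<close>)
      show "AE \<omega> in M. norm (exp (Z b \<omega>)) \<le> 1 \<and> norm (exp (Z b \<omega> - (A b \<omega> - A a \<omega>))) \<le> exp (2 * (Im s)\<^sup>2 * (b - a))"
        using inc(1) e by eventually_elim simp
      have m: "(\<lambda>\<omega>. exp (Z b \<omega>) - exp (Z b \<omega> - (A b \<omega> - A a \<omega>))) \<in> borel_measurable M"
        unfolding Z_def A_def using Xm[OF b] lm[OF b] lm[OF ab(1)] by measurable
      have ae: "AE \<omega> in M. exp (Z b \<omega>) - exp (Z b \<omega> - (A b \<omega> - A a \<omega>)) = exp (Z' b \<omega>) - exp (Z' b \<omega> - (A' b \<omega> - A' a \<omega>))"
        using e by eventually_elim simp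
      show "integrable M (\<lambda>\<omega>. exp (Z b \<omega>) - exp (Z b \<omega> - (A b \<omega> - A a \<omega>)))"
        by (rule integrable_cong_AE_imp[OF inc(2) m]) (use ae in \<open>auto elim!: eventually_mono\<close>)
      show "(\<integral>\<omega>. exp (Z b \<omega>) - exp (Z b \<omega> - (A b \<omega> - A a \<omega>)) \<partial>M) = 0"
        using integral_cong_AE[OF m borel_measurable_integrable[OF inc(2)] ae] inc(3) by simp
    qed
    have C0: "0 \<le> C" by (simp add: C_def B_def add_nonneg_nonneg)
    have gl: "grid n k \<le> grid n (Suc k)" for n k by (rule grid_mono) simp
    have bound: "AE \<omega> in M. \<forall>n k. k < Suc n \<longrightarrow> norm (c \<omega> n k) \<le> C"
    proof (intro AE_all_countable[THEN iffD2] allI)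
      fix n k
      show "AE \<omega> in M. k < Suc n \<longrightarrow> norm (c \<omega> n k) \<le> C"
      proof (cases "k < Suc n")
        case True
        have "grid n (Suc k) \<le> 2" using grid_mono[of "Suc k" "Suc n" n] True by (simp add: grid_end)
        then have "grid n (Suc k) - grid n k \<le> 2" using grid_nonneg[of n k] by linarith
        then have "2 * (Im s)\<^sup>2 * (grid n (Suc k) - grid n k) \<le> 2 * (Im s)\<^sup>2 * 2" by (intro mult_left_mono) auto
        then have *: "exp (2 * (Im s)\<^sup>2 * (grid n (Suc k) - grid n k)) \<le> B" by (simp add: B_def)
        show ?thesis using step(1)[OF grid_nonneg gl, of n k]
        proof eventually_elim
          case (elim \<omega>)
          then have "norm (exp (Z (grid n (Suc k)) \<omega> - (A (grid n (Suc k)) \<omega> - A (grid n k) \<omega>))) \<le> B" using * by linarith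
          then show ?case unfolding c_def C_def using elim norm_exp_mult_expm1_quotient_le by blast
        qed
      qed simp
    qed
    \<comment> \<open>Each summand factors through the increment of \<open>A\<close>, which turns the sum into two Riemann sums.\<close>
    have Sc: "S n \<omega> = c1 * (\<Sum>k<Suc n. c \<omega> n k * of_real (l (grid n (Suc k)) \<omega> $ 1 - l (grid n k) \<omega> $ 1))
       + c2 * (\<Sum>k<Suc n. c \<omega> n k * of_real (l (grid n (Suc k)) \<omega> $ 2 - l (grid n k) \<omega> $ 2))" for n \<omega>
    proof -
      have e: "exp w - exp (w - z) = exp w * expm1_quotient z * z" for w z
        unfolding mult.assoc expm1_quotient_mult by (simp add: exp_diff exp_minus field_simps)
      have dA: "A b \<omega> - A a \<omega> = c1 * of_real (l b \<omega> $ 1 - l a \<omega> $ 1) + c2 * of_real (l b \<omega> $ 2 - l a \<omega> $ 2)" for a b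
        unfolding A_def by (simp add: algebra_simps)
      from e have "S n \<omega> = (\<Sum>k<Suc n. c \<omega> n k * (A (grid n (Suc k)) \<omega> - A (grid n k) \<omega>))"
        unfolding S_def c_def by (simp only:)
      also have "\<dots> = (\<Sum>k<Suc n. c1 * (c \<omega> n k * of_real (l (grid n (Suc k)) \<omega> $ 1 - l (grid n k) \<omega> $ 1))
          + c2 * (c \<omega> n k * of_real (l (grid n (Suc k)) \<omega> $ 2 - l (grid n k) \<omega> $ 2)))"
      proof (rule sum.cong)
        fix k
        have ring: "u * (c1 * p + c2 * q) = c1 * (u * p) + c2 * (u * q)" for u p q :: complex
          by (simp add: algebra_simps)
        show "c \<omega> n k * (A (grid n (Suc k)) \<omega> - A (grid n k) \<omega>) = c1 * (c \<omega> n k * of_real (l (grid n (Suc k)) \<omega> $ 1 - l (grid n k) \<omega> $ 1))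
          + c2 * (c \<omega> n k * of_real (l (grid n (Suc k)) \<omega> $ 2 - l (grid n k) \<omega> $ 2))"
          unfolding dA by (rule ring)
      qed simp
      finally show ?thesis by (simp only: sum.distrib sum_distrib_left)
    qed
    define U1 where "U1 \<omega> = (\<integral>t. exp (y * of_real (X (max 0 t) \<omega> $ 2)) \<partial>clock (\<lambda>t. l t \<omega> $ 1))" for \<omega>
    define U2 where "U2 \<omega> = (\<integral>t. exp (x * of_real (X (max 0 t) \<omega> $ 1)) \<partial>clock (\<lambda>t. l t \<omega> $ 2))" for \<omega>
    have gm: "(\<lambda>t. exp (Z (max 0 t) \<omega>)) \<in> borel_measurable borel" for \<omega>
    proof -
      have "continuous_on UNIV (\<lambda>t. X (max 0 t) \<omega>)"
        by (rule continuous_on_compose2[OF Xc[of \<omega>]]) (auto intro!: continuous_intros)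
      then have "continuous_on UNIV (\<lambda>t. exp (Z (max 0 t) \<omega>))" unfolding Z_def by (intro continuous_intros)
      then show ?thesis by (rule borel_measurable_continuous_onI)
    qed
    have U: "U1 \<omega> = (\<integral>t. exp (Z (max 0 t) \<omega>) \<partial>clock (\<lambda>t. l t \<omega> $ 1))" "U2 \<omega> = (\<integral>t. exp (Z (max 0 t) \<omega>) \<partial>clock (\<lambda>t. l t \<omega> $ 2))" for \<omega>
    proof -
      show "U1 \<omega> = (\<integral>t. exp (Z (max 0 t) \<omega>) \<partial>clock (\<lambda>t. l t \<omega> $ 1))"
        unfolding U1_def
      proof (rule integral_cong_AE)
        show "AE t in clock (\<lambda>t. l t \<omega> $ 1). exp (y * of_real (X (max 0 t) \<omega> $ 2)) = exp (Z (max 0 t) \<omega>)"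
          using AE_clock_of_stieltjes[OF lr supp[of \<omega> 1]] AE_clock[OF lr[of \<omega> 1]]
          by eventually_elim (simp add: Z_def max_absorb2)
        show "(\<lambda>t. exp (y * of_real (X (max 0 t) \<omega> $ 2))) \<in> borel_measurable (clock (\<lambda>t. l t \<omega> $ 1))"
          using P.path_measurable[of \<omega>] by measurable
      qed (use gm in simp)
      show "U2 \<omega> = (\<integral>t. exp (Z (max 0 t) \<omega>) \<partial>clock (\<lambda>t. l t \<omega> $ 2))"
        unfolding U2_def
      proof (rule integral_cong_AE)
        show "AE t in clock (\<lambda>t. l t \<omega> $ 2). exp (x * of_real (X (max 0 t) \<omega> $ 1)) = exp (Z (max 0 t) \<omega>)"
          using AE_clock_of_stieltjes[OF lr supp[of \<omega> 2]] AE_clock[OF lr[of \<omega> 2]]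
          by eventually_elim (simp add: Z_def max_absorb2)
        show "(\<lambda>t. exp (x * of_real (X (max 0 t) \<omega> $ 1))) \<in> borel_measurable (clock (\<lambda>t. l t \<omega> $ 2))"
          using Q.path_measurable[of \<omega>] by measurable
      qed (use gm in simp)
    qed
    have clim: "(\<lambda>n. c \<omega> n (cell n t)) \<longlonglongrightarrow> exp (Z (max 0 t) \<omega>)" if t: "0 < t" "t \<le> 2" for t \<omega>
    proof -
      have Xl: "(\<lambda>n. X (grid n (Suc (cell n t))) \<omega>) \<longlonglongrightarrow> X t \<omega>"
        by (rule continuous_on_grid_tendsto(1)[OF Xc[of \<omega>] t])
      have lc: "continuous_on {0..} (\<lambda>t. l t \<omega> $ i)" for i using lr[of \<omega> i] by (simp add: regular_path_def)
      have "(\<lambda>n. A (grid n (Suc (cell n t))) \<omega> - A (grid n (cell n t)) \<omega>) \<longlonglongrightarrow> A t \<omega> - A t \<omega>"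
        unfolding A_def by (intro tendsto_intros continuous_on_grid_tendsto[OF lc t])
      then have "(\<lambda>n. A (grid n (Suc (cell n t))) \<omega> - A (grid n (cell n t)) \<omega>) \<longlonglongrightarrow> 0" by simp
      then have "(\<lambda>n. expm1_quotient (A (grid n (Suc (cell n t))) \<omega> - A (grid n (cell n t)) \<omega>)) \<longlonglongrightarrow> expm1_quotient 0"
        by (rule isCont_tendsto_compose[OF isCont_expm1_quotient])
      moreover have "(\<lambda>n. exp (Z (grid n (Suc (cell n t))) \<omega>)) \<longlonglongrightarrow> exp (Z t \<omega>)"
        unfolding Z_def by (intro tendsto_intros Xl)
      ultimately have "(\<lambda>n. c \<omega> n (cell n t)) \<longlonglongrightarrow> exp (Z t \<omega>) * expm1_quotient 0"
        unfolding c_def by (intro tendsto_mult)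
      then show ?thesis using t by (simp add: expm1_quotient_def max_absorb2)
    qed
    have "(\<lambda>n. \<integral>\<omega>. S n \<omega> \<partial>M) \<longlonglongrightarrow> (\<integral>\<omega>. c1 * U1 \<omega> + c2 * U2 \<omega> \<partial>M)"
    proof (rule integral_dominated_convergence[where w="\<lambda>\<omega>. norm c1 * (C * l 2 \<omega> $ 1) + norm c2 * (C * l 2 \<omega> $ 2)"])
      show "S n \<in> borel_measurable M" for n
        unfolding S_def using step(2)[OF grid_nonneg gl] by (intro borel_measurable_sum borel_measurable_integrable)
      have "integrable M U1" "integrable M U2"
        unfolding U1_def U2_def using P.laplace_mixture(1)[OF Xpos Re_xy(2)] Q.laplace_mixture(1)[OF Xpos Re_xy(1)] by auto
      then show "(\<lambda>\<omega>. c1 * U1 \<omega> + c2 * U2 \<omega>) \<in> borel_measurable M" by (intro borel_measurable_integrable) auto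
      show "integrable M (\<lambda>\<omega>. norm c1 * (C * l 2 \<omega> $ 1) + norm c2 * (C * l 2 \<omega> $ 2))"
        using li by auto
      show "AE \<omega> in M. (\<lambda>n. S n \<omega>) \<longlonglongrightarrow> c1 * U1 \<omega> + c2 * U2 \<omega>"
        using bound
      proof eventually_elim
        fix \<omega> assume b: "\<forall>n k. k < Suc n \<longrightarrow> norm (c \<omega> n k) \<le> C"
        show "(\<lambda>n. S n \<omega>) \<longlonglongrightarrow> c1 * U1 \<omega> + c2 * U2 \<omega>"
          unfolding Sc U
          by (intro tendsto_add tendsto_mult tendsto_const riemann_sums_tendsto[OF lr _ gm clim]) (use b in auto)
      qed
      show "AE \<omega> in M. norm (S n \<omega>) \<le> norm c1 * (C * l 2 \<omega> $ 1) + norm c2 * (C * l 2 \<omega> $ 2)" for n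
        using bound
      proof eventually_elim
        fix \<omega> assume b: "\<forall>n k. k < Suc n \<longrightarrow> norm (c \<omega> n k) \<le> C"
        have *: "norm (\<Sum>k<Suc n. c \<omega> n k * of_real (l (grid n (Suc k)) \<omega> $ i - l (grid n k) \<omega> $ i)) \<le> C * l 2 \<omega> $ i" for i
        proof -
          have "norm (\<Sum>k<Suc n. c \<omega> n k * of_real (l (grid n (Suc k)) \<omega> $ i - l (grid n k) \<omega> $ i))
            \<le> (\<Sum>k<Suc n. C * (l (grid n (Suc k)) \<omega> $ i - l (grid n k) \<omega> $ i))"
          proof (rule sum_norm_le)
            fix k assume k: "k \<in> {..<Suc n}"
            have "0 \<le> l (grid n (Suc k)) \<omega> $ i - l (grid n k) \<omega> $ i"
              using regular_path_mono[OF lr grid_nonneg gl, of n k \<omega> i] by simp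
            then show "norm (c \<omega> n k * of_real (l (grid n (Suc k)) \<omega> $ i - l (grid n k) \<omega> $ i)) \<le> C * (l (grid n (Suc k)) \<omega> $ i - l (grid n k) \<omega> $ i)"
              using b k C0 unfolding norm_mult norm_of_real by (intro mult_mono) auto
          qed
          also have "\<dots> = C * (l 2 \<omega> $ i - l 0 \<omega> $ i)"
            unfolding sum_distrib_left[symmetric] sum_path_increments[of "\<lambda>t. l t \<omega> $ i"] ..
          finally show ?thesis using lr[of \<omega> i] by (simp add: regular_path_def)
        qed
        show "norm (S n \<omega>) \<le> norm c1 * (C * l 2 \<omega> $ 1) + norm c2 * (C * l 2 \<omega> $ 2)"
          unfolding Sc
          by (rule norm_triangle_le) (unfold norm_mult, intro add_mono mult_left_mono *, auto)
      qed
    qed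
    moreover have "(\<integral>\<omega>. S n \<omega> \<partial>M) = 0" for n
      unfolding S_def
      by (subst Bochner_Integration.integral_sum)
        (simp_all only: step(2,3)[OF grid_nonneg gl] sum.neutral_const)
    ultimately have "(\<integral>\<omega>. c1 * U1 \<omega> + c2 * U2 \<omega> \<partial>M) = 0"
      by (simp add: LIMSEQ_const_iff)
    moreover have "(\<integral>\<omega>. c1 * U1 \<omega> + c2 * U2 \<omega> \<partial>M) = c1 * laplace P.mixture y + c2 * laplace Q.mixture x"
    proof -
      have "integrable M U1" "laplace P.mixture y = (\<integral>\<omega>. U1 \<omega> \<partial>M)"
        unfolding U1_def by (rule P.laplace_mixture[OF Xpos Re_xy(2)], assumption)+
      moreover have "integrable M U2" "laplace Q.mixture x = (\<integral>\<omega>. U2 \<omega> \<partial>M)"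
        unfolding U2_def by (rule Q.laplace_mixture[OF Xpos Re_xy(1)], assumption)+
      ultimately show ?thesis by simp
    qed
    ultimately show "(x + of_real r\<^sub>1 * y) * laplace P.mixture y + (of_real r\<^sub>2 * x + y) * laplace Q.mixture x = 0"
      by (simp add: c1_def c2_def)
  qed
qed

end

section \<open>The explicit formulas for the lateral Laplace transform\<close>

text \<open>The products in the statement enumerate one representative of each pair of opposite offsets, in
  different orders and with either sign.\<close>

lemma centred_poly_eqI:
  fixes a :: "int \<Rightarrow> real"
  assumes len: "hi - lo + 1 = int (N div 2)"
    and a: "\<And>j. j < N div 2 \<Longrightarrow> \<bar>a (lo + int j) - \<mu> / 2\<bar> = \<bar>(real N - 1) / 2 - real j\<bar>"
  shows "(\<Prod>k\<in>{lo..hi}. [:- y_par \<mu> (a k), 1:]) = centred_poly \<mu> N"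
  unfolding centred_poly_def
proof (rule prod.reindex_bij_witness[of _ "\<lambda>j. lo + int j" "\<lambda>k. nat (k - lo)"])
  fix k assume k: "k \<in> {lo..hi}"
  define j where "j = nat (k - lo)"
  have j: "k = lo + int j" "j < N div 2" using k len by (auto simp: j_def)
  have "(a k - \<mu> / 2)\<^sup>2 = ((real N - 1) / 2 - real j)\<^sup>2" using a[OF j(2)] j(1) by (simp only: abs_eq_iff') auto
  then have "y_par \<mu> (a k) = y_par \<mu> (\<mu> / 2 + ((real N - 1) / 2 - real j))"
    using y_par_centred[of \<mu> "a k - \<mu> / 2"] y_par_centred[of \<mu> "(real N - 1) / 2 - real j"] by simp
  then show "[:- y_par \<mu> (\<mu> / 2 + ((real N - 1) / 2 - real (nat (k - lo)))), 1:] = [:- y_par \<mu> (a k), 1:]"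
    by (simp add: j_def)
qed (use len in auto)

theorem theorem49:
  fixes r\<^sub>1 r\<^sub>2 \<mu>\<^sub>1 \<mu>\<^sub>2 s\<^sub>1 s\<^sub>2 \<gamma> \<gamma>\<^sub>1 \<gamma>\<^sub>2 :: real
    and M :: "'a measure" and F :: "real \<Rightarrow> 'a measure"
    and W G L :: "real \<Rightarrow> 'a \<Rightarrow> real ^ 2"
    and \<pi> :: "(real ^ 2) measure"
    and \<phi>\<^sub>1 :: "complex \<Rightarrow> complex" and Y :: "real \<Rightarrow> real" and root :: "complex \<Rightarrow> complex"
  assumes "\<mu>\<^sub>1 > 0" and "\<mu>\<^sub>2 > 0" and "\<mu>\<^sub>1 + \<mu>\<^sub>2 = 1"
    and "1 - r\<^sub>1 * r\<^sub>2 > 0 \<or> (r\<^sub>1 > 0 \<and> r\<^sub>2 > 0)"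
    and "\<mu>\<^sub>1 - r\<^sub>2 * \<mu>\<^sub>2 > 0" and "\<mu>\<^sub>2 - r\<^sub>1 * \<mu>\<^sub>1 > 0"
    and "r\<^sub>1 \<noteq> -1" and "r\<^sub>2 \<noteq> -1"
    and "degenerate_reflected_BM r\<^sub>1 r\<^sub>2 \<mu>\<^sub>1 \<mu>\<^sub>2 M F W G L"
    and "invariant_law \<pi> M G"
    and "\<phi>\<^sub>1 = laplace (lateral_measure_1 M G L)"
    and "Y = y_par \<mu>\<^sub>1"
    and "root = (\<lambda>y. csqrt (2 * y + of_real (\<mu>\<^sub>1\<^sup>2)))"
    and "s\<^sub>1 = (r\<^sub>1 * \<mu>\<^sub>1 - \<mu>\<^sub>2) / (1 + r\<^sub>1)"
    and "s\<^sub>2 = (\<mu>\<^sub>1 - r\<^sub>2 * \<mu>\<^sub>2) / (1 + r\<^sub>2)"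
    and "\<gamma> = s\<^sub>2 - s\<^sub>1" and "\<gamma>\<^sub>1 = \<mu>\<^sub>1 - 2 * s\<^sub>1" and "\<gamma>\<^sub>2 = \<mu>\<^sub>2 + 2 * s\<^sub>2"
    and "{\<gamma>\<^sub>1, \<gamma>\<^sub>2} \<subseteq> \<int>" and "\<gamma> \<notin> \<int>"
  shows
    "(\<gamma>\<^sub>1 \<in> {- 2 * real n | n. n \<ge> 1} \<and> \<gamma>\<^sub>2 \<in> {2 * real n | n. n \<ge> 1} \<longrightarrow>
        (\<exists>(c::real) (P::real poly) (Q::real poly).
           P = (\<Prod>k\<in>{0..\<lfloor>\<gamma>\<^sub>2 / 2\<rfloor> - 1}. [:- Y (s\<^sub>2 - of_int k), 1:]) \<and>
           Q = (\<Prod>k\<in>{0..\<lfloor>- \<gamma>\<^sub>1 / 2\<rfloor> - 1}. [:- Y (s\<^sub>1 - of_int k), 1:]) \<and>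
           eq_on_left_half_plane \<phi>\<^sub>1
             (\<lambda>y. of_real c * (cpoly P y * tan (of_real (pi / 2) * root y))
                    / (cpoly Q y * root y))))
     \<and>
     (\<gamma>\<^sub>1 \<in> {2 * real n - 1 | n. n \<ge> 1} \<and> \<gamma>\<^sub>2 \<in> {- 2 * real n + 1 | n. n \<ge> 1} \<longrightarrow>
        (\<exists>(c::real) (P::real poly) (Q::real poly).
           P = (\<Prod>k\<in>{1..\<lfloor>(\<gamma>\<^sub>1 - 1) / 2\<rfloor>}. [:- Y (s\<^sub>1 + of_int k), 1:]) \<and>
           Q = (\<Prod>k\<in>{1..\<lfloor>- (\<gamma>\<^sub>2 + 1) / 2\<rfloor>}. [:- Y (s\<^sub>2 + of_int k), 1:]) \<and>
           eq_on_left_half_plane \<phi>\<^sub>1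
             (\<lambda>y. of_real c * (cpoly P y * tan (of_real (pi / 2) * root y))
                    / (cpoly Q y * root y))))
     \<and>
     (\<gamma>\<^sub>1 \<in> {2 * real n | n. n \<ge> 1} \<and> \<gamma>\<^sub>2 \<in> {- 2 * real n | n. n \<ge> 1} \<longrightarrow>
        (\<exists>(c::real) (P::real poly) (Q::real poly).
           P = (\<Prod>k\<in>{1..\<lfloor>\<gamma>\<^sub>1 / 2\<rfloor> - 1}. [:- Y (s\<^sub>1 + of_int k), 1:]) \<and>
           Q = (\<Prod>k\<in>{1..\<lfloor>- \<gamma>\<^sub>2 / 2\<rfloor>}. [:- Y (s\<^sub>2 + of_int k), 1:]) \<and>
           eq_on_left_half_plane \<phi>\<^sub>1
             (\<lambda>y. of_real c * (cpoly P y * root y)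
                    / (cpoly Q y * tan (of_real (pi / 2) * root y)))))
     \<and>
     (\<gamma>\<^sub>1 \<in> {- 2 * real n + 1 | n. n \<ge> 1} \<and> \<gamma>\<^sub>2 \<in> {2 * real n - 1 | n. n \<ge> 1} \<longrightarrow>
        (\<exists>(c::real) (P::real poly) (Q::real poly).
           P = (\<Prod>k\<in>{0..\<lfloor>(\<gamma>\<^sub>2 - 1) / 2\<rfloor> - 1}. [:- Y (s\<^sub>2 - of_int k), 1:]) \<and>
           Q = (\<Prod>k\<in>{0..\<lfloor>- (\<gamma>\<^sub>1 + 1) / 2\<rfloor>}. [:- Y (s\<^sub>1 - of_int k), 1:]) \<and>
           eq_on_left_half_plane \<phi>\<^sub>1
             (\<lambda>y. of_real c * (cpoly P y * root y)
                    / (cpoly Q y * tan (of_real (pi / 2) * root y)))))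
     \<and>
     (\<gamma>\<^sub>1 \<in> {real n | n. n \<ge> 1} \<and> \<gamma>\<^sub>2 \<in> {real n | n. n \<ge> 1} \<longrightarrow>
        (\<exists>(c::real) (P::real poly).
           P = (\<Prod>k\<in>{1..\<lfloor>(\<gamma>\<^sub>1 - 1) / 2\<rfloor>}. [:- Y (s\<^sub>1 + of_int k), 1:])
               * (\<Prod>k\<in>{0..\<lfloor>\<gamma>\<^sub>2 / 2 - 1\<rfloor>}. [:- Y (s\<^sub>2 - of_int k), 1:]) \<and>
           eq_on_left_half_plane \<phi>\<^sub>1
             (\<lambda>y. of_real c * (cpoly P y * root y) / sin (of_real pi * root y))))"
proof -
  have mu: "\<mu>\<^sub>1 > 0" "\<mu>\<^sub>2 > 0" "\<mu>\<^sub>1 + \<mu>\<^sub>2 = 1" by fact+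
  interpret P: stationary_reflected_BM r\<^sub>1 r\<^sub>2 \<mu>\<^sub>1 \<mu>\<^sub>2 M F W G L \<pi>
    by unfold_locales fact+
  obtain m\<^sub>1 m\<^sub>2 where m: "half_line_measure m\<^sub>1" "half_line_measure m\<^sub>2"
    and lat: "lateral_measure_1 M G L = restrict_space m\<^sub>1 {0<..}"
    and curve: "\<And>s x y. Re s = 0 \<Longrightarrow> x = 2 * s * (s + of_real \<mu>\<^sub>2) \<Longrightarrow> y = 2 * s * (s - of_real \<mu>\<^sub>1) \<Longrightarrow>
      (x + of_real r\<^sub>1 * y) * laplace m\<^sub>1 y + (of_real r\<^sub>2 * x + y) * laplace m\<^sub>2 x = 0"
    by (rule P.stationary_curve_equation[OF mu(3)], rule that, assumption+)
  have k: "1 + r\<^sub>1 \<noteq> 0" "1 + r\<^sub>2 \<noteq> 0" using \<open>r\<^sub>1 \<noteq> -1\<close> \<open>r\<^sub>2 \<noteq> -1\<close> by auto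
  have s1: "(1 + r\<^sub>1) * s\<^sub>1 = r\<^sub>1 * \<mu>\<^sub>1 - \<mu>\<^sub>2" and s2: "(1 + r\<^sub>2) * s\<^sub>2 = \<mu>\<^sub>1 - r\<^sub>2 * \<mu>\<^sub>2"
    using k by (simp_all add: \<open>s\<^sub>1 = _\<close> \<open>s\<^sub>2 = _\<close>)
  obtain n\<^sub>1 n\<^sub>2 :: int where n: "\<gamma>\<^sub>1 = of_int n\<^sub>1" "\<gamma>\<^sub>2 = of_int n\<^sub>2"
    using \<open>{\<gamma>\<^sub>1, \<gamma>\<^sub>2} \<subseteq> \<int>\<close> by (auto elim!: Ints_cases)
  have n': "of_int n\<^sub>1 = \<mu>\<^sub>1 - 2 * s\<^sub>1" "of_int n\<^sub>2 = \<mu>\<^sub>2 + 2 * s\<^sub>2"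
    using n \<open>\<gamma>\<^sub>1 = _ - _\<close> \<open>\<gamma>\<^sub>2 = _ + _\<close> by simp_all
  interpret C: curve_equation \<mu>\<^sub>1 \<mu>\<^sub>2 s\<^sub>1 s\<^sub>2 "1 + r\<^sub>1" "1 + r\<^sub>2" n\<^sub>1 n\<^sub>2 m\<^sub>1 m\<^sub>2
  proof
    show "s\<^sub>1 \<noteq> 0" using s1 \<open>\<mu>\<^sub>2 - r\<^sub>1 * \<mu>\<^sub>1 > 0\<close> by auto
    fix s :: complex assume s: "Re s = 0" "s \<noteq> 0"
    define x where "x = 2 * s * (s + of_real \<mu>\<^sub>2)"
    define y where "y = 2 * s * (s - of_real \<mu>\<^sub>1)"
    have c1: "of_real ((1 + r\<^sub>1) * s\<^sub>1) = (of_real (r\<^sub>1 * \<mu>\<^sub>1 - \<mu>\<^sub>2) :: complex)" and c2: "of_real ((1 + r\<^sub>2) * s\<^sub>2) = (of_real (\<mu>\<^sub>1 - r\<^sub>2 * \<mu>\<^sub>2) :: complex)"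
      by (simp_all only: s1 s2)
    have e1: "x + of_real r\<^sub>1 * y = 2 * s * (of_real (1 + r\<^sub>1) * s - of_real ((1 + r\<^sub>1) * s\<^sub>1))"
      unfolding c1 by (simp add: x_def y_def algebra_simps)
    have e2: "of_real r\<^sub>2 * x + y = 2 * s * (of_real (1 + r\<^sub>2) * s - of_real ((1 + r\<^sub>2) * s\<^sub>2))"
      unfolding c2 by (simp add: x_def y_def algebra_simps)
    have "2 * s * (of_real (1 + r\<^sub>1) * (s - of_real s\<^sub>1) * laplace m\<^sub>1 y + of_real (1 + r\<^sub>2) * (s - of_real s\<^sub>2) * laplace m\<^sub>2 x) = 0"
      using curve[OF s(1) x_def y_def] unfolding e1 e2 by (simp add: algebra_simps)
    then show "of_real (1 + r\<^sub>1) * (s - of_real s\<^sub>1) * laplace m\<^sub>1 (2 * s * (s - of_real \<mu>\<^sub>1))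
      + of_real (1 + r\<^sub>2) * (s - of_real s\<^sub>2) * laplace m\<^sub>2 (2 * s * (s + of_real \<mu>\<^sub>2)) = 0"
      using s(2) by (simp only: x_def y_def mult_eq_0_iff) simp
  qed (use mu k n' m in auto)
  have root: "root = C.root_y" by (simp add: \<open>root = _\<close> C.root_y_def[abs_def])
  have gam: "\<gamma> = (of_int (n\<^sub>1 + n\<^sub>2) - 1) / 2"
    using n' mu(3) \<open>\<gamma> = _\<close> by simp
  \<comment> \<open>Otherwise \<open>\<gamma> = (\<gamma>\<^sub>1 + \<gamma>\<^sub>2 - 1) / 2\<close> would be an integer.\<close>
  have par: "even n\<^sub>1 \<longleftrightarrow> even n\<^sub>2"
  proof (rule ccontr)
    assume "\<not> ?thesis"
    then have "odd (n\<^sub>1 + n\<^sub>2)" by simp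
    then obtain j where "n\<^sub>1 + n\<^sub>2 = 2 * j + 1" by (rule oddE)
    then have "\<gamma> = of_int j" using gam by simp
    then show False using \<open>\<gamma> \<notin> \<int>\<close> by simp
  qed
  have sign1: "of_int n\<^sub>1 * (1 + r\<^sub>1) > 0"
  proof -
    have "of_int n\<^sub>1 * (1 + r\<^sub>1) = \<mu>\<^sub>1 * (1 + r\<^sub>1) - 2 * ((1 + r\<^sub>1) * s\<^sub>1)" unfolding n' by (simp add: algebra_simps)
    also have "\<dots> = \<mu>\<^sub>1 + \<mu>\<^sub>2 + (\<mu>\<^sub>2 - r\<^sub>1 * \<mu>\<^sub>1)" unfolding s1 by (simp add: algebra_simps)
    finally show ?thesis using mu \<open>\<mu>\<^sub>2 - r\<^sub>1 * \<mu>\<^sub>1 > 0\<close> by simp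
  qed
  have sign2: "of_int n\<^sub>2 * (1 + r\<^sub>2) > 0"
  proof -
    have "of_int n\<^sub>2 * (1 + r\<^sub>2) = \<mu>\<^sub>2 * (1 + r\<^sub>2) + 2 * ((1 + r\<^sub>2) * s\<^sub>2)" unfolding n' by (simp add: algebra_simps)
    also have "\<dots> = \<mu>\<^sub>1 + \<mu>\<^sub>2 + (\<mu>\<^sub>1 - r\<^sub>2 * \<mu>\<^sub>2)" unfolding s2 by (simp add: algebra_simps)
    finally show ?thesis using mu \<open>\<mu>\<^sub>1 - r\<^sub>2 * \<mu>\<^sub>2 > 0\<close> by simp
  qed
  \<comment> \<open>Opposite signs force \<open>\<gamma> < 0\<close>, because \<open>\<gamma> (1 + r\<^sub>1) (1 + r\<^sub>2) = 1 - r\<^sub>1 r\<^sub>2 > 0\<close>.\<close>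
  have sum: "n\<^sub>1 + n\<^sub>2 \<le> 0" if mixed: "(n\<^sub>1 \<le> -1 \<and> n\<^sub>2 \<ge> 1) \<or> (n\<^sub>1 \<ge> 1 \<and> n\<^sub>2 \<le> -1)"
  proof -
    have sg: "(1 + r\<^sub>1 < 0 \<and> 1 + r\<^sub>2 > 0) \<or> (1 + r\<^sub>1 > 0 \<and> 1 + r\<^sub>2 < 0)"
      using mixed sign1 sign2 by (auto simp: zero_less_mult_iff)
    then have "1 - r\<^sub>1 * r\<^sub>2 > 0" using \<open>1 - r\<^sub>1 * r\<^sub>2 > 0 \<or> _\<close> by auto
    moreover have "\<gamma> * ((1 + r\<^sub>1) * (1 + r\<^sub>2)) = 1 - r\<^sub>1 * r\<^sub>2"
    proof -
      have "\<gamma> * ((1 + r\<^sub>1) * (1 + r\<^sub>2)) = ((1 + r\<^sub>2) * s\<^sub>2) * (1 + r\<^sub>1) - ((1 + r\<^sub>1) * s\<^sub>1) * (1 + r\<^sub>2)"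
        unfolding \<open>\<gamma> = s\<^sub>2 - s\<^sub>1\<close> by (simp add: algebra_simps)
      also have "\<dots> = (\<mu>\<^sub>1 + \<mu>\<^sub>2) * (1 - r\<^sub>1 * r\<^sub>2)" unfolding s1 s2 by (simp add: algebra_simps)
      finally show ?thesis using mu by simp
    qed
    moreover have "(1 + r\<^sub>1) * (1 + r\<^sub>2) < 0" using sg by (auto simp: mult_less_0_iff)
    ultimately have "\<gamma> < 0" by (metis less_asym mult_neg_neg mult_nonneg_nonpos2 not_le less_le mult_zero_left not_less_iff_gr_or_eq mult_pos_neg)
    then have "real_of_int (n\<^sub>1 + n\<^sub>2) < 1" using gam by simp
    then show ?thesis by linarith
  qed
  have lap: "\<phi>\<^sub>1 = laplace m\<^sub>1" if "measure m\<^sub>1 {0} = 0"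
    unfolding \<open>\<phi>\<^sub>1 = _\<close> lat by (rule ext) (rule laplace_restrict_positive[OF m(1) that])
  have d1: "s\<^sub>1 - \<mu>\<^sub>1 / 2 = - of_int n\<^sub>1 / 2" and d2: "s\<^sub>2 - \<mu>\<^sub>1 / 2 = (of_int n\<^sub>2 - 1) / 2"
    using n' mu(3) by simp_all
  note Y = \<open>Y = y_par \<mu>\<^sub>1\<close>
  have tan_case: "\<exists>(c::real) P Q. P = centred_poly \<mu>\<^sub>1 N \<and> Q = centred_poly \<mu>\<^sub>1 D \<and>
      eq_on_left_half_plane \<phi>\<^sub>1 (\<lambda>y. of_real c * (cpoly P y * tan (of_real (pi / 2) * root y)) / (cpoly Q y * root y))"
    if cs: "(even n\<^sub>1 \<and> n\<^sub>1 \<le> -1 \<and> n\<^sub>2 \<ge> 1 \<and> N = nat n\<^sub>2 \<and> D = nat (1 - n\<^sub>1)) \<or>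
      (odd n\<^sub>2 \<and> n\<^sub>2 \<le> -1 \<and> n\<^sub>1 \<ge> 1 \<and> N = nat (n\<^sub>1 - 1) \<and> D = nat (- n\<^sub>2))" for N D
  proof -
    have nn: "n\<^sub>1 + n\<^sub>2 \<le> 0" using sum cs by blast
    obtain c where c: "measure m\<^sub>1 {0} = 0"
      "\<And>y. Re y \<le> 0 \<Longrightarrow> ((\<lambda>y. of_real c * (C.centred N y * tan (of_real (pi / 2) * C.root_y y)) / (C.centred D y * C.root_y y)) \<longlongrightarrow> laplace m\<^sub>1 y) (at y)"
      using C.tangent_formula[OF nn par cs] by blast
    then show ?thesis unfolding eq_on_left_half_plane_def root lap[OF c(1)] C.centred_def by blast
  qed
  have cot_case: "\<exists>(c::real) P Q. P = centred_poly \<mu>\<^sub>1 N \<and> Q = centred_poly \<mu>\<^sub>1 D \<and>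
      eq_on_left_half_plane \<phi>\<^sub>1 (\<lambda>y. of_real c * (cpoly P y * root y) / (cpoly Q y * tan (of_real (pi / 2) * root y)))"
    if cs: "(odd n\<^sub>1 \<and> n\<^sub>1 \<le> -1 \<and> n\<^sub>2 \<ge> 1 \<and> N = nat n\<^sub>2 \<and> D = nat (1 - n\<^sub>1)) \<or>
      (even n\<^sub>2 \<and> n\<^sub>2 \<le> -1 \<and> n\<^sub>1 \<ge> 1 \<and> N = nat (n\<^sub>1 - 1) \<and> D = nat (- n\<^sub>2))" for N D
  proof -
    have nn: "n\<^sub>1 + n\<^sub>2 \<le> 0" using sum cs by blast
    obtain c where c: "measure m\<^sub>1 {0} = 0"
      "\<And>y. Re y \<le> 0 \<Longrightarrow> ((\<lambda>y. of_real c * (C.centred N y * C.root_y y) / (C.centred D y * tan (of_real (pi / 2) * C.root_y y))) \<longlongrightarrow> laplace m\<^sub>1 y) (at y)"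
      using C.cotangent_formula[OF nn par cs] by blast
    then show ?thesis unfolding eq_on_left_half_plane_def root lap[OF c(1)] C.centred_def by blast
  qed
  have as_int: "n\<^sub>1 = j" if "\<gamma>\<^sub>1 = of_int j" for j using that n by simp
  have as_int2: "n\<^sub>2 = j" if "\<gamma>\<^sub>2 = of_int j" for j using that n by simp
  show ?thesis
  proof (intro conjI impI, goal_cases)
    case 1
    then obtain a b :: nat where ab: "\<gamma>\<^sub>1 = - 2 * real a" "a \<ge> 1" "\<gamma>\<^sub>2 = 2 * real b" "b \<ge> 1" by blast
    have i: "n\<^sub>1 = - 2 * int a" "n\<^sub>2 = 2 * int b" using ab by (auto intro!: as_int as_int2)
    have P: "(\<Prod>k\<in>{0..\<lfloor>\<gamma>\<^sub>2 / 2\<rfloor> - 1}. [:- Y (s\<^sub>2 - of_int k), 1:]) = centred_poly \<mu>\<^sub>1 (nat n\<^sub>2)"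
      unfolding Y by (rule centred_poly_eqI) (use ab i d2 in auto)
    have Q: "(\<Prod>k\<in>{0..\<lfloor>- \<gamma>\<^sub>1 / 2\<rfloor> - 1}. [:- Y (s\<^sub>1 - of_int k), 1:]) = centred_poly \<mu>\<^sub>1 (nat (1 - n\<^sub>1))"
      unfolding Y by (rule centred_poly_eqI) (use ab i d1 in auto)
    show ?case
      unfolding P Q by (rule tan_case) (use i ab in auto)
  next
    case 2
    then obtain a b :: nat where ab: "\<gamma>\<^sub>1 = 2 * real a - 1" "a \<ge> 1" "\<gamma>\<^sub>2 = - 2 * real b + 1" "b \<ge> 1" by blast
    have i: "n\<^sub>1 = 2 * int a - 1" "n\<^sub>2 = - 2 * int b + 1" using ab by (auto intro!: as_int as_int2)
    have "(\<gamma>\<^sub>1 - 1) / 2 = real_of_int (int a - 1)" "- (\<gamma>\<^sub>2 + 1) / 2 = real_of_int (int b - 1)" using ab by simp_all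
    then have fl: "\<lfloor>(\<gamma>\<^sub>1 - 1) / 2\<rfloor> = int a - 1" "\<lfloor>- (\<gamma>\<^sub>2 + 1) / 2\<rfloor> = int b - 1" by (simp_all only: floor_of_int)
    have N: "nat (n\<^sub>1 - 1) = 2 * (a - 1)" "nat (- n\<^sub>2) = 2 * (b - 1) + 1" using i ab by linarith+
    have P: "(\<Prod>k\<in>{1..\<lfloor>(\<gamma>\<^sub>1 - 1) / 2\<rfloor>}. [:- Y (s\<^sub>1 + of_int k), 1:]) = centred_poly \<mu>\<^sub>1 (nat (n\<^sub>1 - 1))"
      unfolding Y fl N by (rule centred_poly_eqI) (use ab i d1 in \<open>auto simp: of_nat_diff\<close>)
    have Q: "(\<Prod>k\<in>{1..\<lfloor>- (\<gamma>\<^sub>2 + 1) / 2\<rfloor>}. [:- Y (s\<^sub>2 + of_int k), 1:]) = centred_poly \<mu>\<^sub>1 (nat (- n\<^sub>2))"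
      unfolding Y fl N by (rule centred_poly_eqI) (use ab i d2 in \<open>auto simp: of_nat_diff\<close>)
    show ?case
      unfolding P Q by (rule tan_case) (use i ab in auto)
  next
    case 3
    then obtain a b :: nat where ab: "\<gamma>\<^sub>1 = 2 * real a" "a \<ge> 1" "\<gamma>\<^sub>2 = - 2 * real b" "b \<ge> 1" by blast
    have i: "n\<^sub>1 = 2 * int a" "n\<^sub>2 = - 2 * int b" using ab by (auto intro!: as_int as_int2)
    have P: "(\<Prod>k\<in>{1..\<lfloor>\<gamma>\<^sub>1 / 2\<rfloor> - 1}. [:- Y (s\<^sub>1 + of_int k), 1:]) = centred_poly \<mu>\<^sub>1 (nat (n\<^sub>1 - 1))"
      unfolding Y by (rule centred_poly_eqI) (use ab i d1 in auto)
    have Q: "(\<Prod>k\<in>{1..\<lfloor>- \<gamma>\<^sub>2 / 2\<rfloor>}. [:- Y (s\<^sub>2 + of_int k), 1:]) = centred_poly \<mu>\<^sub>1 (nat (- n\<^sub>2))"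
      unfolding Y by (rule centred_poly_eqI) (use ab i d2 in auto)
    show ?case
      unfolding P Q by (rule cot_case) (use i ab in auto)
  next
    case 4
    then obtain a b :: nat where ab: "\<gamma>\<^sub>1 = - 2 * real a + 1" "a \<ge> 1" "\<gamma>\<^sub>2 = 2 * real b - 1" "b \<ge> 1" by blast
    have i: "n\<^sub>1 = - 2 * int a + 1" "n\<^sub>2 = 2 * int b - 1" using ab by (auto intro!: as_int as_int2)
    have "(\<gamma>\<^sub>2 - 1) / 2 = real_of_int (int b - 1)" "- (\<gamma>\<^sub>1 + 1) / 2 = real_of_int (int a - 1)" using ab by simp_all
    then have fl: "\<lfloor>(\<gamma>\<^sub>2 - 1) / 2\<rfloor> = int b - 1" "\<lfloor>- (\<gamma>\<^sub>1 + 1) / 2\<rfloor> = int a - 1" by (simp_all only: floor_of_int)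
    have N: "nat n\<^sub>2 = 2 * (b - 1) + 1" "nat (1 - n\<^sub>1) = 2 * a" using i ab by linarith+
    have P: "(\<Prod>k\<in>{0..\<lfloor>(\<gamma>\<^sub>2 - 1) / 2\<rfloor> - 1}. [:- Y (s\<^sub>2 - of_int k), 1:]) = centred_poly \<mu>\<^sub>1 (nat n\<^sub>2)"
      unfolding Y fl N by (rule centred_poly_eqI) (use ab i d2 in \<open>auto simp: of_nat_diff\<close>)
    have Q: "(\<Prod>k\<in>{0..\<lfloor>- (\<gamma>\<^sub>1 + 1) / 2\<rfloor>}. [:- Y (s\<^sub>1 - of_int k), 1:]) = centred_poly \<mu>\<^sub>1 (nat (1 - n\<^sub>1))"
      unfolding Y fl N by (rule centred_poly_eqI) (use ab i d1 in \<open>auto simp: of_nat_diff\<close>)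
    show ?case
      unfolding P Q by (rule cot_case) (use i ab in auto)
  next
    case 5
    then obtain a b :: nat where ab: "\<gamma>\<^sub>1 = real a" "a \<ge> 1" "\<gamma>\<^sub>2 = real b" "b \<ge> 1" by blast
    have i: "n\<^sub>1 = int a" "n\<^sub>2 = int b" using ab by (auto intro!: as_int as_int2)
    have fl: "\<lfloor>(\<gamma>\<^sub>1 - 1) / 2\<rfloor> = (n\<^sub>1 - 1) div 2" "\<lfloor>\<gamma>\<^sub>2 / 2 - 1\<rfloor> = n\<^sub>2 div 2 - 1"
      using floor_divide_of_int_eq[of "n\<^sub>1 - 1" 2, where 'a = real] floor_divide_of_int_eq[of n\<^sub>2 2, where 'a = real] n by simp_all
    have P: "(\<Prod>k\<in>{1..\<lfloor>(\<gamma>\<^sub>1 - 1) / 2\<rfloor>}. [:- Y (s\<^sub>1 + of_int k), 1:]) = centred_poly \<mu>\<^sub>1 (nat (n\<^sub>1 - 1))"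
      unfolding Y fl by (rule centred_poly_eqI) (use ab i d1 in \<open>auto simp: zdiv_int of_nat_diff\<close>)
    have Q: "(\<Prod>k\<in>{0..\<lfloor>\<gamma>\<^sub>2 / 2 - 1\<rfloor>}. [:- Y (s\<^sub>2 - of_int k), 1:]) = centred_poly \<mu>\<^sub>1 (nat n\<^sub>2)"
      unfolding Y fl by (rule centred_poly_eqI) (use ab i d2 in \<open>auto simp: zdiv_int\<close>)
    have n1: "n\<^sub>1 \<ge> 1" "n\<^sub>2 \<ge> 1" using i ab by auto
    obtain c where c: "measure m\<^sub>1 {0} = 0"
      "\<And>y. Re y \<le> 0 \<Longrightarrow> ((\<lambda>y. of_real c * (C.centred (nat (n\<^sub>1 - 1)) y * C.centred (nat n\<^sub>2) y * C.root_y y) / sin (of_real pi * C.root_y y)) \<longlongrightarrow> laplace m\<^sub>1 y) (at y)"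
      using C.sine_formula[OF n1 par] by blast
    have "eq_on_left_half_plane \<phi>\<^sub>1 (\<lambda>y. of_real c * (cpoly (centred_poly \<mu>\<^sub>1 (nat (n\<^sub>1 - 1)) * centred_poly \<mu>\<^sub>1 (nat n\<^sub>2)) y * root y) / sin (of_real pi * root y))"
      using c(2) unfolding eq_on_left_half_plane_def root lap[OF c(1)] C.centred_def map_poly_of_real_mult poly_mult by blast
    then show ?case
      unfolding P Q by blast
  qed
qed

end
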